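(* Let $E\to M$ be a holomorphic vector bundle of rank $6$ or $7$ on a complex manifold $M$. Assume that $H^2(M,Der_4(\Lambda E))=H^2(M,Der_6(\Lambda E))=0$. (1) A cochain $u_2\in C^1(M,Der_2(\Lambda E))$ admits a $u\in\tilde C^1(M,Der^{(2)}(\Lambda E))$ with $pr_2(u)=u_2$ if and only if $u_2\in\tilde Z^1(M,Der_2(\Lambda E))$. (2) If in addition $H^0(M,Der^{(2)}(\Lambda E))=0$, then there is an admissible family $D'=(D'_{2q})_{q\ge2}$ such that $$\sigma_D:\ H^1(M,G_E)\to\frac{\tilde Z^1(M,Der_2(\Lambda E))}{B^1(M,Der_2(\Lambda E))}\oplus H^1(M,Der_4(\Lambda E))\oplus H^1(M,Der_6(\Lambda E)),$$ $$\sigma_D([\exp(u)])=\Big[u+\sum_{q\ge2}D'_{2q}(u)\Big]\qquad(u\in\tilde C^1(M,Der^{(2)}(\Lambda E))),$$ is a well-defined bijection.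
   Context: Sheaves. $\mathcal O_{\Lambda E}$ is the sheaf of holomorphic sections of the exterior algebra bundle $\Lambda E$, a $\mathbb Z$-graded (hence $\mathbb Z/2\mathbb Z$-graded) sheaf of algebras. $Der(\Lambda E)$ and $End(\Lambda E)$ are the sheaves of even $\mathbb C$-linear derivations, resp. endomorphisms, of $\mathcal O_{\Lambda E}$; $Der_{2k}(\Lambda E)$, $End_{2k}(\Lambda E)$ are the parts sending $\mathcal O_{\Lambda^jE}$ to $\mathcal O_{\Lambda^{j+2k}E}$ for all $j\ge 0$. Put $Der^{(2)}(\Lambda E)=\bigoplus_{k\ge1}Der_{2k}(\Lambda E)$ and $End^{(2)}(\Lambda E)=\bigoplus_{k\geq 1}End_{2k}(\Lambda E)$. $pr_{2k}$ denotes the projection onto the degree-$2k$ component, and $pr_{(2k)}$ the projection onto the sum of the components of degrees $2,4,\dots,2k$ (applied to an automorphism of the form $Id+\text{(element of }End^{(2)})$, these projections ignore the summand $Id$). $G_E$ is the sheaf of automorphisms $\varphi$ of the $\mathbb Z/2\mathbb Z$-graded sheaf of algebras $\mathcal O_{\Lambda E}$ with $(\varphi-Id)(\mathcal O_{\Lambda^jE})\subset\bigoplus_{k\ge1}\mathcal O_{\Lambda^{j+2k}E}$ for all $j\geq 0$. The (finite) exponential series gives a bijection $\exp:Der^{(2)}(\Lambda E)\to G_E$ (known fact). Cochains. All cochains are Čech cochains on a fixed open cover of $M$ that is a Leray cover for coherent sheaves. 1-cochains $u=(u_{ij})$ of derivations are alternating ($u_{ji}=-u_{ij}$); 2-cochains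 are not required to be alternating. $d$ is the usual additive Čech coboundary, so for $w\in C^1(M,End^{(2)}(\Lambda E))$ one has $(dw)_{ijk}=w_{jk}-w_{ik}+w_{ij}$; $Z^\bullet$, $B^\bullet$ denote additive cocycles and coboundaries. The multiplicative coboundary is $(\mathbf d\exp(u))_{ijk}=\exp(u_{ij})\exp(u_{jk})\exp(u_{ki})$. $Z^1(M,G_E)$ is the set of $\exp(u)$ with $\mathbf d\exp(u)=Id$. For $v\in C^0(M,Der^{(2)}(\Lambda E))$ put $(\exp(v).\exp(u))_{ij}=\exp(v_i)\exp(u_{ij})\exp(-v_j)$; $H^1(M,G_E)$ is the set of orbits of this action on $Z^1(M,G_E)$. Let $\tilde C^1(M,Der^{(2)}(\Lambda E))=\{u\in C^1(M,Der^{(2)}(\Lambda E)) : \exp(u)\in Z^1(M,G_E)\}$. The maps $R_{2q}$. For $q\ge2$ and $u\in C^1(M,Der^{(2)}(\Lambda E))$ put $R_{2q}(u)=pr_{2q}\big(\mathbf d\exp(pr_{(2q-2)}(u))\big)\in C^2(M,End_{2q}(\Lambda E))$. For $u\in\tilde C^1(M,Der^{(2)}(\Lambda E))$ one has $R_{2q}(u)=-d(pr_{2q}(u))$. Define $$\tilde Z^1(M,Der_2(\Lambda E))=\{u_2\in Z^1(M,Der_2(\Lambda E)) : R_4(u_2)\in C^2(M,Der_4(\Lambda E))\text{ and }R_6(u_2)\in C^2(M,Der_6(\Lambda E))\}.$$ The quotient $\tilde Z^1(M,Der_2(\Lambda E))/B^1(M,Der_2(\Lambda E))$ is the set of classes in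 $H^1(M,Der_2(\Lambda E))$ of elements of $\tilde Z^1(M,Der_2(\Lambda E))$, and the target of $\sigma_D$ is regarded as a subset of $H^1(M,Der^{(2)}(\Lambda E))=\bigoplus_{k=1}^3H^1(M,Der_{2k}(\Lambda E))$ (for rank $6$ or $7$, $Der_{2k}(\Lambda E)=0$ for $k\ge4$). Admissible family. This is a family of maps $D'_{2q}:\tilde C^1(M,Der^{(2)}(\Lambda E))\to C^1(M,Der_{2q}(\Lambda E))$, $q\ge2$, such that $D'_{2q}(u)$ depends only on $pr_{(2q-2)}(u)$ and $d\,D'_{2q}(u)=R_{2q}(u)$ for all $u\in \tilde C^1(M,Der^{(2)}(\Lambda E))$. *)

theory Defs
  imports "HOL-Analysis.Analysis" "HOL-Library.Function_Algebras" "HOL-Algebra.Module"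
begin

text \<open>
  Sections, sheaf endomorphisms and cochains are all (curried) functions with values in the
  complex numbers, so that 0, +, - and finite sums of them are the pointwise ones of
  \<^theory>\<open>HOL-Library.Function_Algebras\<close>. A section over \<open>V\<close> is made extensional by the value 0
  off \<open>V\<close>, and a sheaf endomorphism over \<open>U\<close> by the value 0 on everything that is not a section
  over an open subset of \<open>U\<close>.
\<close>


section \<open>Complex manifolds\<close>

text \<open>The space \<open>C\<^sup>n\<close> (including \<open>n = 0\<close>), with the topology induced by the product topology.\<close>

definition Cn :: "nat \<Rightarrow> (nat \<Rightarrow> complex) set" where
  "Cn n = {z. \<forall>i\<ge>n. z i = 0}"

text \<open>Holomorphic functions of several variables: continuous and holomorphic in each variable.\<close>

definition holo_Cn :: "nat \<Rightarrow> (nat \<Rightarrow> complex) set \<Rightarrow> ((nat \<Rightarrow> complex) \<Rightarrow> complex) \<Rightarrow> bool" where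
  "holo_Cn n W f \<longleftrightarrow>
     continuous_on W f \<and>
     (\<forall>z\<in>W. \<forall>i<n. (\<lambda>t. f (z(i := t))) field_differentiable (at (z i)))"

record 'a cmanifold =
  cdim :: nat
  charts :: "('a set \<times> ('a \<Rightarrow> nat \<Rightarrow> complex)) set"

definition complex_manifold ::
    "('a::{t2_space,second_countable_topology}, 'z) cmanifold_scheme \<Rightarrow> bool" where
  "complex_manifold M \<longleftrightarrow>
     (\<forall>(W, \<phi>)\<in>charts M.
        open W \<and> openin (top_of_set (Cn (cdim M))) (\<phi> ` W) \<and>
        homeomorphism W (\<phi> ` W) \<phi> (inv_into W \<phi>)) \<and>
     (\<Union>(W, \<phi>)\<in>charts M. W) = UNIV \<and>
     (\<forall>(W, \<phi>)\<in>charts M. \<forall>(W', \<phi>')\<in>charts M. \<forall>k<cdim M.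
        holo_Cn (cdim M) (\<phi> ` (W \<inter> W')) (\<lambda>z. \<phi>' (inv_into W \<phi> z) k))"

definition holo :: "('a, 'z) cmanifold_scheme \<Rightarrow> 'a set \<Rightarrow> ('a \<Rightarrow> complex) \<Rightarrow> bool" where
  "holo M V f \<longleftrightarrow>
     (\<forall>(W, \<phi>)\<in>charts M. holo_Cn (cdim M) (\<phi> ` (W \<inter> V)) (\<lambda>z. f (inv_into W \<phi> z)))"


section \<open>Holomorphic vector bundles\<close>

text \<open>
  A bundle with total space \<^typ>\<open>'e\<close> is given by its projection and a bundle atlas: a set of pairs
  \<open>(W, h)\<close> where \<open>e \<mapsto> (proj e, h e)\<close> is a trivialisation of the bundle over \<open>W\<close>. The complex vector
  space structure of the fibres and the topology and complex structure of the total space are those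
  carried over by the trivialisations; they are well defined because the transition maps are
  linear on fibres and have holomorphic matrix entries.
\<close>

record ('a, 'e) vbundle = "'a cmanifold" +
  rk :: nat
  proj :: "'e \<Rightarrow> 'a"
  trivs :: "('a set \<times> ('e \<Rightarrow> nat \<Rightarrow> complex)) set"

type_synonym ('a, 'e) triv = "'a set \<times> ('e \<Rightarrow> nat \<Rightarrow> complex)"

definition fibre :: "('a, 'e) vbundle \<Rightarrow> 'a \<Rightarrow> 'e set" where
  "fibre E x = {e. proj E e = x}"

text \<open>Column \<open>j\<close> of the transition matrix holds the \<open>t\<close>-coordinates of the vector whose
  \<open>t'\<close>-coordinates are the \<open>j\<close>-th standard basis vector.\<close>

definition transition ::
    "('a, 'e) vbundle \<Rightarrow> ('a, 'e) triv \<Rightarrow> ('a, 'e) triv \<Rightarrow> 'a \<Rightarrow> nat \<Rightarrow> nat \<Rightarrow> complex" where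
  "transition E t t' x i j =
     snd t (inv_into (fibre E x) (snd t') (\<lambda>l. if l = j then 1 else 0)) i"

definition holomorphic_vector_bundle ::
    "('a::{t2_space,second_countable_topology}, 'e) vbundle \<Rightarrow> bool" where
  "holomorphic_vector_bundle E \<longleftrightarrow>
     complex_manifold E \<and>
     (\<forall>t\<in>trivs E. open (fst t) \<and> (\<forall>x\<in>fst t. bij_betw (snd t) (fibre E x) (Cn (rk E)))) \<and>
     (\<Union>t\<in>trivs E. fst t) = UNIV \<and>
     (\<forall>t\<in>trivs E. \<forall>t'\<in>trivs E. \<forall>i<rk E.
        (\<forall>j<rk E. holo E (fst t \<inter> fst t') (\<lambda>x. transition E t t' x i j)) \<and>
        (\<forall>x\<in>fst t \<inter> fst t'. \<forall>e\<in>fibre E x.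
           snd t e i = (\<Sum>j<rk E. transition E t t' x i j * snd t' e j)))"


section \<open>The exterior algebra bundle and its sheaf of sections\<close>

text \<open>
  The exterior algebra of \<open>C\<^sup>r\<close>: the function \<open>a\<close> stands for the sum over \<open>I \<subseteq> {..<r}\<close> of
  \<open>a I \<cdot> e\<^sub>I\<close>, where \<open>e\<^sub>I\<close> is the wedge product of the \<open>e\<^sub>i\<close>, \<open>i \<in> I\<close>, in increasing order.
\<close>

definition ext_space :: "nat \<Rightarrow> (nat set \<Rightarrow> complex) set" where
  "ext_space r = {a. \<forall>I. \<not> I \<subseteq> {..<r} \<longrightarrow> a I = 0}"

definition ext_one :: "nat set \<Rightarrow> complex" where
  "ext_one I = (if I = {} then 1 else 0)"

definition wedge_sign :: "nat set \<Rightarrow> nat set \<Rightarrow> complex" where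
  "wedge_sign I J = (-1) ^ card {(i, j). i \<in> I \<and> j \<in> J \<and> j < i}"

definition wedge :: "(nat set \<Rightarrow> complex) \<Rightarrow> (nat set \<Rightarrow> complex) \<Rightarrow> nat set \<Rightarrow> complex" where
  "wedge a b K = (\<Sum>I\<in>Pow K. wedge_sign I (K - I) * a I * b (K - I))"

definition ext_vec :: "nat \<Rightarrow> (nat \<Rightarrow> complex) \<Rightarrow> nat set \<Rightarrow> complex" where
  "ext_vec r v I = (\<Sum>i<r. if I = {i} then v i else 0)"

text \<open>The map of exterior algebras induced by a square matrix \<open>g\<close>, sending \<open>e\<^sub>J\<close> to the wedge
  product of the columns \<open>g e\<^sub>j\<close>, \<open>j \<in> J\<close>, in increasing order.\<close>

definition ext_map ::
    "nat \<Rightarrow> (nat \<Rightarrow> nat \<Rightarrow> complex) \<Rightarrow> (nat set \<Rightarrow> complex) \<Rightarrow> nat set \<Rightarrow> complex" where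
  "ext_map r g a K =
     (\<Sum>J\<in>Pow {..<r}. a J *
        foldr wedge (map (\<lambda>j. ext_vec r (\<lambda>i. g i j)) (sorted_list_of_set J)) ext_one K)"

text \<open>An element of the exterior algebra of the fibre at \<open>x\<close> is the family of its coordinates with
  respect to all trivialisations at \<open>x\<close>.\<close>

definition ext_fibre ::
    "('a, 'e) vbundle \<Rightarrow> 'a \<Rightarrow> (('a, 'e) triv \<Rightarrow> nat set \<Rightarrow> complex) set" where
  "ext_fibre E x =
     {w. (\<forall>t. \<not> (t \<in> trivs E \<and> x \<in> fst t) \<longrightarrow> w t = 0) \<and>
         (\<forall>t\<in>trivs E. x \<in> fst t \<longrightarrow> w t \<in> ext_space (rk E)) \<and>
         (\<forall>t\<in>trivs E. \<forall>t'\<in>trivs E. x \<in> fst t \<inter> fst t' \<longrightarrow>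
            w t = ext_map (rk E) (transition E t t' x) (w t'))}"

type_synonym ('a, 'e) lsec = "'a \<Rightarrow> ('a, 'e) triv \<Rightarrow> nat set \<Rightarrow> complex"

text \<open>The sections over \<open>V\<close> of the sheaf \<open>O\<^bsub>\<Lambda>E\<^esub>\<close>.\<close>

definition OL :: "('a::topological_space, 'e) vbundle \<Rightarrow> 'a set \<Rightarrow> ('a, 'e) lsec set" where
  "OL E V =
     {s. (\<forall>x. x \<notin> V \<longrightarrow> s x = 0) \<and> (\<forall>x\<in>V. s x \<in> ext_fibre E x) \<and>
         (\<forall>t\<in>trivs E. \<forall>I. holo E (fst t \<inter> V) (\<lambda>x. s x t I))}"

definition sec_restrict :: "'a set \<Rightarrow> ('a, 'e) lsec \<Rightarrow> ('a, 'e) lsec" where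
  "sec_restrict V s = (\<lambda>x. if x \<in> V then s x else 0)"

definition sec_scale :: "complex \<Rightarrow> ('a, 'e) lsec \<Rightarrow> ('a, 'e) lsec" where
  "sec_scale c s = (\<lambda>x t I. c * s x t I)"

definition sec_wedge :: "('a, 'e) lsec \<Rightarrow> ('a, 'e) lsec \<Rightarrow> ('a, 'e) lsec" where
  "sec_wedge s s' = (\<lambda>x t. wedge (s x t) (s' x t))"

definition sec_one :: "('a, 'e) vbundle \<Rightarrow> 'a set \<Rightarrow> ('a, 'e) lsec" where
  "sec_one E V = (\<lambda>x t. if x \<in> V \<and> t \<in> trivs E \<and> x \<in> fst t then ext_one else 0)"

text \<open>Sections all of whose components have a degree in \<open>D\<close>.\<close>

definition OL_degs ::
    "('a::topological_space, 'e) vbundle \<Rightarrow> nat set \<Rightarrow> 'a set \<Rightarrow> ('a, 'e) lsec set" where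
  "OL_degs E D V = {s \<in> OL E V. \<forall>x t I. s x t I \<noteq> 0 \<longrightarrow> card I \<in> D}"

definition sec_part :: "nat \<Rightarrow> ('a, 'e) lsec \<Rightarrow> ('a, 'e) lsec" where
  "sec_part j s = (\<lambda>x t I. if card I = j then s x t I else 0)"


section \<open>Sheaves of endomorphisms, derivations and automorphisms\<close>

text \<open>An endomorphism over \<open>U\<close> is the family of its maps on sections over open \<open>V \<subseteq> U\<close>.\<close>

type_synonym ('a, 'e) endo = "'a set \<Rightarrow> ('a, 'e) lsec \<Rightarrow> ('a, 'e) lsec"

definition endo_id :: "('a::topological_space, 'e) vbundle \<Rightarrow> 'a set \<Rightarrow> ('a, 'e) endo" where
  "endo_id E U = (\<lambda>V s. if open V \<and> V \<subseteq> U \<and> s \<in> OL E V then s else 0)"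

definition endo_comp :: "('a, 'e) endo \<Rightarrow> ('a, 'e) endo \<Rightarrow> ('a, 'e) endo" (infixl "\<bullet>\<bullet>" 70) where
  "\<phi> \<bullet>\<bullet> \<psi> = (\<lambda>V s. \<phi> V (\<psi> V s))"

definition endo_restrict :: "'a set \<Rightarrow> ('a, 'e) endo \<Rightarrow> ('a, 'e) endo" where
  "endo_restrict U \<phi> = (\<lambda>V s. if V \<subseteq> U then \<phi> V s else 0)"

definition End :: "('a::topological_space, 'e) vbundle \<Rightarrow> 'a set \<Rightarrow> ('a, 'e) endo set" where
  "End E U =
     {\<phi>. (\<forall>V s. \<not> (open V \<and> V \<subseteq> U \<and> s \<in> OL E V) \<longrightarrow> \<phi> V s = 0) \<and>
         (\<forall>V. open V \<and> V \<subseteq> U \<longrightarrow>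
            (\<forall>s\<in>OL E V. \<phi> V s \<in> OL E V) \<and>
            (\<forall>s\<in>OL E V. \<forall>s'\<in>OL E V. \<phi> V (s + s') = \<phi> V s + \<phi> V s') \<and>
            (\<forall>c. \<forall>s\<in>OL E V. \<phi> V (sec_scale c s) = sec_scale c (\<phi> V s)) \<and>
            (\<forall>s\<in>OL_degs E {j. even j} V. \<phi> V s \<in> OL_degs E {j. even j} V) \<and>
            (\<forall>s\<in>OL_degs E {j. odd j} V. \<phi> V s \<in> OL_degs E {j. odd j} V) \<and>
            (\<forall>V'. open V' \<and> V' \<subseteq> V \<longrightarrow>
               (\<forall>s\<in>OL E V. \<phi> V' (sec_restrict V' s) = sec_restrict V' (\<phi> V s))))}"

definition Der :: "('a::topological_space, 'e) vbundle \<Rightarrow> 'a set \<Rightarrow> ('a, 'e) endo set" where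
  "Der E U =
     {\<delta> \<in> End E U. \<forall>V. open V \<and> V \<subseteq> U \<longrightarrow>
        (\<forall>s\<in>OL E V. \<forall>s'\<in>OL E V.
           \<delta> V (sec_wedge s s') = sec_wedge (\<delta> V s) s' + sec_wedge s (\<delta> V s'))}"

text \<open>In the following the number \<open>m\<close> is the degree itself, written \<open>2k\<close> in the notation
  \<open>End\<^bsub>2k\<^esub>\<close>, \<open>Der\<^bsub>2k\<^esub>\<close>, \<open>pr\<^bsub>2k\<^esub>\<close>, \<open>pr\<^bsub>(2k)\<^esub>\<close>, \<open>R\<^bsub>2q\<^esub>\<close>.\<close>

definition End_deg ::
    "('a::topological_space, 'e) vbundle \<Rightarrow> nat \<Rightarrow> 'a set \<Rightarrow> ('a, 'e) endo set" where
  "End_deg E m U =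
     {\<phi> \<in> End E U. \<forall>V j. open V \<and> V \<subseteq> U \<longrightarrow> (\<forall>s\<in>OL_degs E {j} V. \<phi> V s \<in> OL_degs E {j + m} V)}"

definition Der_deg ::
    "('a::topological_space, 'e) vbundle \<Rightarrow> nat \<Rightarrow> 'a set \<Rightarrow> ('a, 'e) endo set" where
  "Der_deg E m U = Der E U \<inter> End_deg E m U"

text \<open>The sheaf \<open>Der\<^sup>(\<^sup>2\<^sup>)\<close>.\<close>

definition Der_pos ::
    "('a::topological_space, 'e) vbundle \<Rightarrow> 'a set \<Rightarrow> ('a, 'e) endo set" where
  "Der_pos E U = {\<Sum>k=1..K. \<delta> k | K \<delta>. \<forall>k\<in>{1..K}. \<delta> k \<in> Der_deg E (2 * k) U}"

definition pr ::
    "('a::topological_space, 'e) vbundle \<Rightarrow> nat \<Rightarrow> ('a, 'e) endo \<Rightarrow> ('a, 'e) endo" where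
  "pr E m \<phi> =
     (\<lambda>V s. if s \<in> OL E V then \<Sum>j\<le>rk E. sec_part (j + m) (\<phi> V (sec_part j s)) else 0)"

definition pr_upto ::
    "('a::topological_space, 'e) vbundle \<Rightarrow> nat \<Rightarrow> ('a, 'e) endo \<Rightarrow> ('a, 'e) endo" where
  "pr_upto E m \<phi> = (\<Sum>k\<in>{k. 1 \<le> k \<and> 2 * k \<le> m}. pr E (2 * k) \<phi>)"

text \<open>The exponential series of an element of \<open>Der\<^sup>(\<^sup>2\<^sup>)\<close> over \<open>U\<close>. As \<open>\<delta>\<close> raises degrees by at least
  2, its powers beyond the rank vanish.\<close>

definition endo_exp ::
    "('a::topological_space, 'e) vbundle \<Rightarrow> 'a set \<Rightarrow> ('a, 'e) endo \<Rightarrow> ('a, 'e) endo" where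
  "endo_exp E U \<delta> =
     (\<lambda>V s. if open V \<and> V \<subseteq> U \<and> s \<in> OL E V
            then \<Sum>n\<le>rk E. sec_scale (1 / fact n) ((\<delta> V ^^ n) s) else 0)"

definition G :: "('a::topological_space, 'e) vbundle \<Rightarrow> 'a set \<Rightarrow> ('a, 'e) endo set" where
  "G E U =
     {\<phi> \<in> End E U. \<forall>V. open V \<and> V \<subseteq> U \<longrightarrow>
        bij_betw (\<phi> V) (OL E V) (OL E V) \<and>
        \<phi> V (sec_one E V) = sec_one E V \<and>
        (\<forall>s\<in>OL E V. \<forall>s'\<in>OL E V. \<phi> V (sec_wedge s s') = sec_wedge (\<phi> V s) (\<phi> V s')) \<and>
        (\<forall>j. \<forall>s\<in>OL_degs E {j} V. \<phi> V s - s \<in> OL_degs E {j + 2 * k | k. 1 \<le> k} V)}"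


section \<open>Cech cochains with values in sheaves of endomorphisms\<close>

text \<open>In this section \<open>U\<close> is the open cover, indexed by a type, and \<open>F\<close> is a subsheaf of the
  endomorphism sheaf.\<close>

definition open_cover :: "('i \<Rightarrow> 'a::topological_space set) \<Rightarrow> bool" where
  "open_cover U \<longleftrightarrow> (\<forall>i. open (U i)) \<and> (\<Union>i. U i) = UNIV"

definition C0 :: "('i \<Rightarrow> 'a set) \<Rightarrow> ('a set \<Rightarrow> ('a, 'e) endo set) \<Rightarrow> ('i \<Rightarrow> ('a, 'e) endo) set" where
  "C0 U F = {v. \<forall>i. v i \<in> F (U i)}"

definition C1_all ::
    "('i \<Rightarrow> 'a set) \<Rightarrow> ('a set \<Rightarrow> ('a, 'e) endo set) \<Rightarrow> ('i \<Rightarrow> 'i \<Rightarrow> ('a, 'e) endo) set" where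
  "C1_all U F = {u. \<forall>i j. u i j \<in> F (U i \<inter> U j)}"

definition C1 ::
    "('i \<Rightarrow> 'a set) \<Rightarrow> ('a set \<Rightarrow> ('a, 'e) endo set) \<Rightarrow> ('i \<Rightarrow> 'i \<Rightarrow> ('a, 'e) endo) set" where
  "C1 U F = {u \<in> C1_all U F. \<forall>i j. u j i = - u i j}"

definition C2 ::
    "('i \<Rightarrow> 'a set) \<Rightarrow> ('a set \<Rightarrow> ('a, 'e) endo set) \<Rightarrow> ('i \<Rightarrow> 'i \<Rightarrow> 'i \<Rightarrow> ('a, 'e) endo) set" where
  "C2 U F = {w. \<forall>i j k. w i j k \<in> F (U i \<inter> U j \<inter> U k)}"

definition d0 :: "('i \<Rightarrow> 'a set) \<Rightarrow> ('i \<Rightarrow> ('a, 'e) endo) \<Rightarrow> 'i \<Rightarrow> 'i \<Rightarrow> ('a, 'e) endo" where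
  "d0 U v = (\<lambda>i j. endo_restrict (U i \<inter> U j) (v j - v i))"

definition d1 ::
    "('i \<Rightarrow> 'a set) \<Rightarrow> ('i \<Rightarrow> 'i \<Rightarrow> ('a, 'e) endo) \<Rightarrow> 'i \<Rightarrow> 'i \<Rightarrow> 'i \<Rightarrow> ('a, 'e) endo" where
  "d1 U w = (\<lambda>i j k. endo_restrict (U i \<inter> U j \<inter> U k) (w j k - w i k + w i j))"

definition d2 ::
    "('i \<Rightarrow> 'a set) \<Rightarrow> ('i \<Rightarrow> 'i \<Rightarrow> 'i \<Rightarrow> ('a, 'e) endo) \<Rightarrow>
     'i \<Rightarrow> 'i \<Rightarrow> 'i \<Rightarrow> 'i \<Rightarrow> ('a, 'e) endo" where
  "d2 U w = (\<lambda>i j k l. endo_restrict (U i \<inter> U j \<inter> U k \<inter> U l)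
                          (w j k l - w i k l + w i j l - w i j k))"

definition Z1 ::
    "('i \<Rightarrow> 'a set) \<Rightarrow> ('a set \<Rightarrow> ('a, 'e) endo set) \<Rightarrow> ('i \<Rightarrow> 'i \<Rightarrow> ('a, 'e) endo) set" where
  "Z1 U F = {u \<in> C1 U F. d1 U u = 0}"

definition B1 ::
    "('i \<Rightarrow> 'a set) \<Rightarrow> ('a set \<Rightarrow> ('a, 'e) endo set) \<Rightarrow> ('i \<Rightarrow> 'i \<Rightarrow> ('a, 'e) endo) set" where
  "B1 U F = d0 U ` C0 U F"

definition H1_class ::
    "('i \<Rightarrow> 'a set) \<Rightarrow> ('a set \<Rightarrow> ('a, 'e) endo set) \<Rightarrow> ('i \<Rightarrow> 'i \<Rightarrow> ('a, 'e) endo) \<Rightarrow>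
     ('i \<Rightarrow> 'i \<Rightarrow> ('a, 'e) endo) set" where
  "H1_class U F z = {z + b | b. b \<in> B1 U F}"

definition H1 ::
    "('i \<Rightarrow> 'a set) \<Rightarrow> ('a set \<Rightarrow> ('a, 'e) endo set) \<Rightarrow> ('i \<Rightarrow> 'i \<Rightarrow> ('a, 'e) endo) set set" where
  "H1 U F = H1_class U F ` Z1 U F"

definition H0_vanishes :: "('i \<Rightarrow> 'a set) \<Rightarrow> ('a set \<Rightarrow> ('a, 'e) endo set) \<Rightarrow> bool" where
  "H0_vanishes U F \<longleftrightarrow> (\<forall>v\<in>C0 U F. d0 U v = 0 \<longrightarrow> v = 0)"

text \<open>Since 2-cochains need not be alternating, coboundaries of arbitrary 1-cochains have to be
  divided out here; only then is the quotient the second cohomology group.\<close>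

definition H2_vanishes :: "('i \<Rightarrow> 'a set) \<Rightarrow> ('a set \<Rightarrow> ('a, 'e) endo set) \<Rightarrow> bool" where
  "H2_vanishes U F \<longleftrightarrow> (\<forall>w\<in>C2 U F. d2 U w = 0 \<longrightarrow> w \<in> d1 U ` C1_all U F)"


section \<open>Non-abelian cohomology\<close>

definition exp_cochain ::
    "('a::topological_space, 'e) vbundle \<Rightarrow> ('i \<Rightarrow> 'a set) \<Rightarrow>
     ('i \<Rightarrow> 'i \<Rightarrow> ('a, 'e) endo) \<Rightarrow> 'i \<Rightarrow> 'i \<Rightarrow> ('a, 'e) endo" where
  "exp_cochain E U u = (\<lambda>i j. endo_exp E (U i \<inter> U j) (u i j))"

definition mult_cobdry ::
    "('i \<Rightarrow> 'a set) \<Rightarrow> ('i \<Rightarrow> 'i \<Rightarrow> ('a, 'e) endo) \<Rightarrow> 'i \<Rightarrow> 'i \<Rightarrow> 'i \<Rightarrow> ('a, 'e) endo" where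
  "mult_cobdry U g = (\<lambda>i j k. endo_restrict (U i \<inter> U j \<inter> U k) (g i j \<bullet>\<bullet> g j k \<bullet>\<bullet> g k i))"

definition Z1_G ::
    "('a::topological_space, 'e) vbundle \<Rightarrow> ('i \<Rightarrow> 'a set) \<Rightarrow> ('i \<Rightarrow> 'i \<Rightarrow> ('a, 'e) endo) set" where
  "Z1_G E U =
     {g \<in> exp_cochain E U ` C1 U (Der_pos E).
        (\<forall>i j. g i j \<in> G E (U i \<inter> U j)) \<and>
        mult_cobdry U g = (\<lambda>i j k. endo_id E (U i \<inter> U j \<inter> U k))}"

definition act ::
    "('a::topological_space, 'e) vbundle \<Rightarrow> ('i \<Rightarrow> 'a set) \<Rightarrow> ('i \<Rightarrow> ('a, 'e) endo) \<Rightarrow>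
     ('i \<Rightarrow> 'i \<Rightarrow> ('a, 'e) endo) \<Rightarrow> 'i \<Rightarrow> 'i \<Rightarrow> ('a, 'e) endo" where
  "act E U v g = (\<lambda>i j. endo_restrict (U i \<inter> U j)
                          (endo_exp E (U i) (v i) \<bullet>\<bullet> g i j \<bullet>\<bullet> endo_exp E (U j) (- v j)))"

definition orbit ::
    "('a::topological_space, 'e) vbundle \<Rightarrow> ('i \<Rightarrow> 'a set) \<Rightarrow>
     ('i \<Rightarrow> 'i \<Rightarrow> ('a, 'e) endo) \<Rightarrow> ('i \<Rightarrow> 'i \<Rightarrow> ('a, 'e) endo) set" where
  "orbit E U g = {act E U v g | v. v \<in> C0 U (Der_pos E)}"

definition H1_G ::
    "('a::topological_space, 'e) vbundle \<Rightarrow> ('i \<Rightarrow> 'a set) \<Rightarrow> ('i \<Rightarrow> 'i \<Rightarrow> ('a, 'e) endo) set set" where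
  "H1_G E U = orbit E U ` Z1_G E U"

definition C1_tilde ::
    "('a::topological_space, 'e) vbundle \<Rightarrow> ('i \<Rightarrow> 'a set) \<Rightarrow> ('i \<Rightarrow> 'i \<Rightarrow> ('a, 'e) endo) set" where
  "C1_tilde E U = {u \<in> C1 U (Der_pos E). exp_cochain E U u \<in> Z1_G E U}"


section \<open>The maps \<open>R\<close> and the map \<open>\<sigma>\<close>\<close>

definition pr_cochain ::
    "('a::topological_space, 'e) vbundle \<Rightarrow> nat \<Rightarrow>
     ('i \<Rightarrow> 'i \<Rightarrow> ('a, 'e) endo) \<Rightarrow> 'i \<Rightarrow> 'i \<Rightarrow> ('a, 'e) endo" where
  "pr_cochain E m u = (\<lambda>i j. pr E m (u i j))"

definition pr_upto_cochain ::
    "('a::topological_space, 'e) vbundle \<Rightarrow> nat \<Rightarrow>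
     ('i \<Rightarrow> 'i \<Rightarrow> ('a, 'e) endo) \<Rightarrow> 'i \<Rightarrow> 'i \<Rightarrow> ('a, 'e) endo" where
  "pr_upto_cochain E m u = (\<lambda>i j. pr_upto E m (u i j))"

definition R ::
    "('a::topological_space, 'e) vbundle \<Rightarrow> ('i \<Rightarrow> 'a set) \<Rightarrow> nat \<Rightarrow>
     ('i \<Rightarrow> 'i \<Rightarrow> ('a, 'e) endo) \<Rightarrow> 'i \<Rightarrow> 'i \<Rightarrow> 'i \<Rightarrow> ('a, 'e) endo" where
  "R E U m u = (\<lambda>i j k. pr E m (mult_cobdry U (exp_cochain E U (pr_upto_cochain E (m - 2) u)) i j k))"

definition Z1_tilde ::
    "('a::topological_space, 'e) vbundle \<Rightarrow> ('i \<Rightarrow> 'a set) \<Rightarrow> ('i \<Rightarrow> 'i \<Rightarrow> ('a, 'e) endo) set" where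
  "Z1_tilde E U =
     {u \<in> Z1 U (Der_deg E 2). R E U 4 u \<in> C2 U (Der_deg E 4) \<and> R E U 6 u \<in> C2 U (Der_deg E 6)}"

text \<open>The component \<open>D' q\<close> has degree \<open>2q\<close>.\<close>

definition admissible ::
    "('a::topological_space, 'e) vbundle \<Rightarrow> ('i \<Rightarrow> 'a set) \<Rightarrow>
     (nat \<Rightarrow> ('i \<Rightarrow> 'i \<Rightarrow> ('a, 'e) endo) \<Rightarrow> 'i \<Rightarrow> 'i \<Rightarrow> ('a, 'e) endo) \<Rightarrow> bool" where
  "admissible E U D' \<longleftrightarrow>
     (\<forall>q\<ge>2.
        (\<forall>u\<in>C1_tilde E U. D' q u \<in> C1 U (Der_deg E (2 * q)) \<and> d1 U (D' q u) = R E U (2 * q) u) \<and>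
        (\<forall>u\<in>C1_tilde E U. \<forall>u'\<in>C1_tilde E U.
           pr_upto_cochain E (2 * q - 2) u = pr_upto_cochain E (2 * q - 2) u' \<longrightarrow> D' q u = D' q u'))"

text \<open>The direct sum of \<open>Z1_tilde / B1\<close> in degree 2 and the first cohomologies in degrees 4 and 6,
  as a subset of the first cohomology of \<open>Der\<^sup>(\<^sup>2\<^sup>)\<close>: sums of cosets are taken elementwise.\<close>

definition sigma_target ::
    "('a::topological_space, 'e) vbundle \<Rightarrow> ('i \<Rightarrow> 'a set) \<Rightarrow> ('i \<Rightarrow> 'i \<Rightarrow> ('a, 'e) endo) set set" where
  "sigma_target E U =
     {{a + b + c | a b c. a \<in> X \<and> b \<in> Y \<and> c \<in> Z} | X Y Z.
        X \<in> H1_class U (Der_deg E 2) ` Z1_tilde E U \<and>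
        Y \<in> H1 U (Der_deg E 4) \<and> Z \<in> H1 U (Der_deg E 6)}"


section \<open>Coherent sheaves and Leray covers\<close>

text \<open>The ring of holomorphic functions on \<open>V\<close>, made extensional by the value 0 off \<open>V\<close>.\<close>

definition O_ring :: "('a, 'z) cmanifold_scheme \<Rightarrow> 'a set \<Rightarrow> ('a \<Rightarrow> complex) ring" where
  "O_ring M V =
     \<lparr>carrier = {f. holo M V f \<and> (\<forall>x. x \<notin> V \<longrightarrow> f x = 0)},
      mult = (\<lambda>f g x. f x * g x), one = (\<lambda>x. if x \<in> V then 1 else 0),
      zero = (\<lambda>x. 0), add = (\<lambda>f g x. f x + g x)\<rparr>"

definition fun_restrict :: "'a set \<Rightarrow> ('a \<Rightarrow> complex) \<Rightarrow> 'a \<Rightarrow> complex" where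
  "fun_restrict V f = (\<lambda>x. if x \<in> V then f x else 0)"

text \<open>A sheaf of modules is given by its modules of sections \<open>F V\<close> and its restriction maps
  \<open>\<rho> V V'\<close> from \<open>F V\<close> to \<open>F V'\<close>.\<close>

definition module_sheaf ::
    "('a::topological_space, 'z) cmanifold_scheme \<Rightarrow> ('a set \<Rightarrow> ('a \<Rightarrow> complex, 'f) module) \<Rightarrow>
     ('a set \<Rightarrow> 'a set \<Rightarrow> 'f \<Rightarrow> 'f) \<Rightarrow> bool" where
  "module_sheaf M F \<rho> \<longleftrightarrow>
     (\<forall>V. open V \<longrightarrow> Module.module (O_ring M V) (F V)) \<and>
     (\<forall>V V'. open V \<and> open V' \<and> V' \<subseteq> V \<longrightarrow>
        (\<forall>s\<in>carrier (F V). \<rho> V V' s \<in> carrier (F V')) \<and>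
        (\<forall>s\<in>carrier (F V). \<forall>s'\<in>carrier (F V).
           \<rho> V V' (s \<oplus>\<^bsub>F V\<^esub> s') = \<rho> V V' s \<oplus>\<^bsub>F V'\<^esub> \<rho> V V' s') \<and>
        (\<forall>f\<in>carrier (O_ring M V). \<forall>s\<in>carrier (F V).
           \<rho> V V' (f \<odot>\<^bsub>F V\<^esub> s) = fun_restrict V' f \<odot>\<^bsub>F V'\<^esub> \<rho> V V' s) \<and>
        (\<forall>V''. open V'' \<and> V'' \<subseteq> V' \<longrightarrow>
           (\<forall>s\<in>carrier (F V). \<rho> V' V'' (\<rho> V V' s) = \<rho> V V'' s))) \<and>
     (\<forall>V. open V \<longrightarrow> (\<forall>s\<in>carrier (F V). \<rho> V V s = s)) \<and>
     (\<forall>\<W> s. (\<forall>W\<in>\<W>. open W \<and> s W \<in> carrier (F W)) \<and>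
            (\<forall>W\<in>\<W>. \<forall>W'\<in>\<W>. \<rho> W (W \<inter> W') (s W) = \<rho> W' (W \<inter> W') (s W')) \<longrightarrow>
        (\<exists>!t. t \<in> carrier (F (\<Union>\<W>)) \<and> (\<forall>W\<in>\<W>. \<rho> (\<Union>\<W>) W t = s W)))"

text \<open>Some \<open>n\<close> sections over a neighbourhood of each point generate all stalks there.\<close>

definition finite_type_sheaf ::
    "('a::topological_space, 'z) cmanifold_scheme \<Rightarrow> ('a set \<Rightarrow> ('a \<Rightarrow> complex, 'f) module) \<Rightarrow>
     ('a set \<Rightarrow> 'a set \<Rightarrow> 'f \<Rightarrow> 'f) \<Rightarrow> bool" where
  "finite_type_sheaf M F \<rho> \<longleftrightarrow>
     (\<forall>x. \<exists>V (n::nat) s. open V \<and> x \<in> V \<and> (\<forall>i<n. s i \<in> carrier (F V)) \<and>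
        (\<forall>W y t. open W \<and> W \<subseteq> V \<and> y \<in> W \<and> t \<in> carrier (F W) \<longrightarrow>
           (\<exists>W' c. open W' \<and> y \<in> W' \<and> W' \<subseteq> W \<and> (\<forall>i<n. c i \<in> carrier (O_ring M W')) \<and>
              \<rho> W W' t = finsum (F W') (\<lambda>i. c i \<odot>\<^bsub>F W'\<^esub> \<rho> V W' (s i)) {..<n})))"

definition relation_on ::
    "('a, 'z) cmanifold_scheme \<Rightarrow> ('a set \<Rightarrow> ('a \<Rightarrow> complex, 'f) module) \<Rightarrow>
     ('a set \<Rightarrow> 'a set \<Rightarrow> 'f \<Rightarrow> 'f) \<Rightarrow> 'a set \<Rightarrow> nat \<Rightarrow> (nat \<Rightarrow> 'f) \<Rightarrow> 'a set \<Rightarrow>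
     (nat \<Rightarrow> 'a \<Rightarrow> complex) \<Rightarrow> bool" where
  "relation_on M F \<rho> V n s W c \<longleftrightarrow>
     (\<forall>i<n. c i \<in> carrier (O_ring M W)) \<and>
     finsum (F W) (\<lambda>i. c i \<odot>\<^bsub>F W\<^esub> \<rho> V W (s i)) {..<n} = \<zero>\<^bsub>F W\<^esub>"

text \<open>Coherent: of finite type, and for any finite family \<open>s\<close> of sections over an open set the sheaf
  of relations of \<open>s\<close> is of finite type.\<close>

definition coherent_sheaf ::
    "('a::topological_space, 'z) cmanifold_scheme \<Rightarrow> ('a set \<Rightarrow> ('a \<Rightarrow> complex, 'f) module) \<Rightarrow>
     ('a set \<Rightarrow> 'a set \<Rightarrow> 'f \<Rightarrow> 'f) \<Rightarrow> bool" where
  "coherent_sheaf M F \<rho> \<longleftrightarrow>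
     module_sheaf M F \<rho> \<and> finite_type_sheaf M F \<rho> \<and>
     (\<forall>V n s x. open V \<and> (\<forall>i<n. s i \<in> carrier (F V)) \<and> x \<in> V \<longrightarrow>
        (\<exists>V' (m::nat) r. open V' \<and> x \<in> V' \<and> V' \<subseteq> V \<and>
           (\<forall>k<m. relation_on M F \<rho> V n s V' (r k)) \<and>
           (\<forall>W y c. open W \<and> W \<subseteq> V' \<and> y \<in> W \<and> relation_on M F \<rho> V n s W c \<longrightarrow>
              (\<exists>W' a. open W' \<and> y \<in> W' \<and> W' \<subseteq> W \<and> (\<forall>k<m. a k \<in> carrier (O_ring M W')) \<and>
                 (\<forall>i<n. \<forall>z\<in>W'. c i z = (\<Sum>k<m. a k z * r k i z))))))"

text \<open>Cech \<open>p\<close>-cochains on a cover \<open>\<W>\<close> (a set of open sets, indexed by itself) are functions on lists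
  of length \<open>p + 1\<close> over \<open>\<W>\<close>; \<open>cech_d\<close> is the coboundary of a \<open>p\<close>-cochain at a list of length
  \<open>p + 2\<close>.\<close>

definition cech_cochain ::
    "('a set \<Rightarrow> ('a \<Rightarrow> complex, 'f) module) \<Rightarrow> 'a set set \<Rightarrow> nat \<Rightarrow> ('a set list \<Rightarrow> 'f) \<Rightarrow> bool" where
  "cech_cochain F \<W> p c \<longleftrightarrow>
     (\<forall>\<sigma>\<in>lists \<W>. length \<sigma> = p + 1 \<longrightarrow> c \<sigma> \<in> carrier (F (\<Inter>(set \<sigma>))))"

definition cech_d ::
    "('a set \<Rightarrow> ('a \<Rightarrow> complex, 'f) module) \<Rightarrow> ('a set \<Rightarrow> 'a set \<Rightarrow> 'f \<Rightarrow> 'f) \<Rightarrow>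
     ('a set list \<Rightarrow> 'f) \<Rightarrow> 'a set list \<Rightarrow> 'f" where
  "cech_d F \<rho> c \<sigma> =
     finsum (F (\<Inter>(set \<sigma>)))
       (\<lambda>k. let \<tau> = take k \<sigma> @ drop (Suc k) \<sigma>; y = \<rho> (\<Inter>(set \<tau>)) (\<Inter>(set \<sigma>)) (c \<tau>)
            in if even k then y else \<ominus>\<^bsub>F (\<Inter>(set \<sigma>))\<^esub> y)
       {..<length \<sigma>}"

text \<open>Vanishing of \<open>H\<^sup>p(X, F)\<close>, \<open>p \<ge> 1\<close>, as the direct limit over all open covers of \<open>X\<close>, which is
  sheaf cohomology on a paracompact space such as an open subset of a manifold: each cocycle on a
  cover becomes a coboundary on some refinement.\<close>

definition cohomology_vanishes ::
    "('a::topological_space set \<Rightarrow> ('a \<Rightarrow> complex, 'f) module) \<Rightarrow>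
     ('a set \<Rightarrow> 'a set \<Rightarrow> 'f \<Rightarrow> 'f) \<Rightarrow> 'a set \<Rightarrow> nat \<Rightarrow> bool" where
  "cohomology_vanishes F \<rho> X p \<longleftrightarrow>
     (\<forall>\<W> c. (\<forall>W\<in>\<W>. open W) \<and> \<Union>\<W> = X \<and> cech_cochain F \<W> p c \<and>
        (\<forall>\<sigma>\<in>lists \<W>. length \<sigma> = p + 2 \<longrightarrow> cech_d F \<rho> c \<sigma> = \<zero>\<^bsub>F (\<Inter>(set \<sigma>))\<^esub>) \<longrightarrow>
        (\<exists>\<V> \<tau> b. (\<forall>V\<in>\<V>. open V \<and> \<tau> V \<in> \<W> \<and> V \<subseteq> \<tau> V) \<and> \<Union>\<V> = X \<and>
           cech_cochain F \<V> (p - 1) b \<and>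
           (\<forall>\<sigma>\<in>lists \<V>. length \<sigma> = p + 1 \<longrightarrow>
              \<rho> (\<Inter>(set (map \<tau> \<sigma>))) (\<Inter>(set \<sigma>)) (c (map \<tau> \<sigma>)) = cech_d F \<rho> b \<sigma>)))"

text \<open>
  Taking all coherent sheaves whose sections have the type \<^typ>\<open>'a \<Rightarrow> complex\<close> is no restriction: a
  section of a sheaf is determined by the function sending a point to the germ there, and the
  stalks of a coherent sheaf have at most the cardinality of the continuum, so that germs can be
  encoded as complex numbers.
\<close>

definition leray_cover ::
    "('a::topological_space, 'z) cmanifold_scheme \<Rightarrow> ('i \<Rightarrow> 'a set) \<Rightarrow> bool" where
  "leray_cover M U \<longleftrightarrow>
     open_cover U \<and>
     (\<forall>(F :: 'a set \<Rightarrow> ('a \<Rightarrow> complex, 'a \<Rightarrow> complex) module) \<rho>. coherent_sheaf M F \<rho> \<longrightarrow>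
        (\<forall>S p. finite S \<and> S \<noteq> {} \<and> p \<ge> 1 \<longrightarrow> cohomology_vanishes F \<rho> (\<Inter>i\<in>S. U i) p))"

end

theory Submission
  imports Defs
begin

text \<open>
  As the rank is less than 8, an element of \<open>G\<^sub>E\<close> is determined by its components of degrees 2, 4, 6.
  If two elements agree below degree \<open>2q\<close>, their components of degree \<open>2q\<close> differ by a derivation, and
  these differences add up under composition. Thus the lowest component of a multiplicative
  coboundary is an additive 2-cocycle of derivations, and the vanishing of \<open>H\<^sup>2\<close> allows one to correct
  a cochain degree by degree until it is a cocycle. This gives (1), and it also realises every
  additive cocycle of degree \<open>2q\<close> as the difference, in degree \<open>2q\<close>, of two multiplicative cocycles
  that agree below.

  For (2) a cocycle \<open>g = exp u\<close> is compared, in degree \<open>2q\<close>, with a base cocycle chosen in terms of the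
  classes found in lower degrees, after \<open>g\<close> has been moved within its orbit to agree with it in lower
  degrees; the difference \<open>\<zeta>\<close> is an additive cocycle, and \<open>D'\<^sub>2\<^sub>q(u)\<close> is \<open>\<zeta> - pr\<^sub>2\<^sub>q(u)\<close>. Since \<open>H\<^sup>0 = 0\<close>, a
  0-cochain that preserves the components below degree \<open>2q\<close> starts in degree \<open>2q\<close> and changes \<open>\<zeta>\<close> by a
  coboundary, so the classes of \<open>\<zeta>\<close> are invariants of the orbit; they determine it, and all occur.
\<close>

section \<open>The exterior algebra\<close>

text \<open>The multiplicative cocycles that agree below degree 2q with a given one have components
  of degree 2q that form a torsor under Z^1(Der_2q). This torsor has no distinguished origin: the
  naive coordinate pr_2q(u) is not a cocycle, its coboundary is -R_2q(u). The base cocycles supply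
  origins, and two demands shape their choice. For \<sigma> to be defined on orbits, an origin may
  depend only on classes in lower degrees; hence representatives are chosen from cosets, not from
  cocycles. For D'_2q(u) to depend only on pr_(2q-2)(u), the cocycle \<zeta> must change by exactly
  pr_2q(u) - pr_2q(u') between cochains that agree below; hence the 0-cochains that do the
  normalising are fixed functions of the lower components as well.

  In (1), the link between u_2 and \<open>Z1_tilde\<close> is that the coboundary of exp(u_2) has no
  part of degree 2 once u_2 is an additive cocycle. All products of lower components that could
  spoil the Leibniz rule in degrees 4 and 6 then vanish.\<close>

lemma wedge_infinite: "infinite K \<Longrightarrow> wedge a b K = 0"
  by (simp add: wedge_def finite_Pow_iff)

lemma wedge_add_left: "wedge (a + a') b = wedge a b + wedge a' b"
  by (simp add: wedge_def fun_eq_iff ring_distribs sum.distrib)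

lemma wedge_add_right: "wedge a (b + b') = wedge a b + wedge a b'"
  by (simp add: wedge_def fun_eq_iff ring_distribs sum.distrib)

lemma wedge_scale_left: "wedge (\<lambda>I. c * a I) b = (\<lambda>K. c * wedge a b K)"
  by (simp add: wedge_def fun_eq_iff sum_distrib_left ac_simps)

lemma wedge_scale_right: "wedge a (\<lambda>I. c * b I) = (\<lambda>K. c * wedge a b K)"
  by (simp add: wedge_def fun_eq_iff sum_distrib_left ac_simps)

lemma wedge_zero_left [simp]: "wedge 0 b = 0"
  by (simp add: wedge_def fun_eq_iff)

lemma wedge_zero_right [simp]: "wedge a 0 = 0"
  by (simp add: wedge_def fun_eq_iff)

lemma wedge_zero_fun [simp]: "wedge (\<lambda>I. 0) b = (\<lambda>K. 0)" "wedge a (\<lambda>I. 0) = (\<lambda>K. 0)"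
  by (simp_all add: wedge_def fun_eq_iff)

lemma wedge_sum_left: "wedge (\<lambda>I. \<Sum>x\<in>X. f x I) b K = (\<Sum>x\<in>X. wedge (f x) b K)"
  unfolding wedge_def sum_distrib_left sum_distrib_right by (rule sum.swap)

lemma wedge_sum_right: "wedge a (\<lambda>I. \<Sum>x\<in>X. f x I) K = (\<Sum>x\<in>X. wedge a (f x) K)"
  unfolding wedge_def sum_distrib_left sum_distrib_right by (rule sum.swap)

text \<open>The inversions between \<open>I \<union> J\<close> and \<open>K\<close> are the disjoint
  union of those starting in \<open>I\<close> and those starting in \<open>J\<close>, so the
  exponents add.\<close>

lemma wedge_sign_Un_left:
  assumes "finite I" "finite J" "finite K" "I \<inter> J = {}"
  shows "wedge_sign (I \<union> J) K = wedge_sign I K * wedge_sign J K"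
proof -
  have fin: "finite {(i, j). i \<in> A \<and> j \<in> K \<and> j < i}" if "finite A" for A :: "nat set"
    by (rule finite_subset[of _ "A \<times> K"]) (use that assms in auto)
  have "{(i, j). i \<in> I \<union> J \<and> j \<in> K \<and> j < i} =
      {(i, j). i \<in> I \<and> j \<in> K \<and> j < i} \<union> {(i, j). i \<in> J \<and> j \<in> K \<and> j < i}" by auto
  moreover have "{(i, j). i \<in> I \<and> j \<in> K \<and> j < i} \<inter> {(i, j). i \<in> J \<and> j \<in> K \<and> j < i} = {}"
    using assms by auto
  ultimately show ?thesis
    unfolding wedge_sign_def using fin assms by (simp add: card_Un_disjoint power_add)
qed

lemma wedge_sign_Un_right:
  assumes "finite I" "finite J" "finite K" "J \<inter> K = {}"
  shows "wedge_sign I (J \<union> K) = wedge_sign I J * wedge_sign I K"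
proof -
  have fin: "finite {(i, j). i \<in> I \<and> j \<in> A \<and> j < i}" if "finite A" for A :: "nat set"
    by (rule finite_subset[of _ "I \<times> A"]) (use that assms in auto)
  have "{(i, j). i \<in> I \<and> j \<in> J \<union> K \<and> j < i} =
      {(i, j). i \<in> I \<and> j \<in> J \<and> j < i} \<union> {(i, j). i \<in> I \<and> j \<in> K \<and> j < i}" by auto
  moreover have "{(i, j). i \<in> I \<and> j \<in> J \<and> j < i} \<inter> {(i, j). i \<in> I \<and> j \<in> K \<and> j < i} = {}"
    using assms by auto
  ultimately show ?thesis
    unfolding wedge_sign_def using fin assms by (simp add: card_Un_disjoint power_add)
qed

lemma wedge_sign_empty_left [simp]: "wedge_sign {} J = 1"
  by (simp add: wedge_sign_def)

lemma wedge_sign_empty_right [simp]: "wedge_sign I {} = 1"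
  by (simp add: wedge_sign_def)

lemma wedge_sign_eq_1:
  assumes "\<And>i j. i \<in> I \<Longrightarrow> j \<in> J \<Longrightarrow> \<not> j < i"
  shows "wedge_sign I J = 1"
proof -
  have e: "{(i, j). i \<in> I \<and> j \<in> J \<and> j < i} = {}" using assms by auto
  show ?thesis unfolding wedge_sign_def e by simp
qed

text \<open>Both sides sum over the ordered partitions of \<open>K\<close> into three blocks, with
  the product of the three pairwise signs. The left side names a partition by the union of its first
  two blocks and the first block, the right side by the first and second block.\<close>

lemma wedge_assoc: "wedge (wedge a b) c = wedge a (wedge b c)"
proof
  fix K :: "nat set"
  show "wedge (wedge a b) c K = wedge a (wedge b c) K"
  proof (cases "finite K")
    case False
    then show ?thesis by (simp add: wedge_infinite)
  next
    case fin: True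
    define f where "f = (\<lambda>(L, I). wedge_sign L (K - L) * wedge_sign I (L - I) * a I * b (L - I) * c (K - L))"
    define g where "g = (\<lambda>(I, J). wedge_sign I (K - I) * wedge_sign J (K - I - J) * a I * b J * c (K - I - J))"
    have fs: "finite A" if "A \<subseteq> K" for A using fin that by (rule rev_finite_subset)
    have "wedge (wedge a b) c K = (\<Sum>L\<in>Pow K. \<Sum>I\<in>Pow L. f (L, I))"
      by (simp add: wedge_def f_def sum_distrib_left sum_distrib_right ac_simps)
    also have "\<dots> = sum f (SIGMA L:Pow K. Pow L)"
      by (subst sum.Sigma) (auto simp: fin intro: fs)
    also have "\<dots> = sum g (SIGMA I:Pow K. Pow (K - I))"
    proof (rule sum.reindex_bij_witness[where i="\<lambda>(I, J). (I \<union> J, I)" and j="\<lambda>(L, I). (I, L - I)"])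
      fix x assume "x \<in> (SIGMA L:Pow K. Pow L)"
      then obtain L I where x: "x = (L, I)" "L \<subseteq> K" "I \<subseteq> L" by auto
      have d: "K - I = (L - I) \<union> (K - L)" "L = I \<union> (L - I)" "K - I - (L - I) = K - L" using x by auto
      have "wedge_sign L (K - L) = wedge_sign I (K - L) * wedge_sign (L - I) (K - L)"
        by (subst d(2), rule wedge_sign_Un_left) (use x fs in auto)
      moreover have "wedge_sign I (K - I) = wedge_sign I (L - I) * wedge_sign I (K - L)"
        by (subst d(1), rule wedge_sign_Un_right) (use x fs in auto)
      ultimately show "g (case x of (L, I) \<Rightarrow> (I, L - I)) = f x"
        using x by (simp add: f_def g_def d(3))
    qed auto
    also have "\<dots> = (\<Sum>I\<in>Pow K. \<Sum>J\<in>Pow (K - I). g (I, J))"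
      by (subst sum.Sigma) (auto simp: fin intro: fs)
    also have "\<dots> = wedge a (wedge b c) K"
      by (simp add: wedge_def g_def sum_distrib_left sum_distrib_right ac_simps)
    finally show ?thesis .
  qed
qed

text \<open>Finiteness is demanded because \<open>card\<close> is 0 on infinite sets, which would
  otherwise count as index sets of degree 0.\<close>

definition pure :: "nat \<Rightarrow> (nat set \<Rightarrow> complex) \<Rightarrow> bool" where
  "pure p a \<longleftrightarrow> (\<forall>I. a I \<noteq> 0 \<longrightarrow> finite I \<and> card I = p)"

lemma pure_wedge: "pure p a \<Longrightarrow> pure q b \<Longrightarrow> pure (p + q) (wedge a b)"
  unfolding pure_def
proof (intro allI impI)
  fix K
  assume a: "\<forall>I. a I \<noteq> 0 \<longrightarrow> finite I \<and> card I = p" and b: "\<forall>I. b I \<noteq> 0 \<longrightarrow> finite I \<and> card I = q"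
    and "wedge a b K \<noteq> 0"
  then obtain I where I: "I \<subseteq> K" "a I \<noteq> 0" "b (K - I) \<noteq> 0"
    unfolding wedge_def by (auto elim!: sum.not_neutral_contains_not_neutral)
  then have "finite I" "finite (K - I)" "card I = p" "card (K - I) = q" using a b by auto
  then have "card (I \<union> (K - I)) = p + q" "finite (I \<union> (K - I))"
    using card_Un_disjoint[of I "K - I"] by (blast, blast)
  then show "finite K \<and> card K = p + q" using I by (simp add: Un_absorb1)
qed

lemma pure_ext_one: "pure 0 ext_one"
  by (auto simp: pure_def ext_one_def split: if_splits)

lemma pure_ext_vec: "pure 1 (ext_vec r v)"
  unfolding pure_def
proof (intro allI impI)
  fix I
  assume "ext_vec r v I \<noteq> 0"
  then obtain i where "(if I = {i} then v i else 0) \<noteq> 0"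
    unfolding ext_vec_def by (rule sum.not_neutral_contains_not_neutral)
  then have "I = {i}" by meson
  then show "finite I \<and> card I = 1" by simp
qed

lemma wedge_ext_one_left: "finite K \<Longrightarrow> wedge ext_one a K = a K"
proof -
  assume "finite K"
  have "wedge ext_one a K = (\<Sum>I\<in>Pow K. if I = {} then a K else 0)"
    unfolding wedge_def by (rule sum.cong) (auto simp: ext_one_def)
  then show ?thesis using \<open>finite K\<close> by (simp add: sum.delta)
qed

lemma wedge_ext_one_right: "finite K \<Longrightarrow> wedge a ext_one K = a K"
proof -
  assume "finite K"
  have "wedge a ext_one K = (\<Sum>I\<in>Pow K. if I = K then a K else 0)"
    unfolding wedge_def by (rule sum.cong) (auto simp: ext_one_def)
  then show ?thesis using \<open>finite K\<close> by (simp add: sum.delta)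
qed

text \<open>Complementation in \<open>K\<close> matches the summands of the two products. Both
  factors live on singletons, and of two distinct indices exactly one order is an inversion, so
  matched summands have opposite signs.\<close>

lemma wedge_anticommute:
  assumes "pure 1 v" "pure 1 w"
  shows "wedge v w = - wedge w v"
proof
  fix K
  have "wedge v w K = (\<Sum>I\<in>Pow K. - (wedge_sign I (K - I) * w I * v (K - I)))"
    unfolding wedge_def
  proof (rule sum.reindex_bij_witness[where i="\<lambda>I. K - I" and j="\<lambda>I. K - I"])
    fix I assume I: "I \<in> Pow K"
    then have KI: "K - (K - I) = I" by auto
    show "- (wedge_sign (K - I) (K - (K - I)) * w (K - I) * v (K - (K - I))) = wedge_sign I (K - I) * v I * w (K - I)"
    proof (cases "v I = 0 \<or> w (K - I) = 0")
      case False
      then have "card I = 1" "card (K - I) = 1" using assms by (auto simp: pure_def)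
      then obtain i j where ij: "I = {i}" "K - I = {j}" by (auto simp: card_1_singleton_iff)
      then have "i \<noteq> j" by auto
      have s: "{(x, y). x = i \<and> y = j \<and> y < x} = (if j < i then {(i, j)} else {})" for i j :: nat by auto
      have "wedge_sign {i} {j} = - wedge_sign {j} {i}"
        using \<open>i \<noteq> j\<close> by (auto simp: wedge_sign_def s)
      then show ?thesis unfolding KI using ij by simp
    qed (auto simp: KI)
  qed auto
  then show "wedge v w K = (- wedge w v) K"
    by (simp add: wedge_def sum_negf)
qed

lemma wedge_square_zero:
  assumes "pure 1 v"
  shows "wedge v v = 0"
proof
  fix K
  have "wedge v v K = - wedge v v K"
    using wedge_anticommute[OF assms assms] by (metis uminus_apply)
  then show "wedge v v K = 0 K" by simp
qed

text \<open>The ordered product inside \<open>ext_map\<close>, with the columns of the matrix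
  replaced by an arbitrary family, so that its multiplication rules can be proved by induction on
  the index set.\<close>

definition wedges :: "(nat \<Rightarrow> nat set \<Rightarrow> complex) \<Rightarrow> nat set \<Rightarrow> nat set \<Rightarrow> complex" where
  "wedges v J = foldr wedge (map v (sorted_list_of_set J)) ext_one"

lemma wedges_empty [simp]: "wedges v {} = ext_one"
  by (simp add: wedges_def)

lemma wedges_insert_min:
  assumes "finite J" "\<And>j. j \<in> J \<Longrightarrow> i < j"
  shows "wedges v (insert i J) = wedge (v i) (wedges v J)"
proof -
  have "i \<notin> J" using assms(2) by blast
  then have "sorted_list_of_set (insert i J) = insort i (sorted_list_of_set J)"
    using assms by (simp add: sorted_list_of_set_insert)
  also have "\<dots> = i # sorted_list_of_set J"
    by (rule insort_is_Cons) (use assms in \<open>auto simp: less_imp_le\<close>)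
  finally show ?thesis by (simp add: wedges_def)
qed

lemma pure_wedges:
  assumes "\<And>i. pure 1 (v i)" "finite J"
  shows "pure (card J) (wedges v J)"
  using assms(2)
proof (induction J rule: finite_psubset_induct)
  case (psubset J)
  show ?case
  proof (cases "J = {}")
    case True
    then show ?thesis by (simp add: pure_ext_one)
  next
    case False
    define m where "m = Min J"
    have m: "m \<in> J" "\<And>j. j \<in> J - {m} \<Longrightarrow> m < j"
      using False psubset.hyps by (auto simp: m_def order.not_eq_order_implies_strict)
    have "wedges v J = wedge (v m) (wedges v (J - {m}))"
      using wedges_insert_min[of "J - {m}" m v] m psubset.hyps by (simp add: insert_absorb)
    moreover have "pure (1 + card (J - {m})) (wedge (v m) (wedges v (J - {m})))"
      using m psubset by (intro pure_wedge assms psubset.IH) auto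
    moreover have "1 + card (J - {m}) = card J"
      using m psubset.hyps by (metis card_Suc_Diff1 plus_1_eq_Suc)
    ultimately show ?thesis by simp
  qed
qed

text \<open>\<open>v i\<close> moves to its place in the ordered product; each factor of smaller
  index that it passes costs a sign, and it annihilates a factor equal to itself. The induction
  splits off the smallest index \<open>m\<close>: \<open>i < m\<close> needs no exchange,
  \<open>i = m\<close> gives a square, and \<open>i > m\<close> gives one exchange and the induction
  hypothesis.\<close>

lemma wedge_wedges_insert:
  assumes v: "\<And>i. pure 1 (v i)" and "finite J"
  shows "wedge (v i) (wedges v J) =
    (if i \<in> J then 0 else (\<lambda>K. wedge_sign {i} J * wedges v (insert i J) K))"
  using assms(2)
proof (induction J rule: finite_psubset_induct)
  case (psubset J)
  show ?case
  proof (cases "J = {}")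
    case True
    then show ?thesis using wedges_insert_min[of "{}" i v] by simp
  next
    case False
    define m where "m = Min J"
    define J' where "J' = J - {m}"
    have m: "m \<in> J" "\<And>j. j \<in> J' \<Longrightarrow> m < j"
      using False psubset.hyps by (auto simp: m_def J'_def order.not_eq_order_implies_strict)
    have J': "J' \<subset> J" "finite J'" "m \<notin> J'" "J = insert m J'"
      using m psubset.hyps by (auto simp: J'_def)
    have WJ: "wedges v J = wedge (v m) (wedges v J')"
      using wedges_insert_min[of J' m v] m J' by simp
    consider "i = m" | "i < m" | "m < i" by linarith
    then show ?thesis
    proof cases
      case 1
      then show ?thesis
        using m by (simp add: WJ wedge_assoc[symmetric] wedge_square_zero[OF v])
    next
      case 2
      then have lt: "i < j" if "j \<in> J" for j
        using that m J' by (metis insertE order.strict_trans)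
      then have "i \<notin> J" by blast
      moreover have "wedge_sign {i} J = 1" by (rule wedge_sign_eq_1) (use lt in fastforce)
      ultimately show ?thesis
        using wedges_insert_min[OF psubset.hyps(1), of i v] lt by simp
    next
      case 3
      have eq: "wedge (v i) (wedges v J) = - wedge (v m) (wedge (v i) (wedges v J'))"
      proof -
        have "wedge (v i) (wedges v J) = wedge (wedge (v i) (v m)) (wedges v J')"
          by (simp add: WJ wedge_assoc)
        also have "wedge (v i) (v m) = - wedge (v m) (v i)" by (rule wedge_anticommute[OF v v])
        also have "wedge (- wedge (v m) (v i)) (wedges v J') = - wedge (wedge (v m) (v i)) (wedges v J')"
          using wedge_scale_left[of "-1" "wedge (v m) (v i)" "wedges v J'"] by (simp add: fun_Compl_def)
        finally show ?thesis by (simp add: wedge_assoc)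
      qed
      show ?thesis
      proof (cases "i \<in> J")
        case True
        then have "i \<in> J'" using 3 J' by auto
        then have e0: "wedge (v i) (wedges v J') = 0" using psubset.IH[OF J'(1)] by (simp add: zero_fun_def)
        show ?thesis unfolding eq e0 using True by (simp add: fun_eq_iff)
      next
        case False
        then have "i \<notin> J'" using J' by auto
        have "wedges v (insert i J) = wedges v (insert m (insert i J'))"
          using J' by (simp add: insert_commute)
        also have "\<dots> = wedge (v m) (wedges v (insert i J'))"
          by (rule wedges_insert_min) (use m J' 3 in auto)
        finally have W: "wedges v (insert i J) = wedge (v m) (wedges v (insert i J'))" .
        have "{(x, y). x \<in> {i} \<and> y \<in> {m} \<and> y < x} = {(i, m)}" using 3 by auto
        then have "wedge_sign {i} {m} = -1" by (simp add: wedge_sign_def)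
        moreover have "wedge_sign {i} ({m} \<union> J') = wedge_sign {i} {m} * wedge_sign {i} J'"
          by (rule wedge_sign_Un_right) (use J' in auto)
        ultimately have s: "wedge_sign {i} J = - wedge_sign {i} J'"
          using J' by simp
        have "wedge (v i) (wedges v J') = (\<lambda>K. wedge_sign {i} J' * wedges v (insert i J') K)"
          using psubset.IH[OF J'(1)] \<open>i \<notin> J'\<close> by simp
        then show ?thesis
          unfolding eq using False by (simp add: s W wedge_scale_right fun_Compl_def)
      qed
    qed
  qed
qed

text \<open>The factors of \<open>wedges v I\<close> enter the second product one at a time, the one
  of smallest index last, so \<open>wedge_wedges_insert\<close> applies at each stage. The smallest
  index of \<open>I\<close> has no inversions with the rest of \<open>I\<close>, so only its
  inversions with \<open>J\<close> are counted.\<close>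

lemma wedge_wedges:
  assumes v: "\<And>i. pure 1 (v i)" and "finite I" and J: "finite J"
  shows "wedge (wedges v I) (wedges v J) =
    (if I \<inter> J = {} then (\<lambda>K. wedge_sign I J * wedges v (I \<union> J) K) else 0)"
  using assms(2)
proof (induction I rule: finite_psubset_induct)
  case (psubset I)
  show ?case
  proof (cases "I = {}")
    case True
    have "wedge ext_one (wedges v J) = wedges v J"
    proof
      fix K
      show "wedge ext_one (wedges v J) K = wedges v J K"
        using pure_wedges[of v J, OF v J] by (cases "finite K") (auto simp: wedge_ext_one_left wedge_infinite pure_def)
    qed
    then show ?thesis using True by simp
  next
    case False
    define m where "m = Min I"
    define I' where "I' = I - {m}"
    have m: "m \<in> I" "\<And>j. j \<in> I' \<Longrightarrow> m < j"
      using False psubset.hyps by (auto simp: m_def I'_def order.not_eq_order_implies_strict)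
    have I': "I' \<subset> I" "finite I'" "m \<notin> I'" "I = insert m I'"
      using m psubset.hyps by (auto simp: I'_def)
    have WI: "wedges v I = wedge (v m) (wedges v I')"
      using wedges_insert_min[of I' m v] m I' by simp
    have eq: "wedge (wedges v I) (wedges v J) = wedge (v m) (wedge (wedges v I') (wedges v J))"
      by (simp add: WI wedge_assoc)
    show ?thesis
    proof (cases "I' \<inter> J = {}")
      case False
      then have "I \<inter> J \<noteq> {}" using I' by auto
      then show ?thesis using psubset.IH[OF I'(1)] False by (simp add: eq)
    next
      case True
      have "wedge (wedges v I') (wedges v J) = (\<lambda>K. wedge_sign I' J * wedges v (I' \<union> J) K)"
        using psubset.IH[OF I'(1)] True by simp
      then have eq2: "wedge (wedges v I) (wedges v J) =
          (\<lambda>K. wedge_sign I' J * wedge (v m) (wedges v (I' \<union> J)) K)"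
        unfolding eq by (simp add: wedge_scale_right)
      have ins: "wedge (v m) (wedges v (I' \<union> J)) = (if m \<in> I' \<union> J then 0
          else (\<lambda>K. wedge_sign {m} (I' \<union> J) * wedges v (insert m (I' \<union> J)) K))"
        by (rule wedge_wedges_insert[OF v]) (use I' J in auto)
      show ?thesis
      proof (cases "m \<in> J")
        case True
        then have "I \<inter> J \<noteq> {}" using m by auto
        then show ?thesis using True unfolding eq2 ins by (simp add: zero_fun_def)
      next
        case mJ: False
        have "wedge_sign {m} I' = 1" by (rule wedge_sign_eq_1) (use m in fastforce)
        then have "wedge_sign {m} (I' \<union> J) = wedge_sign {m} J"
          using wedge_sign_Un_right[of "{m}" I' J] True I' J by simp
        moreover have "wedge_sign I J = wedge_sign {m} J * wedge_sign I' J"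
          using wedge_sign_Un_left[of "{m}" I' J] I' J by simp
        ultimately have s: "wedge_sign I' J * wedge_sign {m} (I' \<union> J) = wedge_sign I J" by simp
        have n: "m \<notin> I' \<union> J" "I \<inter> J = {}" "insert m (I' \<union> J) = I \<union> J" using mJ True I' by auto
        show ?thesis
          unfolding eq2 ins if_not_P[OF n(1)] if_P[OF n(2)] n(3) by (simp only: mult.assoc[symmetric] s)
      qed
    qed
  qed
qed

section \<open>Functoriality of the exterior algebra\<close>

lemma ext_map_wedges:
  "ext_map r g a K = (\<Sum>J\<in>Pow {..<r}. a J * wedges (\<lambda>j. ext_vec r (\<lambda>i. g i j)) J K)"
  by (simp add: ext_map_def wedges_def)

lemma ext_spaceD: "a \<in> ext_space r \<Longrightarrow> a I \<noteq> 0 \<Longrightarrow> I \<subseteq> {..<r}"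
  by (auto simp: ext_space_def)

lemma wedge_ext_space:
  assumes "a \<in> ext_space r" "b \<in> ext_space r"
  shows "wedge a b \<in> ext_space r"
proof -
  have "wedge a b K = 0" if "\<not> K \<subseteq> {..<r}" for K
    unfolding wedge_def
  proof (rule sum.neutral, rule ballI)
    fix I assume "I \<in> Pow K"
    have "\<not> (I \<subseteq> {..<r} \<and> K - I \<subseteq> {..<r})"
      using that by (metis Diff_subset_conv Un_absorb1)
    then have "a I = 0 \<or> b (K - I) = 0" using assms by (metis ext_spaceD)
    then show "wedge_sign I (K - I) * a I * b (K - I) = 0" by auto
  qed
  then show ?thesis by (simp add: ext_space_def)
qed

text \<open>The right side expands over pairs of index sets. By \<open>wedge_wedges\<close>,
  overlapping pairs vanish and a disjoint pair contributes \<open>wedges v (I \<union> J)\<close>;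
  collecting the pairs by their union yields the coefficients of \<open>wedge a b\<close>.\<close>

lemma ext_map_wedge:
  assumes a: "a \<in> ext_space r" and b: "b \<in> ext_space r"
  shows "ext_map r g (wedge a b) = wedge (ext_map r g a) (ext_map r g b)"
proof
  fix K
  define v where "v = (\<lambda>j. ext_vec r (\<lambda>i. g i j))"
  have v: "pure 1 (v i)" for i unfolding v_def by (rule pure_ext_vec)
  define P where "P = Pow {..<r}"
  have fin: "finite P" by (simp add: P_def)
  have finP: "finite I" if "I \<in> P" for I using that by (auto simp: P_def intro: finite_subset)
  define f where "f = (\<lambda>(I, J). a I * b J * wedge_sign I J * wedges v (I \<union> J) K)"
  have "wedge (ext_map r g a) (ext_map r g b) K =
      wedge (\<lambda>L. \<Sum>I\<in>P. a I * wedges v I L) (\<lambda>L. \<Sum>J\<in>P. b J * wedges v J L) K"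
    by (intro arg_cong2[of _ _ _ _ "\<lambda>a b. wedge a b K"] ext) (simp_all add: ext_map_wedges v_def P_def)
  also have "\<dots> = (\<Sum>I\<in>P. \<Sum>J\<in>P. a I * b J * wedge (wedges v I) (wedges v J) K)"
    by (simp add: wedge_sum_left wedge_sum_right wedge_scale_left wedge_scale_right sum_distrib_left ac_simps)
  also have "\<dots> = (\<Sum>I\<in>P. \<Sum>J\<in>P. if I \<inter> J = {} then f (I, J) else 0)"
    by (intro sum.cong refl) (simp add: wedge_wedges[OF v finP finP] f_def)
  also have "\<dots> = (\<Sum>x\<in>P \<times> P. if fst x \<inter> snd x = {} then f x else 0)"
    unfolding sum.cartesian_product by (intro sum.cong refl) (simp split: prod.split)
  also have "\<dots> = sum f {x \<in> P \<times> P. fst x \<inter> snd x = {}}"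
    by (rule sum.inter_filter[symmetric]) (simp add: fin)
  also have "\<dots> = (\<Sum>(J, I)\<in>(SIGMA J:P. Pow J). f (I, J - I))"
    by (rule sum.reindex_bij_witness[where j="\<lambda>(I, J). (I \<union> J, I)" and i="\<lambda>(J, I). (I, J - I)"])
      (auto simp: P_def f_def Un_Diff Diff_triv Int_commute Un_absorb1 intro!: arg_cong[of _ _ f])
  also have "\<dots> = (\<Sum>J\<in>P. \<Sum>I\<in>Pow J. f (I, J - I))"
    by (subst sum.Sigma) (auto simp: fin finP)
  also have "\<dots> = ext_map r g (wedge a b) K"
    unfolding ext_map_wedges P_def[symmetric] v_def[symmetric] wedge_def sum_distrib_right
    by (intro sum.cong refl) (auto simp: f_def Un_absorb1)
  finally show "ext_map r g (wedge a b) K = wedge (ext_map r g a) (ext_map r g b) K" by simp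
qed

lemma ext_map_add: "ext_map r g (a + b) = ext_map r g a + ext_map r g b"
  by (simp add: ext_map_def fun_eq_iff ring_distribs sum.distrib)

lemma ext_map_scale: "ext_map r g (\<lambda>I. c * a I) = (\<lambda>I. c * ext_map r g a I)"
  by (simp add: ext_map_def fun_eq_iff sum_distrib_left ac_simps)

lemma ext_map_zero [simp]: "ext_map r g 0 = 0"
  by (simp add: ext_map_def fun_eq_iff)

lemma ext_map_one: "ext_map r g ext_one = ext_one"
proof
  fix K
  have "ext_map r g ext_one K = (\<Sum>J\<in>Pow {..<r}. if J = {} then ext_one K else 0)"
    unfolding ext_map_wedges by (rule sum.cong) (auto simp: ext_one_def)
  then show "ext_map r g ext_one K = ext_one K" by (simp add: sum.delta)
qed

text \<open>A product of \<open>card J\<close> vectors is homogeneous of degree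
  \<open>card J\<close>, so an induced map preserves degrees and commutes with taking parts.\<close>

lemma ext_map_part:
  "ext_map r g (\<lambda>I. if card I = j then a I else 0) = (\<lambda>I. if card I = j then ext_map r g a I else 0)"
proof
  fix K
  define v where "v = (\<lambda>j. ext_vec r (\<lambda>i. g i j))"
  have v: "pure 1 (v i)" for i unfolding v_def by (rule pure_ext_vec)
  have p: "wedges v J K = 0" if "J \<subseteq> {..<r}" "card J \<noteq> card K" for J
    using pure_wedges[of v J, OF v] that finite_subset[of J "{..<r}"] by (auto simp: pure_def)
  show "ext_map r g (\<lambda>I. if card I = j then a I else 0) K = (if card K = j then ext_map r g a K else 0)"
  proof (cases "card K = j")
    case True
    then have "(if card J = j then a J else 0) * wedges v J K = a J * wedges v J K" if "J \<in> Pow {..<r}" for J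
      using p[of J] that by auto
    then show ?thesis using True unfolding ext_map_wedges v_def[symmetric]
      by (simp only: simp_thms if_True if_False cong: sum.cong)
  next
    case False
    then have "(if card J = j then a J else 0) * wedges v J K = 0" if "J \<in> Pow {..<r}" for J
      using p[of J] that by auto
    then show ?thesis using False unfolding ext_map_wedges v_def[symmetric]
      by (simp only: simp_thms if_True if_False sum.neutral_const cong: sum.cong)
  qed
qed

section \<open>Holomorphic sections of the exterior algebra bundle\<close>

text \<open>Trivialisations are pairs; quantifiers over them are kept whole.\<close>

declare split_paired_All [simp del]

lemma sum_fun_apply: "(\<Sum>x\<in>X. f x) y = (\<Sum>x\<in>X. f x y)"
  by (induction X rule: infinite_finite_induct) auto

text \<open>In the product formulas of degree 2q, the end terms pair degree 2q with degree 0, where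
  automorphisms are the identity; the middle terms involve only positive degrees below 2q. The
  hypothesis keeps the two ends distinct.\<close>

lemma sum_atMost_ends:
  fixes f :: "nat \<Rightarrow> 'b::comm_monoid_add"
  assumes "1 \<le> q"
  shows "(\<Sum>a\<le>q. f a) = f 0 + f q + (\<Sum>a\<in>{0<..<q}. f a)"
proof -
  have "{..q} = insert 0 (insert q {0<..<q})" using assms by auto
  then show ?thesis using assms
    by (simp only: sum.insert finite_insert finite_greaterThanLessThan) (simp add: add.assoc)
qed

lemma sum_closed:
  fixes f :: "'i \<Rightarrow> 'b::comm_monoid_add"
  assumes "0 \<in> A" "\<And>a b. a \<in> A \<Longrightarrow> b \<in> A \<Longrightarrow> a + b \<in> A" "\<And>x. x \<in> X \<Longrightarrow> f x \<in> A"
  shows "sum f X \<in> A"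
  using assms(3) by (induction X rule: infinite_finite_induct) (auto intro: assms)

section \<open>Holomorphic functions\<close>

lemma holo_const: "holo M V (\<lambda>x. c)"
  by (auto simp: holo_def holo_Cn_def)

lemma holo_add: "holo M V f \<Longrightarrow> holo M V g \<Longrightarrow> holo M V (\<lambda>x. f x + g x)"
  unfolding holo_def holo_Cn_def by (fastforce intro: continuous_on_add field_differentiable_add)

lemma holo_mult: "holo M V f \<Longrightarrow> holo M V g \<Longrightarrow> holo M V (\<lambda>x. f x * g x)"
  unfolding holo_def holo_Cn_def by (fastforce intro: continuous_on_mult field_differentiable_mult)

lemma holo_sum:
  assumes "\<And>i. i \<in> I \<Longrightarrow> holo M V (f i)"
  shows "holo M V (\<lambda>x. \<Sum>i\<in>I. f i x)"
  using assms by (induction I rule: infinite_finite_induct) (auto intro: holo_const holo_add)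

lemma continuous_on_fun_upd: "continuous_on S (\<lambda>t. (z::nat \<Rightarrow> complex)(i := t))"
proof (rule continuous_on_coordinatewise_then_product)
  show "continuous_on S (\<lambda>t. (z(i := t)) k)" for k
    by (cases "k = i") (auto intro: continuous_on_id)
qed

text \<open>A partial derivative in \<open>holo_Cn\<close> sees all nearby values on a coordinate
  line, and \<open>inv_into W \<phi>\<close> carries no information off the chart image. But the
  image of \<open>W \<inter> V'\<close> is relatively open in \<open>Cn n\<close>, and changing a
  coordinate of index \<open>i < n\<close> stays in \<open>Cn n\<close>. So nearby points of the
  line lie in the image, where both functions agree.\<close>

lemma holo_eq_on:
  assumes M: "complex_manifold M" and f: "holo M V f" and V': "open V'" "V' \<subseteq> V"
    and eq: "\<And>x. x \<in> V' \<Longrightarrow> g x = f x"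
  shows "holo M V' g"
  unfolding holo_def
proof (intro ballI, clarify)
  fix W \<phi> assume ch: "(W, \<phi>) \<in> charts M"
  define n where "n = cdim M"
  have W: "open W" "openin (top_of_set (Cn n)) (\<phi> ` W)" "homeomorphism W (\<phi> ` W) \<phi> (inv_into W \<phi>)"
    using M ch by (auto simp: complex_manifold_def n_def)
  have fh: "holo_Cn n (\<phi> ` (W \<inter> V)) (\<lambda>z. f (inv_into W \<phi> z))"
    using f ch by (auto simp: holo_def n_def)
  have inv: "inv_into W \<phi> (\<phi> x) = x" if "x \<in> W" for x
    using W(3) that by (simp add: homeomorphism_def)
  have eq': "g (inv_into W \<phi> z) = f (inv_into W \<phi> z)" if "z \<in> \<phi> ` (W \<inter> V')" for z
    using that inv eq by auto
  have "openin (top_of_set W) (W \<inter> V')" using V' by (simp add: openin_open_Int)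
  then have "openin (top_of_set (\<phi> ` W)) (\<phi> ` (W \<inter> V'))"
    by (rule homeomorphism_imp_open_map[OF W(3)])
  then have "openin (top_of_set (Cn n)) (\<phi> ` (W \<inter> V'))"
    using W(2) openin_trans by blast
  then obtain T where T: "open T" "\<phi> ` (W \<inter> V') = Cn n \<inter> T"
    by (auto simp: openin_open)
  have sub: "\<phi> ` (W \<inter> V') \<subseteq> \<phi> ` (W \<inter> V)" using V' by auto
  have "holo_Cn n (\<phi> ` (W \<inter> V')) (\<lambda>z. g (inv_into W \<phi> z))"
    unfolding holo_Cn_def
  proof (intro conjI ballI allI impI)
    have "continuous_on (\<phi> ` (W \<inter> V')) (\<lambda>z. f (inv_into W \<phi> z))"
      using fh sub continuous_on_subset by (auto simp: holo_Cn_def)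
    then show "continuous_on (\<phi> ` (W \<inter> V')) (\<lambda>z. g (inv_into W \<phi> z))"
      using eq' by (simp cong: continuous_on_cong)
    fix z i assume z: "z \<in> \<phi> ` (W \<inter> V')" and i: "i < n"
    have "open ((\<lambda>t. z(i := t)) -` T)"
      using open_vimage[OF T(1) continuous_on_fun_upd] .
    moreover have "z i \<in> (\<lambda>t. z(i := t)) -` T" using z T(2) by auto
    moreover have "f (inv_into W \<phi> (z(i := t))) = g (inv_into W \<phi> (z(i := t)))"
      if "t \<in> (\<lambda>t. z(i := t)) -` T" for t
    proof -
      have "z \<in> Cn n" using z T(2) by auto
      then have "z(i := t) \<in> Cn n" using i by (auto simp: Cn_def)
      then have "z(i := t) \<in> \<phi> ` (W \<inter> V')" using that T(2) by auto
      then show ?thesis using eq' by simp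
    qed
    moreover have "(\<lambda>t. f (inv_into W \<phi> (z(i := t)))) field_differentiable (at (z i))"
      using fh z i sub by (auto simp: holo_Cn_def)
    ultimately show "(\<lambda>t. g (inv_into W \<phi> (z(i := t)))) field_differentiable (at (z i))"
      unfolding field_differentiable_def
      by (meson has_field_derivative_transform_within_open)
  qed
  then show "holo_Cn (cdim M) (\<phi> ` (W \<inter> V')) (\<lambda>z. g (inv_into W \<phi> z))" by (simp add: n_def)
qed

section \<open>Linear and multiplicative operations on sections\<close>

lemma sec_part_add: "sec_part j (s + s') = sec_part j s + sec_part j s'"
  by (auto simp: sec_part_def fun_eq_iff)

lemma sec_part_zero [simp]: "sec_part j 0 = 0"
  by (auto simp: sec_part_def fun_eq_iff)

lemma sec_part_scale: "sec_part j (sec_scale c s) = sec_scale c (sec_part j s)"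
  by (auto simp: sec_part_def sec_scale_def fun_eq_iff)

lemma sec_part_sum: "sec_part j (\<Sum>x\<in>X. f x) = (\<Sum>x\<in>X. sec_part j (f x))"
  using sum_comp_morphism[of "sec_part j" f X] by (simp add: sec_part_add o_def)

lemma sec_part_part: "sec_part i (sec_part j s) = (if i = j then sec_part j s else 0)"
  by (auto simp: sec_part_def fun_eq_iff)

lemma sec_scale_add: "sec_scale c (s + s') = sec_scale c s + sec_scale c s'"
  by (auto simp: sec_scale_def fun_eq_iff ring_distribs)

lemma sec_scale_zero [simp]: "sec_scale c 0 = 0"
  by (auto simp: sec_scale_def fun_eq_iff)

lemma sec_scale_sum: "sec_scale c (\<Sum>x\<in>X. f x) = (\<Sum>x\<in>X. sec_scale c (f x))"
  using sum_comp_morphism[of "sec_scale c" f X] by (simp add: sec_scale_add o_def)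

lemma sec_scale_one [simp]: "sec_scale 1 s = s"
  by (simp add: sec_scale_def)

lemma sec_scale_scale: "sec_scale c (sec_scale d s) = sec_scale (c * d) s"
  by (simp add: sec_scale_def mult.assoc)

lemma sec_scale_uminus_one: "sec_scale (-1) s = - s"
  by (simp add: sec_scale_def fun_eq_iff)

lemma sec_restrict_add: "sec_restrict V (s + s') = sec_restrict V s + sec_restrict V s'"
  by (auto simp: sec_restrict_def fun_eq_iff)

lemma sec_restrict_zero [simp]: "sec_restrict V 0 = 0"
  by (auto simp: sec_restrict_def fun_eq_iff)

lemma sec_restrict_sum: "sec_restrict V (\<Sum>x\<in>X. f x) = (\<Sum>x\<in>X. sec_restrict V (f x))"
  using sum_comp_morphism[of "sec_restrict V" f X] by (simp add: sec_restrict_add o_def)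

lemma sec_restrict_scale: "sec_restrict V (sec_scale c s) = sec_scale c (sec_restrict V s)"
  by (auto simp: sec_restrict_def sec_scale_def fun_eq_iff)

lemma sec_restrict_part: "sec_restrict V (sec_part j s) = sec_part j (sec_restrict V s)"
  by (auto simp: sec_restrict_def sec_part_def fun_eq_iff)

lemma sec_wedge_add_left: "sec_wedge (s + s') t = sec_wedge s t + sec_wedge s' t"
  by (simp add: sec_wedge_def fun_eq_iff wedge_add_left)

lemma sec_wedge_add_right: "sec_wedge t (s + s') = sec_wedge t s + sec_wedge t s'"
  by (simp add: sec_wedge_def fun_eq_iff wedge_add_right)

lemma sec_wedge_zero [simp]: "sec_wedge 0 t = 0" "sec_wedge t 0 = 0"
  by (simp_all add: sec_wedge_def fun_eq_iff)

lemma sec_wedge_scale_left: "sec_wedge (sec_scale c s) t = sec_scale c (sec_wedge s t)"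
  by (simp add: sec_wedge_def sec_scale_def fun_eq_iff wedge_scale_left)

lemma sec_wedge_scale_right: "sec_wedge t (sec_scale c s) = sec_scale c (sec_wedge t s)"
  by (simp add: sec_wedge_def sec_scale_def fun_eq_iff wedge_scale_right)

lemma sec_wedge_sum_left: "sec_wedge (\<Sum>x\<in>X. f x) t = (\<Sum>x\<in>X. sec_wedge (f x) t)"
  using sum_comp_morphism[of "\<lambda>s. sec_wedge s t" f X] by (simp add: sec_wedge_add_left o_def)

lemma sec_wedge_sum_right: "sec_wedge t (\<Sum>x\<in>X. f x) = (\<Sum>x\<in>X. sec_wedge t (f x))"
  using sum_comp_morphism[of "sec_wedge t" f X] by (simp add: sec_wedge_add_right o_def)

text \<open>An operation on the exterior algebra that commutes with every induced map does not
  depend on the trivialisation, so it acts on fibres. Scaling and taking the part of a given degree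
  are instances.\<close>

lemma ext_fibre_map:
  assumes w: "w \<in> ext_fibre E x" and f0: "f 0 = 0"
    and fs: "\<And>a. a \<in> ext_space (rk E) \<Longrightarrow> f a \<in> ext_space (rk E)"
    and fm: "\<And>g a. ext_map (rk E) g (f a) = f (ext_map (rk E) g a)"
  shows "(\<lambda>t. f (w t)) \<in> ext_fibre E x"
proof -
  have "f (w t) = ext_map (rk E) (transition E t t' x) (f (w t'))"
    if "t \<in> trivs E" "t' \<in> trivs E" "x \<in> fst t \<inter> fst t'" for t t'
  proof -
    have "w t = ext_map (rk E) (transition E t t' x) (w t')"
      using w that unfolding ext_fibre_def by blast
    then show ?thesis by (simp add: fm)
  qed
  moreover have "w t = 0" if "\<not> (t \<in> trivs E \<and> x \<in> fst t)" for t
    using w that unfolding ext_fibre_def by blast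
  then have "f (w t) = 0" if "\<not> (t \<in> trivs E \<and> x \<in> fst t)" for t using f0 that by simp
  moreover have "w t \<in> ext_space (rk E)" if "t \<in> trivs E" "x \<in> fst t" for t
    using w that unfolding ext_fibre_def by blast
  then have "f (w t) \<in> ext_space (rk E)" if "t \<in> trivs E" "x \<in> fst t" for t using fs that by simp
  ultimately show ?thesis unfolding ext_fibre_def by blast
qed

lemma ext_fibre_scale: "w \<in> ext_fibre E x \<Longrightarrow> (\<lambda>t I. c * w t I) \<in> ext_fibre E x"
  by (erule ext_fibre_map[where f="\<lambda>a I. c * a I"]) (auto simp: ext_space_def ext_map_scale fun_eq_iff)

lemma ext_fibre_zero: "0 \<in> ext_fibre E x"
  by (auto simp: ext_fibre_def ext_space_def)

lemma ext_fibre_part: "w \<in> ext_fibre E x \<Longrightarrow> (\<lambda>t I. if card I = j then w t I else 0) \<in> ext_fibre E x"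
  by (erule ext_fibre_map[where f="\<lambda>a I. if card I = j then a I else 0"])
    (auto simp: ext_space_def ext_map_part fun_eq_iff)

text \<open>The binary analogue, for sums and wedge products. Compatibility is asked for elements of
  \<open>ext_space (rk E)\<close>, which is where \<open>ext_map_wedge\<close> supplies it.\<close>

lemma ext_fibre_map2:
  assumes w: "w \<in> ext_fibre E x" "w' \<in> ext_fibre E x" and f0: "f 0 0 = 0"
    and fs: "\<And>a b. a \<in> ext_space (rk E) \<Longrightarrow> b \<in> ext_space (rk E) \<Longrightarrow> f a b \<in> ext_space (rk E)"
    and fm: "\<And>g a b. a \<in> ext_space (rk E) \<Longrightarrow> b \<in> ext_space (rk E) \<Longrightarrow>
      ext_map (rk E) g (f a b) = f (ext_map (rk E) g a) (ext_map (rk E) g b)"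
  shows "(\<lambda>t. f (w t) (w' t)) \<in> ext_fibre E x"
proof -
  have "f (w t) (w' t) = ext_map (rk E) (transition E t t' x) (f (w t') (w' t'))"
    if "t \<in> trivs E" "t' \<in> trivs E" "x \<in> fst t \<inter> fst t'" for t t'
  proof -
    have "w t = ext_map (rk E) (transition E t t' x) (w t')" "w' t = ext_map (rk E) (transition E t t' x) (w' t')"
      using w that unfolding ext_fibre_def by blast+
    moreover have "w t' \<in> ext_space (rk E)" "w' t' \<in> ext_space (rk E)"
      using w that unfolding ext_fibre_def by blast+
    ultimately show ?thesis by (simp add: fm)
  qed
  moreover have "w t = 0" "w' t = 0" if "\<not> (t \<in> trivs E \<and> x \<in> fst t)" for t
    using w that unfolding ext_fibre_def by blast+
  then have "f (w t) (w' t) = 0" if "\<not> (t \<in> trivs E \<and> x \<in> fst t)" for t using f0 that by simp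
  moreover have "w t \<in> ext_space (rk E)" "w' t \<in> ext_space (rk E)" if "t \<in> trivs E" "x \<in> fst t" for t
    using w that unfolding ext_fibre_def by blast+
  then have "f (w t) (w' t) \<in> ext_space (rk E)" if "t \<in> trivs E" "x \<in> fst t" for t using fs that by simp
  ultimately show ?thesis unfolding ext_fibre_def by blast
qed

lemma ext_fibre_add: "w \<in> ext_fibre E x \<Longrightarrow> w' \<in> ext_fibre E x \<Longrightarrow> w + w' \<in> ext_fibre E x"
  unfolding plus_fun_def[of w w']
  by (rule ext_fibre_map2[where f="(+)"]) (simp_all only: ext_map_add, simp_all add: ext_space_def)

lemma ext_fibre_wedge:
  "w \<in> ext_fibre E x \<Longrightarrow> w' \<in> ext_fibre E x \<Longrightarrow> (\<lambda>t. wedge (w t) (w' t)) \<in> ext_fibre E x"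
  by (rule ext_fibre_map2[where f=wedge]) (simp_all add: wedge_ext_space ext_map_wedge)

lemma ext_fibre_one: "(\<lambda>t. if t \<in> trivs E \<and> x \<in> fst t then ext_one else 0) \<in> ext_fibre E x"
  by (auto simp: ext_fibre_def ext_map_one) (auto simp: ext_space_def ext_one_def)

lemma holo_wedge:
  assumes "\<And>I. holo M V (\<lambda>x. f x I)" "\<And>I. holo M V (\<lambda>x. g x I)"
  shows "holo M V (\<lambda>x. wedge (f x) (g x) K)"
  unfolding wedge_def by (intro holo_sum holo_mult holo_const assms)

section \<open>Sections of the exterior algebra bundle and their degrees\<close>

lemma OL_zero: "0 \<in> OL E V"
  by (simp add: OL_def ext_fibre_zero holo_const)

lemma OL_add: "s \<in> OL E V \<Longrightarrow> s' \<in> OL E V \<Longrightarrow> s + s' \<in> OL E V"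
  by (simp add: OL_def ext_fibre_add holo_add)

lemma OL_scale: "s \<in> OL E V \<Longrightarrow> sec_scale c s \<in> OL E V"
  unfolding OL_def by (auto simp: sec_scale_def ext_fibre_scale holo_mult holo_const intro!: ext)

lemma OL_sum: "(\<And>x. x \<in> X \<Longrightarrow> f x \<in> OL E V) \<Longrightarrow> (\<Sum>x\<in>X. f x) \<in> OL E V"
  by (rule sum_closed) (auto intro: OL_add OL_zero)

lemma OL_wedge: "s \<in> OL E V \<Longrightarrow> s' \<in> OL E V \<Longrightarrow> sec_wedge s s' \<in> OL E V"
  unfolding OL_def by (auto simp: sec_wedge_def ext_fibre_wedge holo_wedge intro!: ext)

lemma OL_part: "s \<in> OL E V \<Longrightarrow> sec_part j s \<in> OL E V"
proof -
  assume s: "s \<in> OL E V"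
  have "holo E (fst t \<inter> V) (\<lambda>x. if card I = j then s x t I else 0)" if "t \<in> trivs E" for t I
    using s that by (cases "card I = j") (auto simp: OL_def holo_const)
  with s show ?thesis unfolding OL_def by (auto simp: sec_part_def ext_fibre_part intro!: ext)
qed

lemma OL_outside:
  assumes "s \<in> OL E V" "\<not> (x \<in> V \<and> t \<in> trivs E \<and> x \<in> fst t)"
  shows "s x t = 0"
proof (cases "x \<in> V")
  case True
  with assms show ?thesis unfolding OL_def ext_fibre_def by blast
next
  case False
  with assms(1) show ?thesis unfolding OL_def by simp
qed

lemma OL_support: "s \<in> OL E V \<Longrightarrow> s x t I \<noteq> 0 \<Longrightarrow> I \<subseteq> {..<rk E}"
proof (cases "x \<in> V \<and> t \<in> trivs E \<and> x \<in> fst t")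
  case True
  assume "s \<in> OL E V" "s x t I \<noteq> 0"
  moreover from this True have "s x t \<in> ext_space (rk E)" unfolding OL_def ext_fibre_def by blast
  ultimately show ?thesis using ext_spaceD by blast
next
  case False
  assume s: "s \<in> OL E V" and nz: "s x t I \<noteq> 0"
  have "s x t = 0" by (rule OL_outside[OF s False])
  with nz show ?thesis by simp
qed

lemma OL_card: "s \<in> OL E V \<Longrightarrow> s x t I \<noteq> 0 \<Longrightarrow> card I \<le> rk E"
  using card_mono[of "{..<rk E}" I] OL_support by fastforce

lemma sum_sec_part: "s \<in> OL E V \<Longrightarrow> (\<Sum>j\<le>rk E. sec_part j s) = s"
proof (intro ext)
  fix x t I
  assume s: "s \<in> OL E V"
  have "(\<Sum>j\<le>rk E. sec_part j s) x t I = (\<Sum>j\<le>rk E. if j = card I then s x t I else 0)"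
    unfolding sum_fun_apply sec_part_def by (intro sum.cong) auto
  also have "\<dots> = s x t I" using OL_card[OF s, of x t I] by (auto simp: sum.delta)
  finally show "(\<Sum>j\<le>rk E. sec_part j s) x t I = s x t I" .
qed

lemma OL_degs_subset: "s \<in> OL_degs E D V \<Longrightarrow> s \<in> OL E V"
  by (simp add: OL_degs_def)

lemma OL_degs_iff: "s \<in> OL_degs E {j} V \<longleftrightarrow> s \<in> OL E V \<and> sec_part j s = s"
  by (auto simp: OL_degs_def sec_part_def fun_eq_iff)

lemma OL_degs_part: "s \<in> OL E V \<Longrightarrow> sec_part j s \<in> OL_degs E {j} V"
  by (simp add: OL_degs_iff OL_part sec_part_part)

lemma OL_degs_mono: "s \<in> OL_degs E D V \<Longrightarrow> D \<subseteq> D' \<Longrightarrow> s \<in> OL_degs E D' V"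
  by (auto simp: OL_degs_def)

lemma OL_degsD: "s \<in> OL_degs E D V \<Longrightarrow> s x t I \<noteq> 0 \<Longrightarrow> card I \<in> D"
  unfolding OL_degs_def by blast

lemma OL_degs_large: "s \<in> OL_degs E {j} V \<Longrightarrow> rk E < j \<Longrightarrow> s = 0"
proof (intro ext, rule ccontr)
  fix x t I
  assume s: "s \<in> OL_degs E {j} V" and j: "rk E < j" and nz: "s x t I \<noteq> 0 x t I"
  then have "card I = j" using OL_degsD[OF s, of x t I] by simp
  moreover have "card I \<le> rk E" using OL_card[OF OL_degs_subset[OF s], of x t I] nz by simp
  ultimately show False using j by simp
qed

lemma sec_part_large: "s \<in> OL E V \<Longrightarrow> rk E < j \<Longrightarrow> sec_part j s = 0"
  using OL_degs_large OL_degs_part by blast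

lemma OL_degs_zero: "0 \<in> OL_degs E D V"
  by (simp add: OL_degs_def OL_zero)

lemma OL_degs_add: "s \<in> OL_degs E D V \<Longrightarrow> s' \<in> OL_degs E D V \<Longrightarrow> s + s' \<in> OL_degs E D V"
  by (simp add: OL_degs_def OL_add) (metis add.left_neutral)

lemma OL_degs_scale: "s \<in> OL_degs E D V \<Longrightarrow> sec_scale c s \<in> OL_degs E D V"
  by (simp add: OL_degs_def OL_scale) (auto simp: sec_scale_def)

lemma OL_degs_sum: "(\<And>x. x \<in> X \<Longrightarrow> f x \<in> OL_degs E D V) \<Longrightarrow> (\<Sum>x\<in>X. f x) \<in> OL_degs E D V"
  by (rule sum_closed) (auto intro: OL_degs_add OL_degs_zero)

lemma OL_degs_wedge:
  assumes s: "s \<in> OL_degs E {a} V" and s': "s' \<in> OL_degs E {b} V"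
  shows "sec_wedge s s' \<in> OL_degs E {a + b} V"
proof -
  have "pure a (s x t)" for x t
    using OL_degsD[OF s] finite_subset[OF OL_support[OF OL_degs_subset[OF s]]] by (auto simp: pure_def)
  moreover have "pure b (s' x t)" for x t
    using OL_degsD[OF s'] finite_subset[OF OL_support[OF OL_degs_subset[OF s']]] by (auto simp: pure_def)
  ultimately have "pure (a + b) (sec_wedge s s' x t)" for x t
    by (simp add: sec_wedge_def pure_wedge)
  then show ?thesis
    using assms by (auto simp: OL_degs_def OL_wedge pure_def)
qed

lemma sec_part_restrict_degs: "s \<in> OL_degs E {j} V \<Longrightarrow> sec_part i s = (if i = j then s else 0)"
  using sec_part_part[of i j s] by (auto simp: OL_degs_iff)

lemma sec_wedge_one_left:
  assumes "s \<in> OL E V"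
  shows "sec_wedge (sec_one E V) s = s"
proof (intro ext)
  fix x t K
  note z = OL_outside[OF assms, of x t]
  have "wedge ext_one (s x t) K = s x t K"
  proof (cases "finite K")
    case False
    then show ?thesis
      using OL_support[OF assms, of x t K] finite_subset by (auto simp: wedge_infinite)
  qed (simp add: wedge_ext_one_left)
  then show "sec_wedge (sec_one E V) s x t K = s x t K"
    using z by (simp add: sec_wedge_def sec_one_def)
qed

lemma sec_wedge_one_right:
  assumes "s \<in> OL E V"
  shows "sec_wedge s (sec_one E V) = s"
proof (intro ext)
  fix x t K
  note z = OL_outside[OF assms, of x t]
  have "wedge (s x t) ext_one K = s x t K"
  proof (cases "finite K")
    case False
    then show ?thesis
      using OL_support[OF assms, of x t K] finite_subset by (auto simp: wedge_infinite)
  qed (simp add: wedge_ext_one_right)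
  then show "sec_wedge s (sec_one E V) x t K = s x t K"
    using z by (simp add: sec_wedge_def sec_one_def)
qed

text \<open>With rank below 8, an endomorphism that raises degrees by even amounts has only
  components of degrees 0, 2, 4 and 6. This is the source of the bound 3 on \<open>q\<close>
  throughout.\<close>

locale low_rank_bundle =
  fixes E :: "('a::{t2_space,second_countable_topology}, 'e) vbundle"
  assumes vector_bundle: "holomorphic_vector_bundle E" and rk_less: "rk E < 8"
begin

lemma manifold: "complex_manifold E"
  using vector_bundle by (simp add: holomorphic_vector_bundle_def)

lemma open_triv: "t \<in> trivs E \<Longrightarrow> open (fst t)"
  using vector_bundle by (simp add: holomorphic_vector_bundle_def)

lemma OL_one:
  assumes V: "open V"
  shows "sec_one E V \<in> OL E V"
proof -
  have "sec_one E V x \<in> ext_fibre E x" if "x \<in> V" for x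
    using ext_fibre_one[of E x] that by (simp add: sec_one_def)
  moreover have "holo E (fst t \<inter> V) (\<lambda>x. sec_one E V x t I)" if "t \<in> trivs E" for t I
  proof (rule holo_eq_on[OF manifold])
    show "holo E (fst t \<inter> V) (\<lambda>x. ext_one I)" by (rule holo_const)
    show "open (fst t \<inter> V)" using open_triv[OF that] V by blast
  qed (use that in \<open>auto simp: sec_one_def\<close>)
  ultimately show ?thesis by (simp add: OL_def) (auto simp: sec_one_def)
qed

lemma OL_restrict:
  assumes s: "s \<in> OL E V" and V': "open V'" "V' \<subseteq> V"
  shows "sec_restrict V' s \<in> OL E V'"
proof -
  have "holo E (fst t \<inter> V') (\<lambda>x. sec_restrict V' s x t I)" if "t \<in> trivs E" for t I
  proof (rule holo_eq_on[OF manifold])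
    show "holo E (fst t \<inter> V) (\<lambda>x. s x t I)" using s that by (simp add: OL_def)
    show "open (fst t \<inter> V')" using open_triv[OF that] V' by blast
  qed (use V' in \<open>auto simp: sec_restrict_def\<close>)
  moreover have "sec_restrict V' s x \<in> ext_fibre E x" if "x \<in> V'" for x
    using s V' that by (auto simp: OL_def sec_restrict_def)
  ultimately show ?thesis by (simp add: OL_def) (simp add: sec_restrict_def)
qed

end

section \<open>Filtered endomorphisms\<close>

abbreviation degs_from :: "nat \<Rightarrow> nat set" where
  "degs_from j \<equiv> {i. \<exists>k. i = j + 2 * k}"

lemma degs_from_mono:
  assumes "i \<in> degs_from j"
  shows "degs_from i \<subseteq> degs_from j"
proof
  obtain k where k: "i = j + 2 * k" using assms by blast
  fix x assume "x \<in> degs_from i"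
  then obtain l where "x = i + 2 * l" by blast
  then have "x = j + 2 * (k + l)" by (simp add: k)
  then show "x \<in> degs_from j" by blast
qed

text \<open>The endomorphisms that never lower degrees and raise them only by even amounts. They
  contain the identity, the derivations in \<open>Der_pos\<close> and the automorphisms in
  \<open>G\<close>, and are closed under sums and composition, so they are the common home for the
  calculus of components.\<close>

definition End_filt ::
    "('a::topological_space, 'e) vbundle \<Rightarrow> 'a set \<Rightarrow> ('a, 'e) endo set" where
  "End_filt E V =
     {\<phi> \<in> End E V. \<forall>W j. open W \<and> W \<subseteq> V \<longrightarrow> (\<forall>s\<in>OL_degs E {j} W. \<phi> W s \<in> OL_degs E (degs_from j) W)}"

definition endo_scale :: "complex \<Rightarrow> ('a, 'e) endo \<Rightarrow> ('a, 'e) endo" where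
  "endo_scale c \<phi> = (\<lambda>V s. sec_scale c (\<phi> V s))"

lemma zero_fun_eta [simp]: "(\<lambda>x. 0) = 0"
  by (simp add: zero_fun_def)

lemma End_zero_outside: "\<phi> \<in> End E V \<Longrightarrow> \<not> (open W \<and> W \<subseteq> V \<and> s \<in> OL E W) \<Longrightarrow> \<phi> W s = 0"
  unfolding End_def by (drule CollectD, drule conjunct1) simp

lemma End_local:
  assumes "\<phi> \<in> End E V" and W: "open W" "W \<subseteq> V" and s: "s \<in> OL E W"
  shows End_OL: "\<phi> W s \<in> OL E W"
    and End_add: "s' \<in> OL E W \<Longrightarrow> \<phi> W (s + s') = \<phi> W s + \<phi> W s'"
    and End_scale: "\<phi> W (sec_scale c s) = sec_scale c (\<phi> W s)"
    and End_sec_restrict: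
      "open W' \<Longrightarrow> W' \<subseteq> W \<Longrightarrow> \<phi> W' (sec_restrict W' s) = sec_restrict W' (\<phi> W s)"
proof -
  note e = assms(1)[unfolded End_def mem_Collect_eq, THEN conjunct2, THEN spec[of _ W], THEN mp, OF conjI[OF W]]
  show "\<phi> W s \<in> OL E W" using e[THEN conjunct1] s by (rule bspec)
  show "\<phi> W (s + s') = \<phi> W s + \<phi> W s'" if "s' \<in> OL E W"
    using e[THEN conjunct2, THEN conjunct1, THEN bspec, OF s] that by (rule bspec)
  show "\<phi> W (sec_scale c s) = sec_scale c (\<phi> W s)"
    using e[THEN conjunct2, THEN conjunct2, THEN conjunct1, THEN spec[of _ c]] s by (rule bspec)
  show "\<phi> W' (sec_restrict W' s) = sec_restrict W' (\<phi> W s)" if "open W'" "W' \<subseteq> W"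
    using e[THEN conjunct2, THEN conjunct2, THEN conjunct2, THEN conjunct2, THEN conjunct2, THEN spec[of _ W'], THEN mp, OF conjI[OF that]] s
    by (rule bspec)
qed

lemma End_zero: "\<phi> \<in> End E V \<Longrightarrow> \<phi> W 0 = 0"
  using End_add[of \<phi> E V W 0 0] End_zero_outside[of \<phi> E V W 0] OL_zero[of E W] by (metis add_cancel_right_left)

lemma End_sum:
  assumes "\<phi> \<in> End E V" "open W" "W \<subseteq> V" "\<And>x. x \<in> X \<Longrightarrow> f x \<in> OL E W"
  shows "\<phi> W (\<Sum>x\<in>X. f x) = (\<Sum>x\<in>X. \<phi> W (f x))"
proof -
  have "\<phi> W (sum f X) = (\<Sum>x\<in>X. \<phi> W (f x)) \<and> sum f X \<in> OL E W" if "\<forall>x\<in>X. f x \<in> OL E W" for X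
    using that
  proof (induction X rule: infinite_finite_induct)
    case (insert x F)
    then have "\<phi> W (sum f F) = (\<Sum>x\<in>F. \<phi> W (f x))" "sum f F \<in> OL E W" "f x \<in> OL E W" by auto
    then show ?case
      unfolding sum.insert[OF insert.hyps(1,2)] using End_add[OF assms(1-3), of "f x" "sum f F"] OL_add by metis
  qed (simp_all add: End_zero[OF assms(1)] OL_zero del: fun_eq_iff)
  then show ?thesis using assms(4) by blast
qed

lemma End_filt_subset: "\<phi> \<in> End_filt E V \<Longrightarrow> \<phi> \<in> End E V"
  by (simp add: End_filt_def)

lemma End_filt_degs:
  "\<phi> \<in> End_filt E V \<Longrightarrow> open W \<Longrightarrow> W \<subseteq> V \<Longrightarrow> s \<in> OL_degs E {j} W \<Longrightarrow> \<phi> W s \<in> OL_degs E (degs_from j) W"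
  unfolding End_filt_def by (drule CollectD, drule conjunct2) simp

lemma sec_part_degs:
  assumes "s \<in> OL_degs E D W" "s \<in> OL E W"
  shows "sec_part j s \<in> (if j \<in> D then OL_degs E {j} W else {0})"
proof (cases "j \<in> D")
  case True
  then show ?thesis using OL_degs_part[OF assms(2)] by simp
next
  case False
  have "sec_part j s = 0"
    using False OL_degsD[OF assms(1)] by (intro ext) (auto simp: sec_part_def)
  then show ?thesis using False by simp
qed

text \<open>A section is the sum of its homogeneous parts, so the condition on homogeneous sections
  and additivity control all sections. Since \<open>degs_from j\<close> consists of numbers of the
  parity of \<open>j\<close>, even and odd sections are preserved too.\<close>

lemma End_filtI:
  assumes zero: "\<And>W s. \<not> (open W \<and> W \<subseteq> V \<and> s \<in> OL E W) \<Longrightarrow> \<phi> W s = 0"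
    and add: "\<And>W s t. open W \<Longrightarrow> W \<subseteq> V \<Longrightarrow> s \<in> OL E W \<Longrightarrow> t \<in> OL E W \<Longrightarrow> \<phi> W (s + t) = \<phi> W s + \<phi> W t"
    and scale: "\<And>W s c. open W \<Longrightarrow> W \<subseteq> V \<Longrightarrow> s \<in> OL E W \<Longrightarrow> \<phi> W (sec_scale c s) = sec_scale c (\<phi> W s)"
    and restr: "\<And>W W' s. open W \<Longrightarrow> W \<subseteq> V \<Longrightarrow> open W' \<Longrightarrow> W' \<subseteq> W \<Longrightarrow> s \<in> OL E W \<Longrightarrow>
      \<phi> W' (sec_restrict W' s) = sec_restrict W' (\<phi> W s)"
    and degs: "\<And>W j s. open W \<Longrightarrow> W \<subseteq> V \<Longrightarrow> s \<in> OL_degs E {j} W \<Longrightarrow> \<phi> W s \<in> OL_degs E (degs_from j) W"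
  shows "\<phi> \<in> End_filt E V"
proof -
  have z: "\<phi> W 0 = 0" if "open W" "W \<subseteq> V" for W
    using add[OF that OL_zero OL_zero] by simp
  \<comment> \<open>Used with the pair \<open>D\<close>, \<open>D'\<close> equal to all degrees, to
    the even degrees and to the odd degrees.\<close>
  have gen: "\<phi> W s \<in> OL_degs E D' W"
    if W: "open W" "W \<subseteq> V" and s: "s \<in> OL_degs E D W" and D: "\<And>j. j \<in> D \<Longrightarrow> degs_from j \<subseteq> D'" for W s D D'
  proof -
    have sO: "s \<in> OL E W" using s by (rule OL_degs_subset)
    have "\<phi> W (sec_part j s) \<in> OL_degs E D' W" for j
    proof (cases "j \<in> D")
      case True
      then show ?thesis using degs[OF W OL_degs_part[OF sO, of j]] D OL_degs_mono by blast
    next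
      case False
      then have "sec_part j s = 0" using sec_part_degs[OF s sO, of j] by simp
      then show ?thesis using z[OF W] OL_degs_zero by simp
    qed
    moreover have "\<phi> W (\<Sum>j\<in>J. sec_part j s) = (\<Sum>j\<in>J. \<phi> W (sec_part j s))" if "finite J" for J
      using that
    proof (induction J rule: finite_induct)
      case empty
      show ?case unfolding sum.empty by (rule z[OF W])
    next
      case (insert j J)
      show ?case
        unfolding sum.insert[OF insert.hyps]
        using add[OF W OL_part[OF sO, of j] OL_sum[of J "\<lambda>j. sec_part j s", OF OL_part[OF sO]]] insert.IH by metis
    qed
    ultimately show ?thesis
      using OL_degs_sum[of "{..rk E}" "\<lambda>j. \<phi> W (sec_part j s)" E D' W] sum_sec_part[OF sO] by (metis finite_atMost)
  qed
  have all: "s \<in> OL_degs E UNIV W \<longleftrightarrow> s \<in> OL E W" for s W by (simp add: OL_degs_def)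
  have OL: "\<phi> W s \<in> OL E W" if "open W" "W \<subseteq> V" "s \<in> OL E W" for W s
    using gen[OF that(1,2), of s UNIV UNIV] that(3) by (simp add: all)
  have ev: "\<phi> W s \<in> OL_degs E {j. even j} W" if "open W" "W \<subseteq> V" "s \<in> OL_degs E {j. even j} W" for W s
    by (rule gen[OF that]) auto
  have od: "\<phi> W s \<in> OL_degs E {j. odd j} W" if "open W" "W \<subseteq> V" "s \<in> OL_degs E {j. odd j} W" for W s
    by (rule gen[OF that]) auto
  have "\<phi> \<in> End E V"
    unfolding End_def mem_Collect_eq
    by (intro conjI allI impI ballI; (elim conjE)?; (rule zero OL add scale ev od restr; assumption))
  moreover have "\<forall>W j. open W \<and> W \<subseteq> V \<longrightarrow> (\<forall>s\<in>OL_degs E {j} W. \<phi> W s \<in> OL_degs E (degs_from j) W)"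
    by (intro allI impI ballI, elim conjE, rule degs)
  ultimately show ?thesis unfolding End_filt_def mem_Collect_eq by (rule conjI)
qed

lemma endo_eqI:
  assumes "\<phi> \<in> End E V" "\<psi> \<in> End E V"
    and "\<And>W j s. open W \<Longrightarrow> W \<subseteq> V \<Longrightarrow> s \<in> OL_degs E {j} W \<Longrightarrow> \<phi> W s = \<psi> W s"
  shows "\<phi> = \<psi>"
proof (intro ext[of \<phi> \<psi>] ext[of "\<phi> _" "\<psi> _"])
  fix W s
  show "\<phi> W s = \<psi> W s"
  proof (cases "open W \<and> W \<subseteq> V \<and> s \<in> OL E W")
    case True
    then have W: "open W" "W \<subseteq> V" and s: "s \<in> OL E W" by auto
    have "\<phi> W (\<Sum>j\<le>rk E. sec_part j s) = \<psi> W (\<Sum>j\<le>rk E. sec_part j s)"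
      using assms(3)[OF W OL_degs_part[OF s]]
      by (simp add: End_sum[OF assms(1) W OL_part[OF s]] End_sum[OF assms(2) W OL_part[OF s]])
    then show ?thesis by (simp add: sum_sec_part[OF s])
  next
    case False
    then show ?thesis using End_zero_outside assms(1,2) by metis
  qed
qed

lemma OL_degs_nested: "s \<in> OL_degs E {j + m} W \<Longrightarrow> even m \<Longrightarrow> s \<in> OL_degs E (degs_from j) W"
  by (erule OL_degs_mono) auto

section \<open>Algebra of filtered endomorphisms\<close>

lemma End_filt_zero: "0 \<in> End_filt E V"
  by (rule End_filtI) (simp_all add: OL_degs_zero)

lemma End_filt_add:
  assumes "\<phi> \<in> End_filt E V" "\<psi> \<in> End_filt E V"
  shows "\<phi> + \<psi> \<in> End_filt E V"
proof (rule End_filtI)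
  note e = assms[THEN End_filt_subset]
  show "(\<phi> + \<psi>) W s = 0" if "\<not> (open W \<and> W \<subseteq> V \<and> s \<in> OL E W)" for W s
    unfolding plus_fun_apply using End_zero_outside[OF e(1) that] End_zero_outside[OF e(2) that] by simp
  show "(\<phi> + \<psi>) W (s + t) = (\<phi> + \<psi>) W s + (\<phi> + \<psi>) W t"
    if "open W" "W \<subseteq> V" "s \<in> OL E W" "t \<in> OL E W" for W s t
    unfolding plus_fun_apply[of \<phi> \<psi>] plus_fun_apply[of "\<phi> W"]
      End_add[OF e(1) that] End_add[OF e(2) that] by (simp only: ac_simps)
  show "(\<phi> + \<psi>) W (sec_scale c s) = sec_scale c ((\<phi> + \<psi>) W s)" if "open W" "W \<subseteq> V" "s \<in> OL E W" for W s c
    unfolding plus_fun_apply[of \<phi> \<psi>] plus_fun_apply[of "\<phi> W"] sec_scale_add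
      End_scale[OF e(1) that] End_scale[OF e(2) that] ..
  show "(\<phi> + \<psi>) W' (sec_restrict W' s) = sec_restrict W' ((\<phi> + \<psi>) W s)"
    if "open W" "W \<subseteq> V" "open W'" "W' \<subseteq> W" "s \<in> OL E W" for W W' s
    unfolding plus_fun_apply[of \<phi> \<psi>] plus_fun_apply[of "\<phi> _"] sec_restrict_add
      End_sec_restrict[OF e(1) that(1,2,5,3,4)] End_sec_restrict[OF e(2) that(1,2,5,3,4)] ..
  show "(\<phi> + \<psi>) W s \<in> OL_degs E (degs_from j) W" if "open W" "W \<subseteq> V" "s \<in> OL_degs E {j} W" for W j s
    unfolding plus_fun_apply[of \<phi> \<psi>] plus_fun_apply[of "\<phi> W"]
    by (rule OL_degs_add[OF End_filt_degs[OF assms(1) that] End_filt_degs[OF assms(2) that]])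
qed

lemma End_filt_scale:
  assumes "\<phi> \<in> End_filt E V"
  shows "endo_scale c \<phi> \<in> End_filt E V"
proof (rule End_filtI, unfold endo_scale_def)
  note e = assms[THEN End_filt_subset]
  show "sec_scale c (\<phi> W s) = 0" if "\<not> (open W \<and> W \<subseteq> V \<and> s \<in> OL E W)" for W s
    using End_zero_outside[OF e(1) that] by simp
  show "sec_scale c (\<phi> W (s + t)) = sec_scale c (\<phi> W s) + sec_scale c (\<phi> W t)"
    if "open W" "W \<subseteq> V" "s \<in> OL E W" "t \<in> OL E W" for W s t
    unfolding End_add[OF e(1) that] by (rule sec_scale_add)
  show "sec_scale c (\<phi> W (sec_scale d s)) = sec_scale d (sec_scale c (\<phi> W s))"
    if "open W" "W \<subseteq> V" "s \<in> OL E W" for W s d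
    unfolding End_scale[OF e(1) that] by (simp add: sec_scale_scale mult.commute)
  show "sec_scale c (\<phi> W' (sec_restrict W' s)) = sec_restrict W' (sec_scale c (\<phi> W s))"
    if "open W" "W \<subseteq> V" "open W'" "W' \<subseteq> W" "s \<in> OL E W" for W W' s
    unfolding End_sec_restrict[OF e(1) that(1,2,5,3,4)] by (simp add: sec_restrict_scale)
  show "sec_scale c (\<phi> W s) \<in> OL_degs E (degs_from j) W" if "open W" "W \<subseteq> V" "s \<in> OL_degs E {j} W" for W j s
    by (rule OL_degs_scale[OF End_filt_degs[OF assms(1) that]])
qed

lemma endo_scale_uminus_one: "endo_scale (-1) \<phi> = - \<phi>"
  by (intro ext) (simp add: endo_scale_def sec_scale_def)

lemma End_filt_uminus: "\<phi> \<in> End_filt E V \<Longrightarrow> - \<phi> \<in> End_filt E V"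
  using End_filt_scale[of \<phi> E V "-1"] by (simp add: endo_scale_uminus_one)

lemma End_filt_diff: "\<phi> \<in> End_filt E V \<Longrightarrow> \<psi> \<in> End_filt E V \<Longrightarrow> \<phi> - \<psi> \<in> End_filt E V"
  using End_filt_add[OF _ End_filt_uminus, of \<phi> E V \<psi>] by simp

lemma End_filt_sum: "(\<And>x. x \<in> X \<Longrightarrow> f x \<in> End_filt E V) \<Longrightarrow> sum f X \<in> End_filt E V"
  by (rule sum_closed) (auto intro: End_filt_add End_filt_zero)

lemma End_filt_comp:
  assumes "\<phi> \<in> End_filt E V" "\<psi> \<in> End_filt E V"
  shows "\<phi> \<bullet>\<bullet> \<psi> \<in> End_filt E V"
proof (rule End_filtI, unfold endo_comp_def)
  note e = assms[THEN End_filt_subset]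
  show "\<phi> W (\<psi> W s) = 0" if "\<not> (open W \<and> W \<subseteq> V \<and> s \<in> OL E W)" for W s
    unfolding End_zero_outside[OF e(2) that] by (rule End_zero[OF e(1)])
  show "\<phi> W (\<psi> W (s + t)) = \<phi> W (\<psi> W s) + \<phi> W (\<psi> W t)"
    if "open W" "W \<subseteq> V" "s \<in> OL E W" "t \<in> OL E W" for W s t
    unfolding End_add[OF e(2) that]
    by (rule End_add[OF e(1) that(1,2) End_OL[OF e(2) that(1,2,3)] End_OL[OF e(2) that(1,2,4)]])
  show "\<phi> W (\<psi> W (sec_scale d s)) = sec_scale d (\<phi> W (\<psi> W s))"
    if "open W" "W \<subseteq> V" "s \<in> OL E W" for W s d
    unfolding End_scale[OF e(2) that] by (rule End_scale[OF e(1) that(1,2) End_OL[OF e(2) that]])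
  show "\<phi> W' (\<psi> W' (sec_restrict W' s)) = sec_restrict W' (\<phi> W (\<psi> W s))"
    if "open W" "W \<subseteq> V" "open W'" "W' \<subseteq> W" "s \<in> OL E W" for W W' s
    unfolding End_sec_restrict[OF e(2) that(1,2,5,3,4)]
    by (rule End_sec_restrict[OF e(1) that(1,2) End_OL[OF e(2) that(1,2,5)] that(3,4)])
  show "\<phi> W (\<psi> W s) \<in> OL_degs E (degs_from j) W" if W: "open W" "W \<subseteq> V" and s: "s \<in> OL_degs E {j} W" for W j s
  proof -
    have d: "\<psi> W s \<in> OL_degs E (degs_from j) W" by (rule End_filt_degs[OF assms(2) W s])
    then have O: "\<psi> W s \<in> OL E W" by (rule OL_degs_subset)
    have "\<phi> W (sec_part i (\<psi> W s)) \<in> OL_degs E (degs_from j) W" for i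
    proof (cases "i \<in> degs_from j")
      case True
      then have "degs_from i \<subseteq> degs_from j" by (rule degs_from_mono)
      then show ?thesis
        using End_filt_degs[OF assms(1) W OL_degs_part[OF O, of i]] OL_degs_mono by blast
    next
      case False
      then have "sec_part i (\<psi> W s) = 0" using sec_part_degs[OF d O, of i] by simp
      then show ?thesis using End_zero[OF e(1)] OL_degs_zero by simp
    qed
    then have "(\<Sum>i\<le>rk E. \<phi> W (sec_part i (\<psi> W s))) \<in> OL_degs E (degs_from j) W"
      by (rule OL_degs_sum)
    also have "(\<Sum>i\<le>rk E. \<phi> W (sec_part i (\<psi> W s))) = \<phi> W (\<Sum>i\<le>rk E. sec_part i (\<psi> W s))"
      by (rule End_sum[OF e(1) W OL_part[OF O], symmetric])
    finally show ?thesis by (simp add: sum_sec_part[OF O])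
  qed
qed

lemma endo_ext: "(\<And>W s. \<phi> W s = \<psi> W s) \<Longrightarrow> \<phi> = (\<psi> :: ('a, 'e) endo)"
  by (rule ext, rule ext)

lemma endo_comp_assoc: "\<phi> \<bullet>\<bullet> \<psi> \<bullet>\<bullet> \<theta> = \<phi> \<bullet>\<bullet> (\<psi> \<bullet>\<bullet> \<theta>)"
  by (simp add: endo_comp_def)

lemma endo_comp_zero_left [simp]: "0 \<bullet>\<bullet> \<psi> = 0"
  by (intro ext) (simp add: endo_comp_def)

lemma endo_comp_zero_right: "\<phi> \<in> End E V \<Longrightarrow> \<phi> \<bullet>\<bullet> 0 = 0"
  by (intro ext) (simp add: endo_comp_def End_zero)

lemma endo_id_right: "\<phi> \<in> End E V \<Longrightarrow> \<phi> \<bullet>\<bullet> endo_id E V = \<phi>"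
  by (rule endo_ext) (auto simp: endo_comp_def endo_id_def End_zero End_zero_outside)

lemma endo_id_left: "\<phi> \<in> End E V \<Longrightarrow> endo_id E V \<bullet>\<bullet> \<phi> = \<phi>"
proof (rule endo_ext)
  fix W s
  assume \<phi>: "\<phi> \<in> End E V"
  show "(endo_id E V \<bullet>\<bullet> \<phi>) W s = \<phi> W s"
  proof (cases "open W \<and> W \<subseteq> V \<and> s \<in> OL E W")
    case True
    then show ?thesis using End_OL[OF \<phi>] by (simp add: endo_comp_def endo_id_def)
  next
    case False
    then show ?thesis unfolding endo_comp_def endo_id_def End_zero_outside[OF \<phi> False] by simp
  qed
qed

lemma endo_restrict_apply: "W \<subseteq> V \<Longrightarrow> endo_restrict V \<phi> W = \<phi> W"
  by (simp add: endo_restrict_def)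

lemma endo_restrict_add: "endo_restrict V (\<phi> + \<psi>) = endo_restrict V \<phi> + endo_restrict V \<psi>"
  by (intro ext) (simp add: endo_restrict_def)

lemma endo_restrict_uminus: "endo_restrict V (- \<phi>) = - endo_restrict V \<phi>"
  by (intro ext) (simp add: endo_restrict_def)

lemma endo_restrict_diff: "endo_restrict V (\<phi> - \<psi>) = endo_restrict V \<phi> - endo_restrict V \<psi>"
  by (intro ext) (simp add: endo_restrict_def)

lemma endo_restrict_zero [simp]: "endo_restrict V 0 = 0"
  by (intro ext) (simp add: endo_restrict_def)

lemma endo_restrict_comp: "endo_restrict V (\<phi> \<bullet>\<bullet> \<psi>) = endo_restrict V \<phi> \<bullet>\<bullet> endo_restrict V \<psi>"
  by (intro ext) (simp add: endo_restrict_def endo_comp_def)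

lemma endo_restrict_restrict: "V' \<subseteq> V \<Longrightarrow> endo_restrict V' (endo_restrict V \<phi>) = endo_restrict V' \<phi>"
  by (intro ext) (auto simp: endo_restrict_def)

lemma endo_restrict_self: "\<phi> \<in> End E V \<Longrightarrow> endo_restrict V \<phi> = \<phi>"
  by (rule endo_ext) (metis End_zero_outside endo_restrict_def)

lemma endo_restrict_id: "V' \<subseteq> V \<Longrightarrow> endo_restrict V' (endo_id E V) = endo_id E V'"
  by (intro ext) (auto simp: endo_restrict_def endo_id_def)

lemma End_filt_restrict:
  assumes "\<phi> \<in> End_filt E V" "V' \<subseteq> V"
  shows "endo_restrict V' \<phi> \<in> End_filt E V'"
proof (rule End_filtI)
  note e = assms(1)[THEN End_filt_subset]
  fix W
  show "endo_restrict V' \<phi> W s = 0" if "\<not> (open W \<and> W \<subseteq> V' \<and> s \<in> OL E W)" for s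
    using End_zero_outside[OF e, of W s] that assms(2) by (auto simp: endo_restrict_def)
  assume W: "open W" "W \<subseteq> V'"
  then have W': "W \<subseteq> V" using assms(2) by blast
  show "endo_restrict V' \<phi> W (s + t) = endo_restrict V' \<phi> W s + endo_restrict V' \<phi> W t"
    if "s \<in> OL E W" "t \<in> OL E W" for s t
    unfolding endo_restrict_apply[OF W(2)] by (rule End_add[OF e W(1) W' that])
  show "endo_restrict V' \<phi> W (sec_scale c s) = sec_scale c (endo_restrict V' \<phi> W s)" if "s \<in> OL E W" for s c
    unfolding endo_restrict_apply[OF W(2)] by (rule End_scale[OF e W(1) W' that])
  show "endo_restrict V' \<phi> Z (sec_restrict Z s) = sec_restrict Z (endo_restrict V' \<phi> W s)"
    if "open Z" "Z \<subseteq> W" "s \<in> OL E W" for Z s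
  proof -
    have "Z \<subseteq> V'" using that W by blast
    then show ?thesis
      using End_sec_restrict[OF e W(1) W' that(3,1,2)] by (simp add: endo_restrict_apply W(2))
  qed
  show "endo_restrict V' \<phi> W s \<in> OL_degs E (degs_from j) W" if "s \<in> OL_degs E {j} W" for j s
    unfolding endo_restrict_apply[OF W(2)] by (rule End_filt_degs[OF assms(1) W(1) W' that])
qed

section \<open>Homogeneous components of endomorphisms\<close>

lemma pr_add: "pr E m (\<phi> + \<psi>) = pr E m \<phi> + pr E m \<psi>"
  by (intro ext) (simp add: pr_def sec_part_add sum.distrib)

lemma pr_scale: "pr E m (endo_scale c \<phi>) = endo_scale c (pr E m \<phi>)"
  by (intro ext) (simp add: pr_def endo_scale_def sec_part_scale sec_scale_sum)

lemma pr_uminus: "pr E m (- \<phi>) = - pr E m \<phi>"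
  using pr_scale[of E m "-1"] by (simp only: endo_scale_uminus_one)

lemma pr_diff: "pr E m (\<phi> - \<psi>) = pr E m \<phi> - pr E m \<psi>"
  using pr_add[of E m \<phi> "- \<psi>"] by (simp add: pr_uminus)

lemma pr_zero [simp]: "pr E m 0 = 0"
  by (intro ext) (simp add: pr_def)

lemma pr_sum: "pr E m (sum f X) = (\<Sum>x\<in>X. pr E m (f x))"
  using sum_comp_morphism[of "pr E m" f X] by (simp add: pr_add o_def)

lemma pr_restrict: "pr E m (endo_restrict V \<phi>) = endo_restrict V (pr E m \<phi>)"
  by (intro ext) (simp add: pr_def endo_restrict_def)

text \<open>On a section of degree \<open>j\<close> only the summand of index \<open>j\<close> in
  \<open>pr\<close> survives. If \<open>j\<close> exceeds the rank that summand is missing, but then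
  the section is 0.\<close>

lemma pr_homogeneous:
  assumes "\<phi> \<in> End E V" and s: "s \<in> OL_degs E {j} W"
  shows "pr E m \<phi> W s = sec_part (j + m) (\<phi> W s)"
proof (cases "j \<le> rk E")
  case True
  have "pr E m \<phi> W s = (\<Sum>i\<le>rk E. sec_part (i + m) (\<phi> W (sec_part i s)))"
    using OL_degs_subset[OF s] by (simp add: pr_def)
  also have "\<dots> = (\<Sum>i\<le>rk E. if i = j then sec_part (j + m) (\<phi> W s) else 0)"
    by (intro sum.cong refl) (simp add: sec_part_restrict_degs[OF s] End_zero[OF assms(1)])
  finally show ?thesis using True by (simp add: sum.delta)
next
  case False
  then have "s = 0" using OL_degs_large[OF s] by simp
  have "pr E m \<phi> W 0 = 0" unfolding pr_def using End_zero[OF assms(1)] by (simp add: OL_zero)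
  then show ?thesis unfolding \<open>s = 0\<close> using End_zero[OF assms(1)] by simp
qed

lemma endo_add_apply: "(\<phi> + \<psi>) W s = \<phi> W s + \<psi> W s" for \<phi> :: "('b, 'c) endo"
  by (intro ext) simp

lemma endo_comp_apply: "(\<phi> \<bullet>\<bullet> \<psi>) W s = \<phi> W (\<psi> W s)"
  by (simp add: endo_comp_def)

context low_rank_bundle
begin

abbreviation P :: "nat \<Rightarrow> ('a, 'e) endo \<Rightarrow> ('a, 'e) endo" where
  "P q \<equiv> pr E (2 * q)"

abbreviation D :: "nat \<Rightarrow> 'a set \<Rightarrow> ('a, 'e) endo set" where
  "D q \<equiv> Der_deg E (2 * q)"

abbreviation F :: "'a set \<Rightarrow> ('a, 'e) endo set" where
  "F \<equiv> End_filt E"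

lemma End_filt_id: "endo_id E V \<in> F V"
proof (rule End_filtI)
  fix W j and s :: "('a, 'e) lsec"
  assume W: "open W" "W \<subseteq> V" and s: "s \<in> OL_degs E {j} W"
  have "s \<in> OL E W" using s by (rule OL_degs_subset)
  moreover have "s \<in> OL_degs E (degs_from j) W" using s by (rule OL_degs_mono) auto
  ultimately show "endo_id E V W s \<in> OL_degs E (degs_from j) W" using W by (simp add: endo_id_def)
next
  fix W W' and s :: "('a, 'e) lsec"
  assume W: "open W" "W \<subseteq> V" "open W'" "W' \<subseteq> W" "s \<in> OL E W"
  have "sec_restrict W' s \<in> OL E W'" using OL_restrict W by blast
  moreover have "W' \<subseteq> V" using W by blast
  ultimately show "endo_id E V W' (sec_restrict W' s) = sec_restrict W' (endo_id E V W s)"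
    using W by (simp add: endo_id_def)
qed (auto simp: endo_id_def OL_add OL_scale)

lemma End_filt_pr:
  assumes \<phi>: "\<phi> \<in> F V"
  shows "P q \<phi> \<in> F V"
proof (rule End_filtI)
  note e = End_filt_subset[OF \<phi>]
  show "P q \<phi> W s = 0" if n: "\<not> (open W \<and> W \<subseteq> V \<and> s \<in> OL E W)" for W s
  proof (cases "s \<in> OL E W")
    case True
    then have "\<phi> W t = 0" for t using n End_zero_outside[OF e] by blast
    then show ?thesis by (simp add: pr_def)
  qed (simp add: pr_def)
  show "P q \<phi> W s \<in> OL_degs E (degs_from j) W" if W: "open W" "W \<subseteq> V" and s: "s \<in> OL_degs E {j} W" for W j s
    unfolding pr_homogeneous[OF e s]
    by (rule OL_degs_nested[OF OL_degs_part[OF End_OL[OF e W OL_degs_subset[OF s]]]]) simp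
  show "P q \<phi> W (s + t) = P q \<phi> W s + P q \<phi> W t"
    if W: "open W" "W \<subseteq> V" and s: "s \<in> OL E W" and t: "t \<in> OL E W" for W s t
    using OL_add[OF s t] s t
    by (simp add: pr_def sec_part_add End_add[OF e W OL_part[OF s] OL_part[OF t]] sum.distrib)
  show "P q \<phi> W (sec_scale c s) = sec_scale c (P q \<phi> W s)"
    if W: "open W" "W \<subseteq> V" and s: "s \<in> OL E W" for W s c
    using OL_scale[OF s] s
    by (simp add: pr_def sec_part_scale End_scale[OF e W OL_part[OF s]] sec_scale_sum)
  show "P q \<phi> W' (sec_restrict W' s) = sec_restrict W' (P q \<phi> W s)"
    if W: "open W" "W \<subseteq> V" and W': "open W'" "W' \<subseteq> W" and s: "s \<in> OL E W" for W W' s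
    using OL_restrict[OF s W'] s
    by (simp add: pr_def sec_restrict_sum sec_restrict_part
        End_sec_restrict[OF e W OL_part[OF s] W', symmetric])
qed

lemma pr_End_deg:
  assumes \<phi>: "\<phi> \<in> F V"
  shows "P q \<phi> \<in> End_deg E (2 * q) V"
proof -
  have "P q \<phi> W s \<in> OL_degs E {j + 2 * q} W"
    if W: "open W" "W \<subseteq> V" and s: "s \<in> OL_degs E {j} W" for W j s
    unfolding pr_homogeneous[OF End_filt_subset[OF \<phi>] s]
    by (rule OL_degs_part[OF End_OL[OF End_filt_subset[OF \<phi>] W OL_degs_subset[OF s]]])
  then show ?thesis
    unfolding End_deg_def using End_filt_subset[OF End_filt_pr[OF \<phi>]] by simp
qed

lemma End_deg_degs:
  "\<phi> \<in> End_deg E m V \<Longrightarrow> open W \<Longrightarrow> W \<subseteq> V \<Longrightarrow> s \<in> OL_degs E {j} W \<Longrightarrow> \<phi> W s \<in> OL_degs E {j + m} W"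
  unfolding End_deg_def by (drule CollectD, drule conjunct2) simp

lemma End_deg_filt:
  assumes "\<phi> \<in> End_deg E (2 * q) V"
  shows "\<phi> \<in> F V"
  unfolding End_filt_def mem_Collect_eq
proof (intro conjI allI impI ballI)
  show "\<phi> \<in> End E V" using assms unfolding End_deg_def by simp
  fix W j s assume "open W \<and> W \<subseteq> V" and s: "s \<in> OL_degs E {j} W"
  then show "\<phi> W s \<in> OL_degs E (degs_from j) W"
    by (intro OL_degs_nested[OF End_deg_degs[OF assms]]) auto
qed

text \<open>A nonzero coefficient of degree \<open>j + 2 * k\<close> forces
  \<open>j + 2 * k \<le> rk E < 8\<close>, hence \<open>k \<le> 3\<close>.\<close>

lemma sum_parts_filtered:
  assumes t: "t \<in> OL_degs E (degs_from j) W"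
  shows "(\<Sum>q\<le>3. sec_part (j + 2 * q) t) = t"
proof (intro ext)
  fix x \<tau> I
  have "(\<Sum>q\<le>3. sec_part (j + 2 * q) t) x \<tau> I = (\<Sum>q\<le>3. if card I = j + 2 * q then t x \<tau> I else 0)"
    unfolding sum_fun_apply sec_part_def ..
  also have "\<dots> = t x \<tau> I"
  proof (cases "t x \<tau> I = 0")
    case False
    obtain k where k: "card I = j + 2 * k" using OL_degsD[OF t False] by blast
    moreover have "card I \<le> rk E" using OL_card[OF OL_degs_subset[OF t] False] .
    ultimately have "k \<le> 3" using rk_less by linarith
    have "(\<Sum>q\<le>3. if card I = j + 2 * q then t x \<tau> I else 0) = (\<Sum>q\<le>3. if q = k then t x \<tau> I else 0)"
      using k by (intro sum.cong) auto
    then show ?thesis using \<open>k \<le> 3\<close> by (simp add: sum.delta)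
  qed (simp cong: if_cong)
  finally show "(\<Sum>q\<le>3. sec_part (j + 2 * q) t) x \<tau> I = t x \<tau> I" .
qed

lemma sum_pr_apply:
  assumes \<phi>: "\<phi> \<in> F V" and W: "open W" "W \<subseteq> V" and s: "s \<in> OL_degs E {j} W"
  shows "\<phi> W s = (\<Sum>q\<le>3. P q \<phi> W s)"
  using sum_parts_filtered[OF End_filt_degs[OF \<phi> W s]]
  by (simp add: pr_homogeneous[OF End_filt_subset[OF \<phi>] s])

lemma sum_endo_apply: "(\<Sum>x\<in>X. f x) W s = (\<Sum>x\<in>X. f x W s)" for f :: "'x \<Rightarrow> ('b, 'c) endo"
  by (simp add: sum_fun_apply)

lemma sum_pr: "\<phi> \<in> F V \<Longrightarrow> (\<Sum>q\<le>3. P q \<phi>) = \<phi>"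
  by (rule endo_eqI[of _ E V])
    (auto simp: sum_endo_apply sum_pr_apply intro!: End_filt_subset End_filt_sum End_filt_pr)

lemma pr_pr:
  assumes \<phi>: "\<phi> \<in> F V"
  shows "P p (P q \<phi>) = (if p = q then P q \<phi> else 0)"
proof (rule endo_eqI[of _ E V])
  show "P p (P q \<phi>) \<in> End E V" by (intro End_filt_subset End_filt_pr \<phi>)
  show "(if p = q then P q \<phi> else 0) \<in> End E V" by (simp add: End_filt_subset End_filt_pr \<phi> End_filt_zero)
  fix W j s assume "open W" "W \<subseteq> V" and s: "s \<in> OL_degs E {j} W"
  show "P p (P q \<phi>) W s = (if p = q then P q \<phi> else 0) W s"
    unfolding pr_homogeneous[OF End_filt_subset[OF End_filt_pr[OF \<phi>]] s]
      pr_homogeneous[OF End_filt_subset[OF \<phi>] s] sec_part_part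
    by (simp add: pr_homogeneous[OF End_filt_subset[OF \<phi>] s])
qed

lemma pr_End_deg_self:
  assumes \<phi>: "\<phi> \<in> End_deg E (2 * q) V"
  shows "P p \<phi> = (if p = q then \<phi> else 0)"
proof (rule endo_eqI[of _ E V])
  note f = End_deg_filt[OF \<phi>]
  show "P p \<phi> \<in> End E V" by (intro End_filt_subset End_filt_pr f)
  show "(if p = q then \<phi> else 0) \<in> End E V" by (simp add: End_filt_subset f End_filt_zero)
  fix W j s assume W: "open W" "W \<subseteq> V" and s: "s \<in> OL_degs E {j} W"
  show "P p \<phi> W s = (if p = q then \<phi> else 0) W s"
    unfolding pr_homogeneous[OF End_filt_subset[OF f] s]
    by (simp add: sec_part_restrict_degs[OF End_deg_degs[OF \<phi> W s]])
qed

lemma pr_large: "\<phi> \<in> F V \<Longrightarrow> 3 < q \<Longrightarrow> P q \<phi> = 0"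
proof (rule endo_eqI[of _ E V])
  assume \<phi>: "\<phi> \<in> F V" and q: "3 < q"
  show "P q \<phi> \<in> End E V" by (intro End_filt_subset End_filt_pr \<phi>)
  show "0 \<in> End E V" by (intro End_filt_subset End_filt_zero)
  fix W j s assume W: "open W" "W \<subseteq> V" and s: "s \<in> OL_degs E {j} W"
  have "sec_part (j + 2 * q) (\<phi> W s) = 0"
    by (rule sec_part_large[OF End_OL[OF End_filt_subset[OF \<phi>] W OL_degs_subset[OF s]]]) (use q rk_less in simp)
  then show "P q \<phi> W s = 0 W s" by (simp add: pr_homogeneous[OF End_filt_subset[OF \<phi>] s])
qed

lemma filt_eqI:
  assumes "\<phi> \<in> F V" "\<psi> \<in> F V" "\<And>q. q \<le> 3 \<Longrightarrow> P q \<phi> = P q \<psi>"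
  shows "\<phi> = \<psi>"
  using sum_pr[OF assms(1)] sum_pr[OF assms(2)] assms(3) by (metis (no_types, lifting) atMost_iff sum.cong)

lemma sum_atMost_3_restrict:
  "q \<le> 3 \<Longrightarrow> (\<Sum>b\<le>3. if b \<le> q then f b else 0) = (\<Sum>b\<le>(q::nat). f b)"
  by (subst sum.inter_filter[symmetric]) (auto intro: arg_cong2[where f=sum])

text \<open>A contribution to degree 2q consists of a component of \<psi> of degree 2b followed by
  one of \<phi> of degree 2(q - b). Components of \<psi> with b > q cannot contribute, because
  \<phi> does not lower degrees.\<close>

lemma pr_comp:
  assumes \<phi>: "\<phi> \<in> F V" and \<psi>: "\<psi> \<in> F V" and q: "q \<le> 3"
  shows "P q (\<phi> \<bullet>\<bullet> \<psi>) = (\<Sum>b\<le>q. P (q - b) \<phi> \<bullet>\<bullet> P b \<psi>)"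
proof (rule endo_eqI[of _ E V])
  show "P q (\<phi> \<bullet>\<bullet> \<psi>) \<in> End E V" by (intro End_filt_subset End_filt_pr End_filt_comp \<phi> \<psi>)
  show "(\<Sum>b\<le>q. P (q - b) \<phi> \<bullet>\<bullet> P b \<psi>) \<in> End E V"
    by (intro End_filt_subset End_filt_sum End_filt_pr End_filt_comp \<phi> \<psi>)
  fix W j s assume W: "open W" "W \<subseteq> V" and s: "s \<in> OL_degs E {j} W"
  note e = End_filt_subset[OF \<phi>]
  define t where "t = (\<lambda>b. P b \<psi> W s)"
  have t: "t b \<in> OL_degs E {j + 2 * b} W" for b
    unfolding t_def by (rule End_deg_degs[OF pr_End_deg[OF \<psi>] W s])
  have part: "sec_part (j + 2 * q) (\<phi> W (t b)) = (if b \<le> q then P (q - b) \<phi> W (t b) else 0)" for b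
  proof (cases "b \<le> q")
    case True
    then have "j + 2 * q = j + 2 * b + 2 * (q - b)" by simp
    then show ?thesis using True by (simp only: pr_homogeneous[OF e t] if_True)
  next
    case False
    have d: "\<phi> W (t b) \<in> OL_degs E (degs_from (j + 2 * b)) W" by (rule End_filt_degs[OF \<phi> W t])
    have "j + 2 * q \<notin> degs_from (j + 2 * b)" using False by auto
    then show ?thesis using sec_part_degs[OF d OL_degs_subset[OF d], of "j + 2 * q"] False by simp
  qed
  have "P q (\<phi> \<bullet>\<bullet> \<psi>) W s = sec_part (j + 2 * q) (\<phi> W (\<psi> W s))"
    by (simp add: pr_homogeneous[OF End_filt_subset[OF End_filt_comp[OF \<phi> \<psi>]] s] endo_comp_apply)
  also have "\<phi> W (\<psi> W s) = (\<Sum>b\<le>3. \<phi> W (t b))"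
    unfolding sum_pr_apply[OF \<psi> W s] t_def[symmetric] by (rule End_sum[OF e W OL_degs_subset[OF t]])
  also have "sec_part (j + 2 * q) \<dots> = (\<Sum>b\<le>3. if b \<le> q then P (q - b) \<phi> W (t b) else 0)"
    by (simp only: sec_part_sum part)
  also have "\<dots> = (\<Sum>b\<le>q. P (q - b) \<phi> W (t b))" by (rule sum_atMost_3_restrict[OF q])
  also have "\<dots> = (\<Sum>b\<le>q. P (q - b) \<phi> \<bullet>\<bullet> P b \<psi>) W s"
    by (simp add: sum_endo_apply endo_comp_apply t_def)
  finally show "P q (\<phi> \<bullet>\<bullet> \<psi>) W s = (\<Sum>b\<le>q. P (q - b) \<phi> \<bullet>\<bullet> P b \<psi>) W s" .
qed

lemma pr_id: "P q (endo_id E V) = (if q = 0 then endo_id E V else 0)"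
proof -
  have "endo_id E V \<in> End_deg E (2 * 0) V"
    unfolding End_deg_def using End_filt_subset[OF End_filt_id] by (auto simp: endo_id_def OL_degs_subset)
  then show ?thesis using pr_End_deg_self by metis
qed

end

section \<open>Derivations, automorphisms and the exponential map\<close>

context low_rank_bundle
begin

section \<open>Derivations of a fixed degree and of positive degree\<close>

lemma End_deg_iff: "\<phi> \<in> End_deg E (2 * q) V \<longleftrightarrow> \<phi> \<in> F V \<and> P q \<phi> = \<phi>"
  using End_deg_filt pr_End_deg_self[of \<phi> q V q] pr_End_deg[of \<phi> V q] by auto

lemma Der_deg_End_deg: "\<delta> \<in> D q V \<Longrightarrow> \<delta> \<in> End_deg E (2 * q) V"
  by (simp add: Der_deg_def)

lemma Der_deg_filt: "\<delta> \<in> D q V \<Longrightarrow> \<delta> \<in> F V"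
  by (rule End_deg_filt[OF Der_deg_End_deg])

lemma pr_Der_deg: "\<delta> \<in> D q V \<Longrightarrow> P p \<delta> = (if p = q then \<delta> else 0)"
  by (rule pr_End_deg_self[OF Der_deg_End_deg])

lemma Der_leibniz:
  assumes "\<delta> \<in> Der E V" and W: "open W" "W \<subseteq> V" and s: "s \<in> OL E W" and t: "t \<in> OL E W"
  shows "\<delta> W (sec_wedge s t) = sec_wedge (\<delta> W s) t + sec_wedge s (\<delta> W t)"
  using assms(1)[unfolded Der_def mem_Collect_eq, THEN conjunct2, THEN spec[of _ W], THEN mp, OF conjI[OF W],
      THEN bspec, OF s, THEN bspec, OF t] .

lemma Der_degI:
  assumes \<delta>: "\<delta> \<in> End_deg E (2 * q) V"
    and L: "\<And>W s t. open W \<Longrightarrow> W \<subseteq> V \<Longrightarrow> s \<in> OL E W \<Longrightarrow> t \<in> OL E W \<Longrightarrow>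
      \<delta> W (sec_wedge s t) = sec_wedge (\<delta> W s) t + sec_wedge s (\<delta> W t)"
  shows "\<delta> \<in> D q V"
proof -
  have "\<delta> \<in> Der E V"
    unfolding Der_def mem_Collect_eq
  proof (intro conjI allI impI ballI)
    show "\<delta> \<in> End E V" using End_filt_subset[OF End_deg_filt[OF \<delta>]] .
  qed (elim conjE, rule L)
  then show ?thesis using \<delta> by (simp add: Der_deg_def)
qed

lemma Der_deg_leibniz:
  "\<delta> \<in> D q V \<Longrightarrow> open W \<Longrightarrow> W \<subseteq> V \<Longrightarrow> s \<in> OL E W \<Longrightarrow> t \<in> OL E W \<Longrightarrow>
    \<delta> W (sec_wedge s t) = sec_wedge (\<delta> W s) t + sec_wedge s (\<delta> W t)"
  by (rule Der_leibniz) (auto simp: Der_deg_def)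

lemma Der_deg_zero: "0 \<in> D q V"
proof (rule Der_degI)
  show "0 \<in> End_deg E (2 * q) V" by (simp add: End_deg_iff End_filt_zero)
qed simp

lemma Der_deg_add:
  assumes a: "\<delta> \<in> D q V" and b: "\<epsilon> \<in> D q V"
  shows "\<delta> + \<epsilon> \<in> D q V"
proof (rule Der_degI)
  show "\<delta> + \<epsilon> \<in> End_deg E (2 * q) V"
    using Der_deg_End_deg[OF a] Der_deg_End_deg[OF b] by (simp add: End_deg_iff End_filt_add pr_add)
  fix W s t
  assume h: "open W" "W \<subseteq> V" "s \<in> OL E W" "t \<in> OL E W"
  have "(\<delta> + \<epsilon>) W r = \<delta> W r + \<epsilon> W r" for r by simp
  then show "(\<delta> + \<epsilon>) W (sec_wedge s t) = sec_wedge ((\<delta> + \<epsilon>) W s) t + sec_wedge s ((\<delta> + \<epsilon>) W t)"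
    by (simp only: Der_deg_leibniz[OF a h] Der_deg_leibniz[OF b h] sec_wedge_add_left sec_wedge_add_right ac_simps)
qed

lemma Der_deg_uminus:
  assumes a: "\<delta> \<in> D q V"
  shows "- \<delta> \<in> D q V"
proof (rule Der_degI)
  show "- \<delta> \<in> End_deg E (2 * q) V"
    using Der_deg_End_deg[OF a] by (simp add: End_deg_iff End_filt_uminus pr_uminus)
  fix W s t
  assume h: "open W" "W \<subseteq> V" "s \<in> OL E W" "t \<in> OL E W"
  have "(- \<delta>) W r = sec_scale (-1) (\<delta> W r)" for r by (simp add: sec_scale_uminus_one)
  then show "(- \<delta>) W (sec_wedge s t) = sec_wedge ((- \<delta>) W s) t + sec_wedge s ((- \<delta>) W t)"
    by (simp only: Der_deg_leibniz[OF a h] sec_wedge_scale_left sec_wedge_scale_right sec_scale_add)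
qed

lemma Der_deg_diff: "\<delta> \<in> D q V \<Longrightarrow> \<epsilon> \<in> D q V \<Longrightarrow> \<delta> - \<epsilon> \<in> D q V"
  using Der_deg_add[OF _ Der_deg_uminus, of \<delta> q V \<epsilon>] by simp

lemma Der_deg_restrict:
  assumes a: "\<delta> \<in> D q V" and V': "V' \<subseteq> V"
  shows "endo_restrict V' \<delta> \<in> D q V'"
proof (rule Der_degI)
  show "endo_restrict V' \<delta> \<in> End_deg E (2 * q) V'"
    using Der_deg_End_deg[OF a] V' by (auto simp: End_deg_iff pr_restrict intro: End_filt_restrict)
  fix W s t
  assume h: "open W" "W \<subseteq> V'" "s \<in> OL E W" "t \<in> OL E W"
  have "W \<subseteq> V" using h V' by blast
  then show "endo_restrict V' \<delta> W (sec_wedge s t) =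
      sec_wedge (endo_restrict V' \<delta> W s) t + sec_wedge s (endo_restrict V' \<delta> W t)"
    unfolding endo_restrict_apply[OF h(2)] by (rule Der_deg_leibniz[OF a h(1) _ h(3,4)])
qed

text \<open>The summands in \<open>Der_pos\<close> have pairwise distinct degrees, so
  \<open>P q\<close> recovers the one of degree 2q. Conversely an element is the sum of its
  components, and three positive degrees suffice.\<close>

lemma Der_pos_iff:
  "u \<in> Der_pos E V \<longleftrightarrow> u \<in> F V \<and> P 0 u = 0 \<and> (\<forall>q\<ge>1. P q u \<in> D q V)"
proof
  assume "u \<in> Der_pos E V"
  then obtain K \<delta> where u: "u = (\<Sum>k=1..K. \<delta> k)" and \<delta>: "\<And>k. k \<in> {1..K} \<Longrightarrow> \<delta> k \<in> D k V"
    unfolding Der_pos_def by blast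
  have "P q u = (\<Sum>k=1..K. if q = k then \<delta> k else 0)" for q
    unfolding u pr_sum using \<delta> pr_Der_deg by (intro sum.cong refl) blast
  then have "P q u = (if q \<in> {1..K} then \<delta> q else 0)" for q
    by (simp add: sum.delta')
  then have "P 0 u = (if 0 \<in> {1..K} then \<delta> 0 else 0)" and "\<And>q. P q u \<in> D q V"
    using \<delta> Der_deg_zero by (blast, auto)
  then have "P 0 u = 0" "\<And>q. P q u \<in> D q V" by auto
  moreover have "u \<in> F V" unfolding u by (rule End_filt_sum, rule Der_deg_filt[OF \<delta>])
  ultimately show "u \<in> F V \<and> P 0 u = 0 \<and> (\<forall>q\<ge>1. P q u \<in> D q V)" by blast
next
  assume u: "u \<in> F V \<and> P 0 u = 0 \<and> (\<forall>q\<ge>1. P q u \<in> D q V)"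
  have "u = (\<Sum>q\<le>3. P q u)" using sum_pr u by metis
  also have "\<dots> = (\<Sum>q=1..3. P q u)"
    using u by (intro sum.mono_neutral_right) (auto simp: not_le)
  finally have "u = (\<Sum>q=1..3. P q u)" .
  moreover have "\<forall>q\<in>{1..3}. P q u \<in> D q V" using u by simp
  ultimately show "u \<in> Der_pos E V"
    unfolding Der_pos_def mem_Collect_eq by (intro exI[of _ 3] exI[of _ "\<lambda>q. P q u"] conjI)
qed

lemma Der_pos_filt: "u \<in> Der_pos E V \<Longrightarrow> u \<in> F V"
  by (simp add: Der_pos_iff)

lemma pr_Der_pos: "u \<in> Der_pos E V \<Longrightarrow> q \<ge> 1 \<Longrightarrow> P q u \<in> D q V"
  by (simp add: Der_pos_iff)

lemma pr_0_Der_pos: "u \<in> Der_pos E V \<Longrightarrow> pr E 0 u = 0"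
  using Der_pos_iff[of u V] by simp

lemma Der_pos_Der_deg: "\<delta> \<in> D q V \<Longrightarrow> q \<ge> 1 \<Longrightarrow> \<delta> \<in> Der_pos E V"
proof -
  assume \<delta>: "\<delta> \<in> D q V" and q: "q \<ge> 1"
  have "P p \<delta> \<in> D p V" for p unfolding pr_Der_deg[OF \<delta>] using \<delta> Der_deg_zero by auto
  moreover have "P 0 \<delta> = 0" unfolding pr_Der_deg[OF \<delta>] using q by auto
  ultimately show ?thesis unfolding Der_pos_iff using Der_deg_filt[OF \<delta>] by blast
qed

lemma Der_pos_add: "u \<in> Der_pos E V \<Longrightarrow> v \<in> Der_pos E V \<Longrightarrow> u + v \<in> Der_pos E V"
  by (simp add: Der_pos_iff End_filt_add pr_add Der_deg_add)

lemma Der_pos_uminus: "u \<in> Der_pos E V \<Longrightarrow> - u \<in> Der_pos E V"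
  by (simp add: Der_pos_iff End_filt_uminus pr_uminus Der_deg_uminus)

lemma Der_pos_zero: "0 \<in> Der_pos E V"
  by (simp add: Der_pos_iff End_filt_zero Der_deg_zero)

lemma Der_pos_sum: "u \<in> Der_pos E V \<Longrightarrow> u = (\<Sum>q=1..3. P q u)"
proof -
  assume u: "u \<in> Der_pos E V"
  have "u = (\<Sum>q\<le>3. P q u)" using sum_pr[OF Der_pos_filt[OF u]] by simp
  also have "\<dots> = (\<Sum>q=1..3. P q u)"
    using pr_0_Der_pos[OF u] by (intro sum.mono_neutral_right) (auto simp: not_le)
  finally show ?thesis .
qed

lemma Der_pos_leibniz:
  assumes u: "u \<in> Der_pos E V" and h: "open W" "W \<subseteq> V" "s \<in> OL E W" "t \<in> OL E W"
  shows "u W (sec_wedge s t) = sec_wedge (u W s) t + sec_wedge s (u W t)"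
proof -
  have a: "u W r = (\<Sum>q=1..3. P q u W r)" for r
    using Der_pos_sum[OF u] by (metis (no_types, lifting) sum.cong sum_endo_apply)
  have "P q u W (sec_wedge s t) = sec_wedge (P q u W s) t + sec_wedge s (P q u W t)" if "q \<in> {1..3}" for q
    by (rule Der_deg_leibniz[OF pr_Der_pos[OF u] h]) (use that in simp)
  then show ?thesis
    unfolding a by (simp add: sum.distrib sec_wedge_sum_left sec_wedge_sum_right)
qed

subsection \<open>Automorphisms\<close>

lemma G_D:
  assumes "g \<in> G E V"
  shows G_End: "g \<in> End E V"
    and G_bij: "open W \<Longrightarrow> W \<subseteq> V \<Longrightarrow> bij_betw (g W) (OL E W) (OL E W)"
    and G_one: "open W \<Longrightarrow> W \<subseteq> V \<Longrightarrow> g W (sec_one E W) = sec_one E W"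
    and G_wedge: "open W \<Longrightarrow> W \<subseteq> V \<Longrightarrow> s \<in> OL E W \<Longrightarrow> t \<in> OL E W \<Longrightarrow>
      g W (sec_wedge s t) = sec_wedge (g W s) (g W t)"
    and G_degs: "open W \<Longrightarrow> W \<subseteq> V \<Longrightarrow> s \<in> OL_degs E {j} W \<Longrightarrow>
      g W s - s \<in> OL_degs E {j + 2 * k | k. 1 \<le> k} W"
proof -
  note e = assms[unfolded G_def mem_Collect_eq, THEN conjunct2, THEN spec[of _ W], THEN mp]
  show "g \<in> End E V" using assms by (simp add: G_def)
  show "bij_betw (g W) (OL E W) (OL E W)" if "open W" "W \<subseteq> V"
    using e[OF conjI[OF that], THEN conjunct1] .
  show "g W (sec_one E W) = sec_one E W" if "open W" "W \<subseteq> V"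
    using e[OF conjI[OF that], THEN conjunct2, THEN conjunct1] .
  show "g W (sec_wedge s t) = sec_wedge (g W s) (g W t)"
    if "open W" "W \<subseteq> V" "s \<in> OL E W" "t \<in> OL E W"
    using e[OF conjI[OF that(1,2)], THEN conjunct2, THEN conjunct2, THEN conjunct1, THEN bspec, OF that(3), THEN bspec, OF that(4)] .
  show "g W s - s \<in> OL_degs E {j + 2 * k | k. 1 \<le> k} W" if "open W" "W \<subseteq> V" "s \<in> OL_degs E {j} W"
    using e[OF conjI[OF that(1,2)], THEN conjunct2, THEN conjunct2, THEN conjunct2, THEN spec[of _ j], THEN bspec, OF that(3)] .
qed

lemma G_filt:
  assumes g: "g \<in> G E V"
  shows "g \<in> F V"
  unfolding End_filt_def mem_Collect_eq
proof (intro conjI allI impI ballI)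
  show "g \<in> End E V" by (rule G_End[OF g])
  fix W j s assume W: "open W \<and> W \<subseteq> V" and s: "s \<in> OL_degs E {j} W"
  have "g W s - s \<in> OL_degs E (degs_from j) W"
    by (rule OL_degs_mono[OF G_degs[OF g _ _ s]]) (use W in auto)
  moreover have "s \<in> OL_degs E (degs_from j) W" using s by (rule OL_degs_mono) auto
  ultimately have "(g W s - s) + s \<in> OL_degs E (degs_from j) W" by (rule OL_degs_add)
  then show "g W s \<in> OL_degs E (degs_from j) W" by simp
qed

lemma pr_0_G:
  assumes g: "g \<in> G E V"
  shows "P 0 g = endo_id E V"
proof (rule endo_eqI[of _ E V])
  show "P 0 g \<in> End E V" "endo_id E V \<in> End E V"
    by (intro End_filt_subset End_filt_pr End_filt_id G_filt[OF g])+
  fix W j s assume W: "open W" "W \<subseteq> V" and s: "s \<in> OL_degs E {j} W"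
  note d = G_degs[OF g W s]
  have "j \<notin> {j + 2 * k | k. 1 \<le> k}" by auto
  then have "sec_part j (g W s - s) = 0" using sec_part_degs[OF d OL_degs_subset[OF d], of j] by simp
  moreover have "g W s = (g W s - s) + s" by simp
  ultimately have "sec_part j (g W s) = sec_part j s" by (metis sec_part_add add_0)
  then show "P 0 g W s = endo_id E V W s"
    using pr_homogeneous[OF G_End[OF g] s, of "2 * 0"] W OL_degs_subset[OF s] s
    by (simp add: sec_part_restrict_degs[OF s] endo_id_def)
qed

text \<open>For a filtered endomorphism, the degree condition in \<open>G\<close> amounts to having
  the identity as component of degree 0.\<close>

lemma G_I:
  assumes g: "g \<in> F V" and g0: "P 0 g = endo_id E V"
    and bij: "\<And>W. open W \<Longrightarrow> W \<subseteq> V \<Longrightarrow> bij_betw (g W) (OL E W) (OL E W)"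
    and one: "\<And>W. open W \<Longrightarrow> W \<subseteq> V \<Longrightarrow> g W (sec_one E W) = sec_one E W"
    and wedge: "\<And>W s t. open W \<Longrightarrow> W \<subseteq> V \<Longrightarrow> s \<in> OL E W \<Longrightarrow> t \<in> OL E W \<Longrightarrow>
      g W (sec_wedge s t) = sec_wedge (g W s) (g W t)"
  shows "g \<in> G E V"
proof -
  have degs: "g W s - s \<in> OL_degs E {j + 2 * k | k. 1 \<le> k} W"
    if W: "open W" "W \<subseteq> V" and s: "s \<in> OL_degs E {j} W" for W j s
  proof -
    have "g W s = (\<Sum>q\<le>3. P q g W s)" by (rule sum_pr_apply[OF g W s])
    also have "\<dots> = P 0 g W s + (\<Sum>q=1..3. P q g W s)"
    proof -
      have "{..3::nat} = insert 0 {1..3}" by auto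
      then show ?thesis by (simp only: sum.insert finite_atLeastAtMost atLeastAtMost_iff) auto
    qed
    also have "P 0 g W s = s" unfolding g0 using W OL_degs_subset[OF s] by (simp add: endo_id_def)
    finally have "g W s - s = (\<Sum>q=1..3. P q g W s)" by (metis add_diff_cancel_left')
    moreover have "P q g W s \<in> OL_degs E {j + 2 * k | k. 1 \<le> k} W" if "q \<in> {1..3}" for q
      by (rule OL_degs_mono[OF End_deg_degs[OF pr_End_deg[OF g] W s]]) (use that in auto)
    ultimately show ?thesis by (metis (no_types, lifting) OL_degs_sum)
  qed
  show ?thesis
    unfolding G_def mem_Collect_eq
    by (intro conjI allI impI ballI End_filt_subset[OF g]; (elim conjE)?; (rule bij one wedge degs; assumption))
qed

lemma G_comp:
  assumes g: "g \<in> G E V" and h: "h \<in> G E V"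
  shows "g \<bullet>\<bullet> h \<in> G E V"
proof (rule G_I)
  show "g \<bullet>\<bullet> h \<in> F V" by (intro End_filt_comp G_filt g h)
  have "P 0 (g \<bullet>\<bullet> h) = P 0 g \<bullet>\<bullet> P 0 h"
    using pr_comp[OF G_filt[OF g] G_filt[OF h], of 0] by simp
  then show "P 0 (g \<bullet>\<bullet> h) = endo_id E V"
    unfolding pr_0_G[OF g] pr_0_G[OF h] by (simp only: endo_id_left[OF End_filt_subset[OF End_filt_id]])
  fix W assume W: "open W" "W \<subseteq> V"
  show "bij_betw ((g \<bullet>\<bullet> h) W) (OL E W) (OL E W)"
    using bij_betw_trans[OF G_bij[OF h W] G_bij[OF g W]] by (simp add: endo_comp_def o_def)
  show "(g \<bullet>\<bullet> h) W (sec_one E W) = sec_one E W"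
    by (simp add: endo_comp_apply G_one[OF h W] G_one[OF g W])
  show "(g \<bullet>\<bullet> h) W (sec_wedge s t) = sec_wedge ((g \<bullet>\<bullet> h) W s) ((g \<bullet>\<bullet> h) W t)"
    if "s \<in> OL E W" "t \<in> OL E W" for s t
    using G_wedge[OF g W End_OL[OF G_End[OF h] W that(1)] End_OL[OF G_End[OF h] W that(2)]]
    by (simp add: endo_comp_apply G_wedge[OF h W that])
qed

lemma G_id: "endo_id E V \<in> G E V"
proof (rule G_I)
  show "P 0 (endo_id E V) = endo_id E V" by (rule trans[OF pr_id if_P[OF refl]])
  fix W assume W: "open W" "W \<subseteq> V"
  have "bij_betw id (OL E W) (OL E W)" by simp
  then show "bij_betw (endo_id E V W) (OL E W) (OL E W)"
    by (rule bij_betw_cong[THEN iffD1, rotated]) (use W in \<open>simp add: endo_id_def\<close>)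
  show "endo_id E V W (sec_one E W) = sec_one E W" using W by (simp add: endo_id_def OL_one)
  show "endo_id E V W (sec_wedge s t) = sec_wedge (endo_id E V W s) (endo_id E V W t)"
    if "s \<in> OL E W" "t \<in> OL E W" for s t
    using W that by (simp add: endo_id_def OL_wedge)
qed (rule End_filt_id)

lemma G_restrict:
  assumes g: "g \<in> G E V" and V': "V' \<subseteq> V"
  shows "endo_restrict V' g \<in> G E V'"
proof (rule G_I)
  show "endo_restrict V' g \<in> F V'" by (rule End_filt_restrict[OF G_filt[OF g] V'])
  show "P 0 (endo_restrict V' g) = endo_id E V'"
    unfolding pr_restrict pr_0_G[OF g] by (rule endo_restrict_id[OF V'])
  fix W assume W: "open W" "W \<subseteq> V'"
  then have "W \<subseteq> V" using V' by blast
  then show "bij_betw (endo_restrict V' g W) (OL E W) (OL E W)"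
    "endo_restrict V' g W (sec_one E W) = sec_one E W"
    "\<And>s t. s \<in> OL E W \<Longrightarrow> t \<in> OL E W \<Longrightarrow>
      endo_restrict V' g W (sec_wedge s t) = sec_wedge (endo_restrict V' g W s) (endo_restrict V' g W t)"
    unfolding endo_restrict_apply[OF W(2)] using G_bij[OF g W(1)] G_one[OF g W(1)] G_wedge[OF g W(1)] by auto
qed

text \<open>For homogeneous sections this compares the parts of degree 2q above the lowest on both
  sides of g(s t) = g(s) g(t). Bilinearity extends it to arbitrary sections.\<close>

lemma pr_G_wedge:
  assumes g: "g \<in> G E V" and q: "q \<le> 3" and W: "open W" "W \<subseteq> V" and s: "s \<in> OL E W" and t: "t \<in> OL E W"
  shows "P q g W (sec_wedge s t) = (\<Sum>a\<le>q. sec_wedge (P a g W s) (P (q - a) g W t))"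
proof -
  note gF = G_filt[OF g]
  have hom: "P q g W (sec_wedge s t) = (\<Sum>a\<le>q. sec_wedge (P a g W s) (P (q - a) g W t))"
    if s: "s \<in> OL_degs E {i} W" and t: "t \<in> OL_degs E {j} W" for s t i j
  proof -
    define S where "S = (\<lambda>a. P a g W s)"
    define T where "T = (\<lambda>a. P a g W t)"
    have ST: "sec_wedge (S a) (T b) \<in> OL_degs E {(i + 2 * a) + (j + 2 * b)} W" for a b
      unfolding S_def T_def
      by (intro OL_degs_wedge End_deg_degs[OF pr_End_deg[OF gF] W] s t)
    have gs: "g W s = (\<Sum>a\<le>3. S a)" "g W t = (\<Sum>b\<le>3. T b)"
      unfolding S_def T_def by (rule sum_pr_apply[OF gF W s], rule sum_pr_apply[OF gF W t])
    have "P q g W (sec_wedge s t) = sec_part (i + j + 2 * q) (sec_wedge (g W s) (g W t))"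
      unfolding pr_homogeneous[OF G_End[OF g] OL_degs_wedge[OF s t]]
        G_wedge[OF g W OL_degs_subset[OF s] OL_degs_subset[OF t]] ..
    also have "\<dots> = (\<Sum>a\<le>3. \<Sum>b\<le>3. sec_part (i + j + 2 * q) (sec_wedge (S a) (T b)))"
      unfolding gs by (simp only: sec_wedge_sum_left sec_wedge_sum_right sec_part_sum) (rule sum.swap)
    also have "\<dots> = (\<Sum>a\<le>3. \<Sum>b\<le>3. if a + b = q then sec_wedge (S a) (T b) else 0)"
      by (intro sum.cong refl) (auto simp: sec_part_restrict_degs[OF ST])
    also have "\<dots> = (\<Sum>a\<le>3. if a \<le> q then sec_wedge (S a) (T (q - a)) else 0)"
    proof (intro sum.cong refl)
      fix a :: nat
      have "(\<Sum>b\<le>3. if a + b = q then sec_wedge (S a) (T b) else 0) =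
          (\<Sum>b\<le>3. if b = q - a then (if a \<le> q then sec_wedge (S a) (T b) else 0) else 0)"
        by (intro sum.cong refl) auto
      also have "\<dots> = (if a \<le> q then sec_wedge (S a) (T (q - a)) else 0)"
        using q by (auto simp: sum.delta)
      finally show "(\<Sum>b\<le>3. if a + b = q then sec_wedge (S a) (T b) else 0) =
          (if a \<le> q then sec_wedge (S a) (T (q - a)) else 0)" .
    qed
    also have "\<dots> = (\<Sum>a\<le>q. sec_wedge (S a) (T (q - a)))" by (rule sum_atMost_3_restrict[OF q])
    finally show ?thesis unfolding S_def T_def .
  qed
  have eP: "P a g \<in> End E V" for a by (rule End_filt_subset[OF End_filt_pr[OF gF]])
  have "P q g W (sec_wedge s t) = P q g W (\<Sum>i\<le>rk E. \<Sum>j\<le>rk E. sec_wedge (sec_part i s) (sec_part j t))"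
    unfolding sec_wedge_sum_left[symmetric] sec_wedge_sum_right[symmetric] sum_sec_part[OF s] sum_sec_part[OF t] ..
  also have "\<dots> = (\<Sum>i\<le>rk E. \<Sum>j\<le>rk E. P q g W (sec_wedge (sec_part i s) (sec_part j t)))"
    by (subst End_sum[OF eP W], intro OL_sum OL_wedge OL_part s t, intro sum.cong refl, subst End_sum[OF eP W])
      (intro OL_wedge OL_part s t, rule refl)
  also have "\<dots> = (\<Sum>i\<le>rk E. \<Sum>j\<le>rk E. \<Sum>a\<le>q. sec_wedge (P a g W (sec_part i s)) (P (q - a) g W (sec_part j t)))"
    by (simp only: hom[OF OL_degs_part[OF s] OL_degs_part[OF t]])
  also have "\<dots> = (\<Sum>a\<le>q. \<Sum>i\<le>rk E. \<Sum>j\<le>rk E. sec_wedge (P a g W (sec_part i s)) (P (q - a) g W (sec_part j t)))"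
    by (subst sum.swap, subst (2) sum.swap) (intro sum.cong refl sum.swap)
  also have "\<dots> = (\<Sum>a\<le>q. sec_wedge (P a g W s) (P (q - a) g W t))"
  proof (intro sum.cong refl)
    fix a
    have e: "P b g W r = (\<Sum>i\<le>rk E. P b g W (sec_part i r))" if "r \<in> OL E W" for b r
      using End_sum[OF eP W, where X="{..rk E}" and f="\<lambda>i. sec_part i r", OF OL_part[OF that]]
      by (simp add: sum_sec_part[OF that])
    show "(\<Sum>i\<le>rk E. \<Sum>j\<le>rk E. sec_wedge (P a g W (sec_part i s)) (P (q - a) g W (sec_part j t))) =
        sec_wedge (P a g W s) (P (q - a) g W t)"
      by (simp only: e[OF s, of a] e[OF t, of "q - a"] sec_wedge_sum_left sec_wedge_sum_right) (rule sum.swap)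
  qed
  finally show ?thesis .
qed

text \<open>The cross terms are those of the degree \<open>2q\<close> part of \<open>g (s \<and> t) = g s \<and> g t\<close>.\<close>

lemma pr_diff_derivation:
  assumes g: "g \<in> G E V" and g': "g' \<in> G E V" and q: "1 \<le> q" "q \<le> 3"
    and cross: "\<And>p W s t. 0 < p \<Longrightarrow> p < q \<Longrightarrow> open W \<Longrightarrow> W \<subseteq> V \<Longrightarrow> s \<in> OL E W \<Longrightarrow> t \<in> OL E W \<Longrightarrow>
      sec_wedge (P p g W s) (P (q - p) g W t) = sec_wedge (P p g' W s) (P (q - p) g' W t)"
  shows "P q g - P q g' \<in> D q V"
proof (rule Der_degI)
  show "P q g - P q g' \<in> End_deg E (2 * q) V"
    using pr_End_deg[OF G_filt[OF g], of q] pr_End_deg[OF G_filt[OF g'], of q]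
    by (simp add: End_deg_iff End_filt_diff pr_diff)
  fix W s t
  assume h: "open W" "W \<subseteq> V" "s \<in> OL E W" "t \<in> OL E W"
  have id: "P 0 g W r = r" "P 0 g' W r = r" if "r \<in> OL E W" for r
    unfolding pr_0_G[OF g] pr_0_G[OF g'] using h that by (simp_all add: endo_id_def)
  note split = sum_atMost_ends[OF q(1)]
  have "(\<Sum>a\<in>{0<..<q}. sec_wedge (P a g W s) (P (q - a) g W t)) =
      (\<Sum>a\<in>{0<..<q}. sec_wedge (P a g' W s) (P (q - a) g' W t))"
    by (rule sum.cong) (use cross h in auto)
  then have "P q g W (sec_wedge s t) - P q g' W (sec_wedge s t) =
      (sec_wedge s (P q g W t) + sec_wedge (P q g W s) t) - (sec_wedge s (P q g' W t) + sec_wedge (P q g' W s) t)"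
    unfolding pr_G_wedge[OF g q(2) h] pr_G_wedge[OF g' q(2) h] split diff_zero diff_self_eq_0 id[OF h(3)] id[OF h(4)]
    by simp
  moreover have "(P q g - P q g') W r = P q g W r + sec_scale (-1) (P q g' W r)" for r
    by (simp add: sec_scale_uminus_one)
  ultimately show "(P q g - P q g') W (sec_wedge s t) =
      sec_wedge ((P q g - P q g') W s) t + sec_wedge s ((P q g - P q g') W t)"
    by (simp only: sec_wedge_add_left sec_wedge_add_right sec_wedge_scale_left sec_wedge_scale_right)
      (simp add: sec_scale_uminus_one)
qed

end

subsection \<open>The exponential map\<close>

lemma sec_scale_apply: "sec_scale c s x t I = c * s x t I"
  by (simp add: sec_scale_def)

lemma OL_degs_wedge_ge:
  assumes s: "s \<in> OL_degs E {a..} W" and t: "t \<in> OL_degs E {b..} W"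
  shows "sec_wedge s t \<in> OL_degs E {a + b..} W"
proof -
  note sO = OL_degs_subset[OF s] and tO = OL_degs_subset[OF t]
  have "sec_wedge (sec_part i s) (sec_part j t) \<in> OL_degs E {a + b..} W" for i j
  proof (cases "a \<le> i \<and> b \<le> j")
    case True
    show ?thesis
      by (rule OL_degs_mono[OF OL_degs_wedge[OF OL_degs_part[OF sO] OL_degs_part[OF tO]]]) (use True in auto)
  next
    case False
    then have "sec_part i s = 0 \<or> sec_part j t = 0"
      using sec_part_degs[OF s sO, of i] sec_part_degs[OF t tO, of j] by auto
    then show ?thesis using OL_degs_zero by auto
  qed
  then have "(\<Sum>i\<le>rk E. \<Sum>j\<le>rk E. sec_wedge (sec_part i s) (sec_part j t)) \<in> OL_degs E {a + b..} W"
    by (intro OL_degs_sum)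
  then show ?thesis
    unfolding sec_wedge_sum_left[symmetric] sec_wedge_sum_right[symmetric] sum_sec_part[OF sO] sum_sec_part[OF tO] .
qed

context low_rank_bundle
begin

lemma OL_degs_ge_large: "s \<in> OL_degs E {m..} W \<Longrightarrow> rk E < m \<Longrightarrow> s = 0"
proof (intro ext, rule ccontr)
  fix x t I
  assume s: "s \<in> OL_degs E {m..} W" and m: "rk E < m" and nz: "s x t I \<noteq> 0 x t I"
  then have "m \<le> card I" using OL_degsD[OF s, of x t I] by simp
  moreover have "card I \<le> rk E" using OL_card[OF OL_degs_subset[OF s], of x t I] nz by simp
  ultimately show False using m by simp
qed

lemma OL_degs_ge_8: "s \<in> OL_degs E {8..} W \<Longrightarrow> s = 0"
  by (rule OL_degs_ge_large) (use rk_less in simp_all)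

lemma Der_pos_End: "u \<in> Der_pos E V \<Longrightarrow> u \<in> End E V"
  by (rule End_filt_subset[OF Der_pos_filt])

lemma Der_pos_raises:
  assumes u: "u \<in> Der_pos E V" and W: "open W" "W \<subseteq> V" and s: "s \<in> OL_degs E {m..} W"
  shows "u W s \<in> OL_degs E {m + 2..} W"
proof -
  note sO = OL_degs_subset[OF s]
  have "u W (sec_part i s) \<in> OL_degs E {m + 2..} W" for i
  proof (cases "m \<le> i")
    case True
    have "u W (sec_part i s) = (\<Sum>q=1..3. P q u W (sec_part i s))"
      using Der_pos_sum[OF u] sum_endo_apply[of "\<lambda>q. P q u" "{1..3}" W] by metis
    moreover have "P q u W (sec_part i s) \<in> OL_degs E {m + 2..} W" if "q \<in> {1..3}" for q
      by (rule OL_degs_mono[OF End_deg_degs[OF pr_End_deg[OF Der_pos_filt[OF u]] W OL_degs_part[OF sO]]])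
        (use that True in auto)
    ultimately show ?thesis by (metis (no_types, lifting) OL_degs_sum)
  next
    case False
    then have "sec_part i s = 0" using sec_part_degs[OF s sO, of i] by simp
    then show ?thesis using End_zero[OF Der_pos_End[OF u]] OL_degs_zero by simp
  qed
  then have "(\<Sum>i\<le>rk E. u W (sec_part i s)) \<in> OL_degs E {m + 2..} W" by (rule OL_degs_sum)
  also have "(\<Sum>i\<le>rk E. u W (sec_part i s)) = u W s"
    using End_sum[OF Der_pos_End[OF u] W, where X="{..rk E}" and f="\<lambda>i. sec_part i s", OF OL_part[OF sO]]
    by (simp add: sum_sec_part[OF sO])
  finally show ?thesis .
qed

lemma Der_pos_funpow:
  assumes u: "u \<in> Der_pos E V" and W: "open W" "W \<subseteq> V" and s: "s \<in> OL E W"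
  shows "(u W ^^ n) s \<in> OL_degs E {2 * n..} W"
proof (induction n)
  case 0
  then show ?case using s by (simp add: OL_degs_def)
next
  case (Suc n)
  have "2 * n + 2 = 2 * Suc n" by simp
  then show ?case using Der_pos_raises[OF u W Suc] by (simp only: funpow.simps o_apply)
qed

text \<open>The n-th power of \<open>u\<close> raises degrees by at least 2n, so with rank below 8
  only the powers up to the third are left.\<close>

lemma endo_exp_apply:
  assumes u: "u \<in> Der_pos E V" and W: "open W" "W \<subseteq> V" and s: "s \<in> OL E W"
  shows "endo_exp E V u W s =
    s + u W s + sec_scale (1/2) (u W (u W s)) + sec_scale (1/6) (u W (u W (u W s)))"
proof -
  define f where "f = (\<lambda>n. sec_scale (1 / fact n) ((u W ^^ n) s))"
  have big: "f n = 0" if "rk E < 2 * n" for n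
  proof -
    have "(u W ^^ n) s = 0"
      by (rule OL_degs_ge_large[OF Der_pos_funpow[OF u W s] that])
    then show ?thesis by (simp add: f_def)
  qed
  have "endo_exp E V u W s = (\<Sum>n\<le>rk E. f n)"
    using W s by (simp add: endo_exp_def f_def)
  \<comment> \<open>The rank may lie on either side of 3: the sum is extended to 7, which bounds
    every admissible rank, and cut down to 3 afterwards.\<close>
  also have "\<dots> = (\<Sum>n\<le>7. f n)"
    using big rk_less by (intro sum.mono_neutral_left) auto
  also have "\<dots> = (\<Sum>n\<le>3. f n)"
    using big rk_less by (intro sum.mono_neutral_right) auto
  also have "\<dots> = f 0 + f 1 + f 2 + f 3"
  proof -
    have "{..3::nat} = {0, 1, 2, 3}" by auto
    then show ?thesis by (simp only:) (simp add: add.assoc)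
  qed
  also have "\<dots> = s + u W s + sec_scale (1/2) (u W (u W s)) + sec_scale (1/6) (u W (u W (u W s)))"
    by (simp only: f_def funpow.simps numeral_2_eq_2 numeral_3_eq_3 One_nat_def o_apply id_apply)
      (simp add: fact_numeral)
  finally show ?thesis .
qed

lemma endo_exp_eq:
  assumes u: "u \<in> Der_pos E V"
  shows "endo_exp E V u =
    endo_id E V + u + endo_scale (1/2) (u \<bullet>\<bullet> u) + endo_scale (1/6) (u \<bullet>\<bullet> u \<bullet>\<bullet> u)"
proof (rule endo_ext)
  fix W s
  note e = Der_pos_End[OF u]
  show "endo_exp E V u W s =
    (endo_id E V + u + endo_scale (1/2) (u \<bullet>\<bullet> u) + endo_scale (1/6) (u \<bullet>\<bullet> u \<bullet>\<bullet> u)) W s"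
  proof (cases "open W \<and> W \<subseteq> V \<and> s \<in> OL E W")
    case True
    then show ?thesis
      using endo_exp_apply[OF u, of W s]
      by (simp only: endo_add_apply endo_scale_def endo_comp_apply endo_id_def simp_thms if_True)
  next
    case False
    have "endo_exp E V u W s = 0" "endo_id E V W s = 0" "u W s = 0"
      using False End_zero_outside[OF e False] by (auto simp: endo_exp_def endo_id_def)
    then show ?thesis
      by (simp only: endo_add_apply endo_scale_def endo_comp_apply End_zero[OF e] sec_scale_zero add_0)
  qed
qed

lemma endo_exp_filt: "u \<in> Der_pos E V \<Longrightarrow> endo_exp E V u \<in> F V"
  unfolding endo_exp_eq
  by (intro End_filt_add End_filt_scale End_filt_comp End_filt_id Der_pos_filt)

text \<open>Since \<open>u\<close> has no component of degree 0, its n-th power starts in degree 2n.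
  Each line collects the products of components of the given total degree from u, u^2/2 and
  u^3/6.\<close>

lemma pr_exp:
  assumes u: "u \<in> Der_pos E V"
  shows "pr E 0 (endo_exp E V u) = endo_id E V"
    and "P 1 (endo_exp E V u) = P 1 u"
    and "P 2 (endo_exp E V u) = P 2 u + endo_scale (1/2) (P 1 u \<bullet>\<bullet> P 1 u)"
    and "P 3 (endo_exp E V u) = P 3 u + endo_scale (1/2) (P 2 u \<bullet>\<bullet> P 1 u + P 1 u \<bullet>\<bullet> P 2 u)
      + endo_scale (1/6) (P 1 u \<bullet>\<bullet> P 1 u \<bullet>\<bullet> P 1 u)"
proof -
  note f = Der_pos_filt[OF u] and u0 = pr_0_Der_pos[OF u]
  have z: "P q u \<bullet>\<bullet> 0 = 0" for q by (rule endo_comp_zero_right[OF End_filt_subset[OF End_filt_pr[OF f]]])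
  have z2: "P q (u \<bullet>\<bullet> u) \<bullet>\<bullet> 0 = 0" for q
    by (rule endo_comp_zero_right[OF End_filt_subset[OF End_filt_pr[OF End_filt_comp[OF f f]]]])
  have zs: "pr E 2 u \<bullet>\<bullet> 0 = 0" "pr E 4 u \<bullet>\<bullet> 0 = 0" "pr E 6 u \<bullet>\<bullet> 0 = 0"
    "pr E 2 (u \<bullet>\<bullet> u) \<bullet>\<bullet> 0 = 0" "pr E 4 (u \<bullet>\<bullet> u) \<bullet>\<bullet> 0 = 0" "pr E 6 (u \<bullet>\<bullet> u) \<bullet>\<bullet> 0 = 0"
    using z[of 1] z[of 2] z[of 3] z2[of 1] z2[of 2] z2[of 3] by simp_all
  have s0: "(\<Sum>b\<le>0. h b) = h 0" and s1: "(\<Sum>b\<le>1. h b) = h 0 + h 1" and s2: "(\<Sum>b\<le>2. h b) = h 0 + h 1 + h 2"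
    and s3: "(\<Sum>b\<le>3. h b) = h 0 + h 1 + h 2 + h 3" for h :: "nat \<Rightarrow> ('a, 'e) endo"
    by (simp_all add: numeral_2_eq_2 numeral_3_eq_3)
  have uu: "P 0 (u \<bullet>\<bullet> u) = 0" "P 1 (u \<bullet>\<bullet> u) = 0" "P 2 (u \<bullet>\<bullet> u) = P 1 u \<bullet>\<bullet> P 1 u"
    "P 3 (u \<bullet>\<bullet> u) = P 2 u \<bullet>\<bullet> P 1 u + P 1 u \<bullet>\<bullet> P 2 u"
    using pr_comp[OF f f, of 0] pr_comp[OF f f, of 1] pr_comp[OF f f, of 2] pr_comp[OF f f, of 3]
    by (simp_all add: s0 s1 s2 s3 u0 zs del: One_nat_def atMost_0)
  have uuu: "P 0 (u \<bullet>\<bullet> u \<bullet>\<bullet> u) = 0" "P 1 (u \<bullet>\<bullet> u \<bullet>\<bullet> u) = 0" "P 2 (u \<bullet>\<bullet> u \<bullet>\<bullet> u) = 0"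
    "P 3 (u \<bullet>\<bullet> u \<bullet>\<bullet> u) = P 1 u \<bullet>\<bullet> P 1 u \<bullet>\<bullet> P 1 u"
    using pr_comp[OF End_filt_comp[OF f f] f, of 0] pr_comp[OF End_filt_comp[OF f f] f, of 1]
      pr_comp[OF End_filt_comp[OF f f] f, of 2] pr_comp[OF End_filt_comp[OF f f] f, of 3] uu
    by (simp_all add: s0 s1 s2 s3 u0 zs del: One_nat_def atMost_0)
  have sc: "endo_scale c 0 = 0" for c :: complex
    by (rule endo_ext) (simp add: endo_scale_def)
  show "pr E 0 (endo_exp E V u) = endo_id E V"
    using uu(1) uuu(1) pr_id[of 0 V] by (simp add: endo_exp_eq[OF u] pr_add pr_scale u0 sc)
  show "P 1 (endo_exp E V u) = P 1 u"
    using uu(2) uuu(2) pr_id[of 1 V] by (simp add: endo_exp_eq[OF u] pr_add pr_scale sc)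
  show "P 2 (endo_exp E V u) = P 2 u + endo_scale (1/2) (P 1 u \<bullet>\<bullet> P 1 u)"
    using uu(3) uuu(3) pr_id[of 2 V] by (simp add: endo_exp_eq[OF u] pr_add pr_scale sc)
  show "P 3 (endo_exp E V u) = P 3 u + endo_scale (1/2) (P 2 u \<bullet>\<bullet> P 1 u + P 1 u \<bullet>\<bullet> P 2 u)
      + endo_scale (1/6) (P 1 u \<bullet>\<bullet> P 1 u \<bullet>\<bullet> P 1 u)"
    using uu(4) uuu(4) pr_id[of 3 V] by (simp add: endo_exp_eq[OF u] pr_add pr_scale sc)
qed

text \<open>By \<open>pr_exp\<close>, the component of degree 2q of the exponential is
  \<open>P q u\<close> plus a polynomial in the components of \<open>u\<close> of lower degree.
  Where these agree, the polynomial parts cancel.\<close>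

lemma pr_exp_diff:
  assumes u: "u \<in> Der_pos E V" and v: "v \<in> Der_pos E V" and q: "1 \<le> q" "q \<le> 3"
    and eq: "\<And>p. 1 \<le> p \<Longrightarrow> p < q \<Longrightarrow> P p u = P p v"
  shows "P q (endo_exp E V u) - P q (endo_exp E V v) = P q u - P q v"
proof -
  consider "q = 1" | "q = 2" | "q = 3" using q by linarith
  then show ?thesis
  proof cases
    case 1
    show ?thesis unfolding 1 pr_exp(2)[OF u] pr_exp(2)[OF v] ..
  next
    case 2
    show ?thesis using eq[of 1] unfolding 2 pr_exp(3)[OF u] pr_exp(3)[OF v] by simp
  next
    case 3
    show ?thesis using eq[of 1] eq[of 2] unfolding 3 pr_exp(4)[OF u] pr_exp(4)[OF v] by simp
  qed
qed

text \<open>Iterating the Leibniz rule gives the binomial expansion of u^n(s t). The product of the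
  two truncated exponentials contains further terms u^i(s) u^j(t) with i + j \<ge> 4, but these have
  degree at least 8 and vanish.\<close>

lemma endo_exp_wedge:
  assumes u: "u \<in> Der_pos E V" and W: "open W" "W \<subseteq> V" and s: "s \<in> OL E W" and t: "t \<in> OL E W"
  shows "endo_exp E V u W (sec_wedge s t) = sec_wedge (endo_exp E V u W s) (endo_exp E V u W t)"
proof -
  note e = Der_pos_End[OF u]
  define s1 where "s1 = u W s" define s2 where "s2 = u W s1" define s3 where "s3 = u W s2"
  define t1 where "t1 = u W t" define t2 where "t2 = u W t1" define t3 where "t3 = u W t2"
  have sO: "s1 \<in> OL E W" "s2 \<in> OL E W" "s3 \<in> OL E W"
    unfolding s3_def s2_def s1_def by (intro End_OL[OF e W] s)+
  have tO: "t1 \<in> OL E W" "t2 \<in> OL E W" "t3 \<in> OL E W"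
    unfolding t3_def t2_def t1_def by (intro End_OL[OF e W] t)+
  have d: "s1 \<in> OL_degs E {2..} W" "s2 \<in> OL_degs E {4..} W" "s3 \<in> OL_degs E {6..} W"
    "t1 \<in> OL_degs E {2..} W" "t2 \<in> OL_degs E {4..} W" "t3 \<in> OL_degs E {6..} W"
  proof -
    have r: "u W x \<in> OL_degs E {m..} W" if "x \<in> OL_degs E {n..} W" "m = n + 2" for x m n
      unfolding that(2) by (rule Der_pos_raises[OF u W that(1)])
    have "s \<in> OL_degs E {0..} W" "t \<in> OL_degs E {0..} W" using s t by (simp_all add: OL_degs_def)
    from this[THEN r[where m=2]] show "s1 \<in> OL_degs E {2..} W" "t1 \<in> OL_degs E {2..} W"
      unfolding s1_def t1_def by simp_all
    from this[THEN r[where m=4]] show "s2 \<in> OL_degs E {4..} W" "t2 \<in> OL_degs E {4..} W"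
      unfolding s2_def t2_def by simp_all
    from this[THEN r[where m=6]] show "s3 \<in> OL_degs E {6..} W" "t3 \<in> OL_degs E {6..} W"
      unfolding s3_def t3_def by simp_all
  qed
  have big: "sec_wedge x y = 0" if "x \<in> OL_degs E {a..} W" "y \<in> OL_degs E {b..} W" "8 \<le> a + b" for x y a b
    by (rule OL_degs_ge_8[OF OL_degs_mono[OF OL_degs_wedge_ge[OF that(1,2)]]]) (use that in auto)
  \<comment> \<open>Exactly the products with index sum at least 4.\<close>
  have z: "sec_wedge s1 t3 = 0" "sec_wedge s2 t2 = 0" "sec_wedge s2 t3 = 0"
    "sec_wedge s3 t1 = 0" "sec_wedge s3 t2 = 0" "sec_wedge s3 t3 = 0"
    by (rule big[OF d(1) d(6)] big[OF d(2) d(5)] big[OF d(2) d(6)] big[OF d(3) d(4)] big[OF d(3) d(5)]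
      big[OF d(3) d(6)], simp)+
  note L = Der_pos_leibniz[OF u W] and A = End_add[OF e W]
  have u1: "u W (sec_wedge s t) = sec_wedge s1 t + sec_wedge s t1"
    unfolding L[OF s t] s1_def t1_def ..
  have u2: "u W (u W (sec_wedge s t)) = (sec_wedge s2 t + sec_wedge s1 t1) + (sec_wedge s1 t1 + sec_wedge s t2)"
    unfolding u1 A[OF OL_wedge[OF sO(1) t] OL_wedge[OF s tO(1)]] L[OF sO(1) t] L[OF s tO(1)]
      s1_def[symmetric] t1_def[symmetric] s2_def[symmetric] t2_def[symmetric] ..
  have u3: "u W (u W (u W (sec_wedge s t))) =
      ((sec_wedge s3 t + sec_wedge s2 t1) + (sec_wedge s2 t1 + sec_wedge s1 t2)) +
      ((sec_wedge s2 t1 + sec_wedge s1 t2) + (sec_wedge s1 t2 + sec_wedge s t3))"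
    unfolding u2 A[OF OL_add[OF OL_wedge[OF sO(2) t] OL_wedge[OF sO(1) tO(1)]]
        OL_add[OF OL_wedge[OF sO(1) tO(1)] OL_wedge[OF s tO(2)]]]
      A[OF OL_wedge[OF sO(2) t] OL_wedge[OF sO(1) tO(1)]] A[OF OL_wedge[OF sO(1) tO(1)] OL_wedge[OF s tO(2)]]
      L[OF sO(2) t] L[OF sO(1) tO(1)] L[OF s tO(2)]
      s1_def[symmetric] t1_def[symmetric] s2_def[symmetric] t2_def[symmetric] s3_def[symmetric] t3_def[symmetric] ..
  show ?thesis
    unfolding endo_exp_apply[OF u W s] endo_exp_apply[OF u W t] endo_exp_apply[OF u W OL_wedge[OF s t]]
    unfolding u3 unfolding u2 unfolding u1 unfolding
      s1_def[symmetric] t1_def[symmetric] s2_def[symmetric] t2_def[symmetric] s3_def[symmetric] t3_def[symmetric]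
      sec_wedge_add_left sec_wedge_add_right sec_wedge_scale_left sec_wedge_scale_right z sec_scale_zero
    by (intro ext) (simp add: sec_scale_apply field_simps)
qed

text \<open>As u^4 = 0, this is the identity between the cubic truncations of exp(x) and exp(-x)
  modulo x^4.\<close>

lemma endo_exp_inverse:
  assumes u: "u \<in> Der_pos E V"
  shows "endo_exp E V u \<bullet>\<bullet> endo_exp E V (- u) = endo_id E V"
proof (rule endo_eqI[of _ E V])
  note mu = Der_pos_uminus[OF u]
  show "endo_exp E V u \<bullet>\<bullet> endo_exp E V (- u) \<in> End E V" "endo_id E V \<in> End E V"
    by (intro End_filt_subset End_filt_comp endo_exp_filt u mu End_filt_id)+
  fix W j s assume W: "open W" "W \<subseteq> V" and "s \<in> OL_degs E {j} W"
  then have s: "s \<in> OL E W" by (intro OL_degs_subset)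
  note e = Der_pos_End[OF u]
  define s1 where "s1 = u W s" define s2 where "s2 = u W s1" define s3 where "s3 = u W s2"
  have sO: "s1 \<in> OL E W" "s2 \<in> OL E W" "s3 \<in> OL E W"
    unfolding s3_def s2_def s1_def by (intro End_OL[OF e W] s)+
  have "(u W ^^ 4) s \<in> OL_degs E {8..} W" using Der_pos_funpow[OF u W s, of 4] by simp
  then have s4: "u W s3 = 0"
    using OL_degs_ge_8 unfolding s3_def s2_def s1_def by (simp add: eval_nat_numeral)
  have m: "(- u) W r = sec_scale (-1) (u W r)" for r by (simp add: sec_scale_uminus_one)
  \<comment> \<open>The value of exp(-u) on \<open>s\<close>.\<close>
  define r where "r = s + sec_scale (-1) s1 + sec_scale (1/2) s2 + sec_scale (-1/6) s3"
  note lin = End_scale[OF e W] End_add[OF e W] OL_add OL_scale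
  have r: "endo_exp E V (- u) W s = r"
    unfolding endo_exp_apply[OF mu W s] m r_def s3_def s2_def s1_def
    by (simp add: lin s End_OL[OF e W] sec_scale_scale)
  have rO: "r \<in> OL E W" unfolding r_def by (intro OL_add OL_scale s sO)
  have r1: "u W r = s1 + sec_scale (-1) s2 + sec_scale (1/2) s3"
    unfolding r_def using s sO s4 by (simp add: lin flip: s1_def s2_def s3_def)
  have r2: "u W (u W r) = s2 + sec_scale (-1) s3"
    unfolding r1 using s sO s4 by (simp add: lin flip: s2_def s3_def)
  have r3: "u W (u W (u W r)) = s3"
    unfolding r2 using s sO s4 by (simp add: lin flip: s3_def)
  have "endo_exp E V u W r = s"
    unfolding endo_exp_apply[OF u W rO] unfolding r3 unfolding r2 unfolding r1 unfolding r_def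
    by (intro ext) (simp add: sec_scale_apply field_simps)
  then show "(endo_exp E V u \<bullet>\<bullet> endo_exp E V (- u)) W s = endo_id E V W s"
    using W s by (simp add: endo_comp_apply r endo_id_def)
qed

lemma endo_exp_inverse': "u \<in> Der_pos E V \<Longrightarrow> endo_exp E V (- u) \<bullet>\<bullet> endo_exp E V u = endo_id E V"
  using endo_exp_inverse[OF Der_pos_uminus, of u V] by (metis minus_minus)

lemma endo_exp_G:
  assumes u: "u \<in> Der_pos E V"
  shows "endo_exp E V u \<in> G E V"
proof (rule G_I)
  note mu = Der_pos_uminus[OF u]
  show "endo_exp E V u \<in> F V" by (rule endo_exp_filt[OF u])
  show "P 0 (endo_exp E V u) = endo_id E V" using pr_exp(1)[OF u] by simp
  fix W assume W: "open W" "W \<subseteq> V"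
  have inv: "endo_exp E V u W (endo_exp E V (- u) W s) = s" "endo_exp E V (- u) W (endo_exp E V u W s) = s"
    if "s \<in> OL E W" for s
    unfolding endo_comp_apply[symmetric] endo_exp_inverse[OF u] endo_exp_inverse'[OF u]
    using W that by (simp_all add: endo_id_def)
  show "bij_betw (endo_exp E V u W) (OL E W) (OL E W)"
    by (rule bij_betwI[where g="endo_exp E V (- u) W"])
      (use inv End_OL[OF End_filt_subset[OF endo_exp_filt[OF u]] W] End_OL[OF End_filt_subset[OF endo_exp_filt[OF mu]] W] in auto)
  \<comment> \<open>The Leibniz rule for 1 = 1 * 1 shows that a derivation kills the unit
    section.\<close>
  have "u W (sec_one E W) = u W (sec_one E W) + u W (sec_one E W)"
    using Der_pos_leibniz[OF u W OL_one[OF W(1)] OL_one[OF W(1)]]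
      sec_wedge_one_left[OF OL_one[OF W(1)]] sec_wedge_one_left[OF End_OL[OF Der_pos_End[OF u] W OL_one[OF W(1)]]]
      sec_wedge_one_right[OF End_OL[OF Der_pos_End[OF u] W OL_one[OF W(1)]]] by metis
  then have "u W (sec_one E W) = 0" by (metis add_cancel_right_right)
  then show "endo_exp E V u W (sec_one E W) = sec_one E W"
    by (simp add: endo_exp_apply[OF u W OL_one[OF W(1)]] End_zero[OF Der_pos_End[OF u]])
qed (rule endo_exp_wedge[OF u])

lemma endo_exp_zero: "endo_exp E V 0 = endo_id E V"
  unfolding endo_exp_eq[OF Der_pos_zero] by (rule endo_ext) (simp add: endo_scale_def)

text \<open>The device by which automorphisms are corrected in degree 2q: the logarithm is changed
  by a derivation of that degree, and nothing happens below.\<close>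

lemma endo_exp_add_Der_deg:
  assumes u: "u \<in> Der_pos E V" and \<delta>: "\<delta> \<in> D q V" and q: "1 \<le> q" "q \<le> 3"
  shows "P q (endo_exp E V (u + \<delta>)) = P q (endo_exp E V u) + \<delta>"
    and "p < q \<Longrightarrow> P p (endo_exp E V (u + \<delta>)) = P p (endo_exp E V u)"
proof -
  note v = Der_pos_add[OF u Der_pos_Der_deg[OF \<delta> q(1)]]
  have P: "P p (u + \<delta>) = P p u + (if p = q then \<delta> else 0)" for p
    by (simp only: pr_add pr_Der_deg[OF \<delta>])
  have "P q (endo_exp E V (u + \<delta>)) - P q (endo_exp E V u) = \<delta>"
    using pr_exp_diff[OF v u q] P by simp
  then show "P q (endo_exp E V (u + \<delta>)) = P q (endo_exp E V u) + \<delta>"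
    by (metis add.commute diff_add_cancel)
  show "P p (endo_exp E V (u + \<delta>)) = P p (endo_exp E V u)" if "p < q"
  proof (cases "p = 0")
    case True
    then show ?thesis using pr_exp(1)[OF u] pr_exp(1)[OF v] by simp
  next
    case False
    then have "P p (endo_exp E V (u + \<delta>)) - P p (endo_exp E V u) = 0"
      using pr_exp_diff[OF v u, of p] P that q by simp
    then show ?thesis by simp
  qed
qed

lemma G_eqI:
  assumes "g \<in> G E V" "h \<in> G E V" "\<And>q. 1 \<le> q \<Longrightarrow> q \<le> 3 \<Longrightarrow> P q g = P q h"
  shows "g = h"
proof (rule filt_eqI[OF G_filt[OF assms(1)] G_filt[OF assms(2)]])
  fix q :: nat assume "q \<le> 3"
  then show "P q g = P q h"
    using assms(3)[of q] pr_0_G[OF assms(1)] pr_0_G[OF assms(2)] by (cases "q = 0") (simp, simp)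
qed

lemma pr_diff_Der_deg:
  assumes "g \<in> G E V" "h \<in> G E V" "1 \<le> q" "q \<le> 3" "\<And>p. 1 \<le> p \<Longrightarrow> p < q \<Longrightarrow> P p g = P p h"
  shows "P q g - P q h \<in> D q V"
proof (rule pr_diff_derivation[OF assms(1-4)])
  fix p W s t assume "0 < p" "p < q"
  then have "P p g = P p h" "P (q - p) g = P (q - p) h" using assms(5)[of p] assms(5)[of "q - p"] by auto
  then show "sec_wedge (P p g W s) (P (q - p) g W t) = sec_wedge (P p h W s) (P (q - p) h W t)" by (simp only:)
qed

text \<open>The logarithm is found degree by degree.\<close>

lemma G_obtain_exp:
  assumes g: "g \<in> G E V"
  obtains u where "u \<in> Der_pos E V" "endo_exp E V u = g"
proof -
  have "\<exists>u\<in>Der_pos E V. \<forall>p. 1 \<le> p \<and> p \<le> q \<longrightarrow> P p (endo_exp E V u) = P p g" if "q \<le> 3" for q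
    using that
  proof (induction q)
    case 0
    show ?case by (rule bexI[OF _ Der_pos_zero]) auto
  next
    case (Suc q)
    then obtain u where u: "u \<in> Der_pos E V" "\<And>p. 1 \<le> p \<Longrightarrow> p \<le> q \<Longrightarrow> P p (endo_exp E V u) = P p g"
      by auto
    define \<delta> where "\<delta> = P (Suc q) g - P (Suc q) (endo_exp E V u)"
    have \<delta>: "\<delta> \<in> D (Suc q) V"
      unfolding \<delta>_def by (rule pr_diff_Der_deg[OF g endo_exp_G[OF u(1)]]) (use u(2) Suc.prems in auto)
    have "P p (endo_exp E V (u + \<delta>)) = P p g" if "1 \<le> p" "p \<le> Suc q" for p
    proof (cases "p = Suc q")
      case True
      show ?thesis
        unfolding True using endo_exp_add_Der_deg(1)[OF u(1) \<delta> _ Suc.prems] by (simp add: \<delta>_def)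
    next
      case False
      then show ?thesis
        using endo_exp_add_Der_deg(2)[OF u(1) \<delta> _ Suc.prems, of p] u(2)[of p] that by simp
    qed
    moreover have "u + \<delta> \<in> Der_pos E V" by (rule Der_pos_add[OF u(1) Der_pos_Der_deg[OF \<delta>]]) simp
    ultimately show ?case by blast
  qed
  from this[of 3] obtain u where u: "u \<in> Der_pos E V" "\<And>p. 1 \<le> p \<Longrightarrow> p \<le> 3 \<Longrightarrow> P p (endo_exp E V u) = P p g"
    by auto
  then show thesis using that G_eqI[OF endo_exp_G[OF u(1)] g] by blast
qed

lemma Der_pos_eqI:
  assumes "u \<in> Der_pos E V" "v \<in> Der_pos E V" "\<And>q. 1 \<le> q \<Longrightarrow> q \<le> 3 \<Longrightarrow> P q u = P q v"
  shows "u = v"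
  using Der_pos_sum[OF assms(1)] Der_pos_sum[OF assms(2)] assms(3)
  by (metis (no_types, lifting) atLeastAtMost_iff sum.cong)

text \<open>Once the components below degree 2q are known to agree, \<open>pr_exp_diff\<close> turns
  equality of the exponentials into equality in degree 2q.\<close>

lemma endo_exp_inj:
  assumes u: "u \<in> Der_pos E V" and v: "v \<in> Der_pos E V" and eq: "endo_exp E V u = endo_exp E V v"
  shows "u = v"
proof (rule Der_pos_eqI[OF u v])
  fix q :: nat
  assume "1 \<le> q" "q \<le> 3"
  then show "P q u = P q v"
  proof (induction q rule: less_induct)
    case (less q)
    then show ?case using pr_exp_diff[OF u v, of q] eq by auto
  qed
qed

end

section \<open>Cochains of automorphisms\<close>

lemma add_eq_add_imp_alternating_sum:
  fixes a b c d :: "'g::ab_group_add"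
  assumes "a + b = c + d"
  shows "c - b + d - a = 0"
proof -
  have "c - b + d - a = (c + d) - (a + b)" by (simp add: algebra_simps)
  then show ?thesis using assms by simp
qed

context low_rank_bundle
begin

text \<open>For 1 \<le> q, \<open>x\<close> is the component of degree 2q of g h^{-1}, that is, its
  image in the graded piece of \<open>G\<close> for the filtration by degree. Written as a relation
  that carries \<open>x\<close> along, it can be chained and composed without naming
  inverses.\<close>

definition dif :: "'a set \<Rightarrow> nat \<Rightarrow> ('a, 'e) endo \<Rightarrow> ('a, 'e) endo \<Rightarrow> ('a, 'e) endo \<Rightarrow> bool" where
  "dif V q g h x \<longleftrightarrow>
     g \<in> G E V \<and> h \<in> G E V \<and> (\<forall>p. 1 \<le> p \<and> p < q \<longrightarrow> P p g = P p h) \<and> P q g = P q h + x"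

lemma dif_G: "dif V q g h x \<Longrightarrow> g \<in> G E V" "dif V q g h x \<Longrightarrow> h \<in> G E V"
  by (simp_all add: dif_def)

lemma dif_lower: "dif V q g h x \<Longrightarrow> p < q \<Longrightarrow> P p g = P p h"
  using pr_0_G[of g V] pr_0_G[of h V] by (cases "p = 0") (auto simp: dif_def)

lemma dif_top: "dif V q g h x \<Longrightarrow> P q g = P q h + x"
  by (simp add: dif_def)

lemma dif_refl: "g \<in> G E V \<Longrightarrow> dif V q g g 0"
  by (simp add: dif_def)

lemma dif_sym: "dif V q g h x \<Longrightarrow> dif V q h g (- x)"
  by (simp add: dif_def)

lemma dif_trans: "dif V q g h x \<Longrightarrow> dif V q h k y \<Longrightarrow> dif V q g k (x + y)"
  by (simp add: dif_def ac_simps)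

lemma dif_unique: "dif V q g h x \<Longrightarrow> dif V q g h y \<Longrightarrow> x = y"
  unfolding dif_def by (metis add_left_cancel)

lemma dif_eq_0: "dif V q g g x \<Longrightarrow> x = 0"
  using dif_unique dif_refl dif_G by blast

lemma dif_less: "dif V q g h x \<Longrightarrow> p < q \<Longrightarrow> dif V p g h 0"
  using dif_lower[of V q g h x p] by (auto simp: dif_def)

lemma dif_Der_deg: "dif V q g h x \<Longrightarrow> 1 \<le> q \<Longrightarrow> q \<le> 3 \<Longrightarrow> x \<in> D q V"
  using pr_diff_Der_deg[of g V h q] unfolding dif_def by (metis add_diff_cancel_left')

text \<open>In \<open>pr_comp\<close>, the middle terms of degree 2q contain only components below
  2q, where the factors agree. In the end terms a component of degree 2q meets the identity, so the
  discrepancies simply add.\<close>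

lemma dif_comp:
  assumes g: "dif V q g g' x" and h: "dif V q h h' y" and q: "1 \<le> q" "q \<le> 3"
  shows "dif V q (g \<bullet>\<bullet> h) (g' \<bullet>\<bullet> h') (x + y)"
proof -
  note F = dif_G[OF g, THEN G_filt] dif_G[OF h, THEN G_filt]
  have "P p (g \<bullet>\<bullet> h) = P p (g' \<bullet>\<bullet> h')" if "p < q" for p
  proof -
    have p: "p \<le> 3" using that q by simp
    show ?thesis
      unfolding pr_comp[OF F(1,3) p] pr_comp[OF F(2,4) p]
      by (intro sum.cong refl arg_cong2[where f=endo_comp] dif_lower[OF g] dif_lower[OF h]) (use that in auto)
  qed
  moreover have "P q (g \<bullet>\<bullet> h) = P q (g' \<bullet>\<bullet> h') + (x + y)"
  proof -
    note split = sum_atMost_ends[OF q(1)]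
    have mid: "(\<Sum>b\<in>{0<..<q}. P (q - b) g \<bullet>\<bullet> P b h) = (\<Sum>b\<in>{0<..<q}. P (q - b) g' \<bullet>\<bullet> P b h')"
      by (intro sum.cong refl arg_cong2[where f=endo_comp] dif_lower[OF g] dif_lower[OF h]) auto
    have ends: "P q \<phi> \<bullet>\<bullet> P 0 \<psi> = P q \<phi>" "P 0 \<phi> \<bullet>\<bullet> P q \<psi> = P q \<psi>" if "\<phi> \<in> G E V" "\<psi> \<in> G E V" for \<phi> \<psi>
      unfolding pr_0_G[OF that(1)] pr_0_G[OF that(2)]
      by (rule endo_id_right[OF End_filt_subset[OF End_filt_pr[OF G_filt[OF that(1)]]]])
        (rule endo_id_left[OF End_filt_subset[OF End_filt_pr[OF G_filt[OF that(2)]]]])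
    show ?thesis
      unfolding pr_comp[OF F(1,3) q(2)] pr_comp[OF F(2,4) q(2)] split diff_zero diff_self_eq_0 mid
        ends[OF dif_G(1)[OF g] dif_G(1)[OF h]] ends[OF dif_G(2)[OF g] dif_G(2)[OF h]]
      unfolding dif_top[OF g] dif_top[OF h]
      by (simp only: ac_simps)
  qed
  ultimately show ?thesis
    unfolding dif_def using G_comp[OF dif_G(1)[OF g] dif_G(1)[OF h]] G_comp[OF dif_G(2)[OF g] dif_G(2)[OF h]] by blast
qed

lemma dif_restrict:
  assumes "dif V q g h x" "V' \<subseteq> V"
  shows "dif V' q (endo_restrict V' g) (endo_restrict V' h) (endo_restrict V' x)"
  using assms by (auto simp: dif_def G_restrict pr_restrict endo_restrict_add)

lemma dif_exp:
  assumes "u \<in> Der_pos E V" "v \<in> Der_pos E V" "1 \<le> q" "q \<le> 3" "\<And>p. 1 \<le> p \<Longrightarrow> p < q \<Longrightarrow> P p u = P p v"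
  shows "dif V q (endo_exp E V u) (endo_exp E V v) (P q u - P q v)"
  unfolding dif_def
proof (intro conjI allI impI)
  show "P p (endo_exp E V u) = P p (endo_exp E V v)" if "1 \<le> p \<and> p < q" for p
    using pr_exp_diff[OF assms(1,2), of p] that assms by simp
  show "P q (endo_exp E V u) = P q (endo_exp E V v) + (P q u - P q v)"
    using pr_exp_diff[OF assms] by (metis add.commute diff_add_cancel)
qed (simp_all add: endo_exp_G assms)

lemma G_eq_id_iff: "g \<in> G E V \<Longrightarrow> g = endo_id E V \<longleftrightarrow> (\<forall>p. 1 \<le> p \<and> p \<le> 3 \<longrightarrow> P p g = 0)"
  using G_eqI[OF _ G_id, of g V] pr_id by (metis not_one_le_zero)

end

section \<open>Multiplicative cochains and their additive differences\<close>

locale low_rank_cover = low_rank_bundle E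
  for E :: "('a::{t2_space,second_countable_topology}, 'e) vbundle" +
  fixes U :: "'i \<Rightarrow> 'a set"
  assumes H2_4: "H2_vanishes U (Der_deg E 4)" and H2_6: "H2_vanishes U (Der_deg E 6)"
begin

abbreviation (input) U2 :: "'i \<Rightarrow> 'i \<Rightarrow> 'a set" where
  "U2 i j \<equiv> U i \<inter> U j"

abbreviation (input) U3 :: "'i \<Rightarrow> 'i \<Rightarrow> 'i \<Rightarrow> 'a set" where
  "U3 i j k \<equiv> U i \<inter> U j \<inter> U k"

text \<open>The multiplicative form of alternation. By \<open>exp_cochain_C1_G\<close> and
  \<open>C1_G_exp\<close> these are exactly the exponentials of alternating cochains, but the
  description avoids logarithms and is easy to check for products.\<close>

definition C1_G :: "('i \<Rightarrow> 'i \<Rightarrow> ('a, 'e) endo) set" where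
  "C1_G = {g. \<forall>i j. g i j \<in> G E (U2 i j) \<and> g i j \<bullet>\<bullet> g j i = endo_id E (U2 i j)}"

definition cdif ::
    "nat \<Rightarrow> ('i \<Rightarrow> 'i \<Rightarrow> ('a, 'e) endo) \<Rightarrow> ('i \<Rightarrow> 'i \<Rightarrow> ('a, 'e) endo) \<Rightarrow> ('i \<Rightarrow> 'i \<Rightarrow> ('a, 'e) endo) \<Rightarrow> bool"
  where "cdif q g h x \<longleftrightarrow> (\<forall>i j. dif (U2 i j) q (g i j) (h i j) (x i j))"

lemma cochain_add_apply: "(u + x) i j = u i j + x i j" for u x :: "'i \<Rightarrow> 'i \<Rightarrow> ('a, 'e) endo"
  by (intro ext) simp

lemma C1_alt: "x \<in> C1 U A \<Longrightarrow> x j i = - x i j"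
  unfolding C1_def by blast

lemma C1_mem: "x \<in> C1 U A \<Longrightarrow> x i j \<in> A (U2 i j)"
  unfolding C1_def C1_all_def by blast

lemma C1I: "(\<And>i j. x i j \<in> A (U2 i j)) \<Longrightarrow> (\<And>i j. x j i = - x i j) \<Longrightarrow> x \<in> C1 U A"
  unfolding C1_def C1_all_def by blast

lemma exp_cochain_C1_G:
  assumes u: "u \<in> C1 U (Der_pos E)"
  shows "exp_cochain E U u \<in> C1_G"
  unfolding C1_G_def exp_cochain_def
proof (intro CollectI allI conjI)
  fix i j
  show "endo_exp E (U2 i j) (u i j) \<in> G E (U2 i j)" by (rule endo_exp_G[OF C1_mem[OF u]])
  show "endo_exp E (U2 i j) (u i j) \<bullet>\<bullet> endo_exp E (U2 j i) (u j i) = endo_id E (U2 i j)"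
    using endo_exp_inverse[OF C1_mem[OF u, of i j]] unfolding C1_alt[OF u, of j i] Int_commute[of "U j"] .
qed

text \<open>Logarithms exist entry by entry. Both exp(-u_ij) and exp(u_ji) are inverse to g_ij, so
  injectivity of the exponential makes the logarithms alternating.\<close>

lemma C1_G_exp:
  assumes g: "g \<in> C1_G"
  obtains u where "u \<in> C1 U (Der_pos E)" "g = exp_cochain E U u"
proof -
  have "\<exists>u. u \<in> Der_pos E (U2 i j) \<and> endo_exp E (U2 i j) u = g i j" for i j
  proof -
    have "g i j \<in> G E (U2 i j)" using g by (simp add: C1_G_def)
    then show ?thesis by (rule G_obtain_exp) blast
  qed
  then obtain u where u: "\<And>i j. u i j \<in> Der_pos E (U2 i j)" "\<And>i j. endo_exp E (U2 i j) (u i j) = g i j"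
    by metis
  have "u j i = - u i j" for i j
  proof -
    have gji: "g j i \<in> G E (U2 i j)" using g unfolding C1_G_def Int_commute[of "U i"] by blast
    have "endo_exp E (U2 i j) (- u i j) = endo_exp E (U2 i j) (- u i j) \<bullet>\<bullet> (g i j \<bullet>\<bullet> g j i)"
      using g endo_id_right[OF G_End[OF endo_exp_G[OF Der_pos_uminus[OF u(1)]]], of i j]
      unfolding C1_G_def by simp
    also have "\<dots> = (endo_exp E (U2 i j) (- u i j) \<bullet>\<bullet> endo_exp E (U2 i j) (u i j)) \<bullet>\<bullet> g j i"
      by (simp only: u(2) endo_comp_assoc)
    also have "\<dots> = g j i"
      unfolding endo_exp_inverse'[OF u(1)] by (rule endo_id_left[OF G_End[OF gji]])
    also have "\<dots> = endo_exp E (U2 i j) (u j i)"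
      using u(2)[of j i] by (simp only: Int_commute)
    finally show ?thesis
      using endo_exp_inj[of "- u i j" "U2 i j" "u j i"] Der_pos_uminus[OF u(1)] u(1)[of j i]
      by (simp only: Int_commute)
  qed
  then have "u \<in> C1 U (Der_pos E)" using u(1) by (intro C1I)
  moreover have "g = exp_cochain E U u" by (rule ext, rule ext) (simp add: exp_cochain_def u(2))
  ultimately show thesis by (rule that)
qed

lemma C1_G_G: "g \<in> C1_G \<Longrightarrow> g i j \<in> G E (U2 i j)"
  by (simp add: C1_G_def)

lemma C1_G_inverse: "g \<in> C1_G \<Longrightarrow> g i j \<bullet>\<bullet> g j i = endo_id E (U2 i j)"
  by (simp add: C1_G_def)

text \<open>An entry g_ii squares to the identity, and \<open>G\<close> has no elements of order 2:
  its logarithm equals its own negative.\<close>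

lemma C1_G_diag:
  assumes "g \<in> C1_G"
  shows "g i i = endo_id E (U i)"
proof -
  obtain u where u: "u \<in> C1 U (Der_pos E)" and g: "g = exp_cochain E U u" using C1_G_exp[OF assms] .
  have "u i i = - u i i" by (rule C1_alt[OF u])
  then have "u i i = 0"
  proof (intro ext)
    fix V s x t I
    assume e: "u i i = - u i i"
    have "u i i V s x t I = (- u i i) V s x t I" by (rule arg_cong[where f="\<lambda>\<phi>. \<phi> V s x t I", OF e])
    then show "u i i V s x t I = 0 V s x t I" by simp
  qed
  then show ?thesis by (simp add: g exp_cochain_def endo_exp_zero)
qed

lemma cdif_refl: "g \<in> C1_G \<Longrightarrow> cdif q g g 0"
  by (simp add: cdif_def dif_refl C1_G_G)

lemma cdif_sym: "cdif q g h x \<Longrightarrow> cdif q h g (- x)"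
  by (simp add: cdif_def dif_sym)

lemma cdif_trans: "cdif q g h x \<Longrightarrow> cdif q h k y \<Longrightarrow> cdif q g k (x + y)"
  by (simp add: cdif_def) (metis dif_trans)

lemma cdif_less: "cdif q g h x \<Longrightarrow> p < q \<Longrightarrow> cdif p g h 0"
  by (simp add: cdif_def) (metis dif_less)

lemma cdif_unique: "cdif q g h x \<Longrightarrow> cdif q g h y \<Longrightarrow> x = y"
  unfolding cdif_def by (rule ext, rule ext) (metis dif_unique)

lemma cdif_top: "cdif q g h x \<Longrightarrow> P q (g i j) = P q (h i j) + x i j"
  unfolding cdif_def using dif_top by blast

lemma cdif_Suc: "cdif q g h 0 \<Longrightarrow> cdif (Suc q) g h (\<lambda>i j. P (Suc q) (g i j) - P (Suc q) (h i j))"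
  by (auto simp: cdif_def dif_def less_Suc_eq)

text \<open>Since g_ij g_ji and h_ij h_ji are both the identity, the discrepancies x_ij and x_ji add
  up to 0.\<close>

lemma cdif_C1:
  assumes g: "g \<in> C1_G" and h: "h \<in> C1_G" and x: "cdif q g h x" and q: "1 \<le> q" "q \<le> 3"
  shows "x \<in> C1 U (D q)"
proof (rule C1I)
  note d = x[unfolded cdif_def, rule_format]
  fix i j
  show "x i j \<in> D q (U2 i j)" by (rule dif_Der_deg[OF d q])
  have "dif (U2 i j) q (g i j \<bullet>\<bullet> g j i) (h i j \<bullet>\<bullet> h j i) (x i j + x j i)"
    by (rule dif_comp[OF d _ q]) (use d[of j i] in \<open>simp only: Int_commute\<close>)
  then have "x i j + x j i = 0"
    unfolding C1_G_inverse[OF g] C1_G_inverse[OF h] by (rule dif_eq_0)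
  then show "x j i = - x i j" by (metis add.inverse_unique)
qed

lemma mult_cobdry_comp:
  "mult_cobdry U g i j k = endo_restrict (U3 i j k) (g i j) \<bullet>\<bullet> endo_restrict (U3 i j k) (g j k) \<bullet>\<bullet>
     endo_restrict (U3 i j k) (g k i)"
  by (simp add: mult_cobdry_def endo_restrict_comp)

text \<open>On the lowest differing component the triple product becomes a sum. For alternating
  \<open>x\<close>, \<open>d1_C1\<close> identifies this sum with the additive coboundary, which is
  how multiplicative and additive cocycle conditions are linked.\<close>

lemma mult_cobdry_dif:
  assumes x: "cdif q g h x" and q: "1 \<le> q" "q \<le> 3"
  shows "dif (U3 i j k) q (mult_cobdry U g i j k) (mult_cobdry U h i j k)
    (endo_restrict (U3 i j k) (x i j + x j k + x k i))"
  unfolding mult_cobdry_comp endo_restrict_add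
  by (intro dif_comp q; rule dif_restrict[OF x[unfolded cdif_def, rule_format]]) blast+

lemma mult_cobdry_G: "g \<in> C1_G \<Longrightarrow> mult_cobdry U g i j k \<in> G E (U3 i j k)"
  unfolding mult_cobdry_comp by (intro G_comp; rule G_restrict[OF C1_G_G]) auto

lemma d1_C1:
  assumes x: "x \<in> C1 U A"
  shows "d1 U x i j k = endo_restrict (U3 i j k) (x i j + x j k + x k i)"
  unfolding d1_def C1_alt[OF x, of k i] by (rule arg_cong[where f="endo_restrict _"]) (simp add: ac_simps)

lemma Z1_G_iff:
  "g \<in> Z1_G E U \<longleftrightarrow> g \<in> C1_G \<and> (\<forall>i j k. mult_cobdry U g i j k = endo_id E (U3 i j k))"
proof -
  have "g \<in> exp_cochain E U ` C1 U (Der_pos E) \<longleftrightarrow> g \<in> C1_G"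
    using C1_G_exp exp_cochain_C1_G by blast
  then show ?thesis unfolding Z1_G_def using C1_G_G by (auto simp: fun_eq_iff)
qed

lemma Z1_G_C1_G: "g \<in> Z1_G E U \<Longrightarrow> g \<in> C1_G"
  by (simp add: Z1_G_iff)

lemma cdif_Z1:
  assumes g: "g \<in> Z1_G E U" and h: "h \<in> Z1_G E U" and x: "cdif q g h x" and q: "1 \<le> q" "q \<le> 3"
  shows "x \<in> Z1 U (D q)"
proof -
  have C: "x \<in> C1 U (D q)" by (rule cdif_C1[OF Z1_G_C1_G[OF g] Z1_G_C1_G[OF h] x q])
  have "d1 U x i j k = 0" for i j k
    using mult_cobdry_dif[OF x q, of i j k] g h unfolding Z1_G_iff d1_C1[OF C] by (metis dif_eq_0)
  then show ?thesis using C by (simp add: Z1_def fun_eq_iff)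
qed

text \<open>The correction is made on the logarithm: exp(u + x) has the prescribed discrepancy, and
  alternation of u + x keeps the new cochain in \<open>C1_G\<close>.\<close>

lemma C1_G_modify:
  assumes h: "h \<in> C1_G" and x: "x \<in> C1 U (D q)" and q: "1 \<le> q" "q \<le> 3"
  obtains g where "g \<in> C1_G" "cdif q g h x"
proof -
  obtain u where u: "u \<in> C1 U (Der_pos E)" and hu: "h = exp_cochain E U u" using C1_G_exp[OF h] .
  have ux: "u + x \<in> C1 U (Der_pos E)"
  proof (rule C1I)
    fix i j
    note p = cochain_add_apply[of u x]
    show "(u + x) i j \<in> Der_pos E (U2 i j)"
      unfolding p by (rule Der_pos_add[OF C1_mem[OF u] Der_pos_Der_deg[OF C1_mem[OF x] q(1)]])
    show "(u + x) j i = - (u + x) i j"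
      unfolding p C1_alt[OF u, of j i] C1_alt[OF x, of j i] by (rule minus_add_distrib[symmetric])
  qed
  have "cdif q (exp_cochain E U (u + x)) h x"
    unfolding cdif_def hu exp_cochain_def
  proof (intro allI)
    fix i j
    note a = endo_exp_add_Der_deg[OF C1_mem[OF u, of i j] C1_mem[OF x, of i j] q]
    show "dif (U2 i j) q (endo_exp E (U2 i j) ((u + x) i j)) (endo_exp E (U2 i j) (u i j)) (x i j)"
      using a endo_exp_G[OF C1_mem[OF ux, of i j]] endo_exp_G[OF C1_mem[OF u, of i j]] by (simp add: dif_def)
  qed
  then show thesis using that[OF exp_cochain_C1_G[OF ux]] by blast
qed

text \<open>The obstruction cocycle: in \<open>c\<^sub>i\<^sub>j\<^sub>k c\<^sub>i\<^sub>k\<^sub>l = (g\<^sub>i\<^sub>j c\<^sub>j\<^sub>k\<^sub>l g\<^sub>j\<^sub>i) c\<^sub>i\<^sub>j\<^sub>l\<close>, the lowest-degree terms add up.\<close>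

lemma mult_cobdry_cocycle:
  assumes g: "g \<in> C1_G" and q: "1 \<le> q" "q \<le> 3"
    and y: "\<And>i j k. dif (U3 i j k) q (mult_cobdry U g i j k) (endo_id E (U3 i j k)) (y i j k)"
  shows "d2 U y = 0"
proof -
  have "d2 U y i j k l = 0" for i j k l
  proof -
    define Q where "Q = U i \<inter> U j \<inter> U k \<inter> U l"
    define \<gamma> where "\<gamma> = (\<lambda>a b. endo_restrict Q (g a b))"
    define I where "I = {i, j, k, l}"
    have \<gamma>G: "\<gamma> a b \<in> G E Q" if "a \<in> I" "b \<in> I" for a b
      unfolding \<gamma>_def by (rule G_restrict[OF C1_G_G[OF g]]) (use that in \<open>auto simp: Q_def I_def\<close>)
    have inv: "\<gamma> a b \<bullet>\<bullet> \<gamma> b a = endo_id E Q" if "a \<in> I" "b \<in> I" for a b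
      unfolding \<gamma>_def endo_restrict_comp[symmetric] C1_G_inverse[OF g]
      by (rule endo_restrict_id) (use that in \<open>auto simp: Q_def I_def\<close>)
    have cancel: "\<gamma> a b \<bullet>\<bullet> (\<gamma> b a \<bullet>\<bullet> \<phi>) = \<phi>" if "a \<in> I" "b \<in> I" "\<phi> \<in> G E Q" for a b \<phi>
      unfolding endo_comp_assoc[symmetric] inv[OF that(1,2)] by (rule endo_id_left[OF G_End[OF that(3)]])
    define c where "c = (\<lambda>a b d. \<gamma> a b \<bullet>\<bullet> \<gamma> b d \<bullet>\<bullet> \<gamma> d a)"
    have c: "dif Q q (c a b d) (endo_id E Q) (endo_restrict Q (y a b d))" if "a \<in> I" "b \<in> I" "d \<in> I" for a b d
    proof -
      have Q: "Q \<subseteq> U3 a b d" using that by (auto simp: Q_def I_def)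
      have "endo_restrict Q (mult_cobdry U g a b d) = c a b d"
        unfolding mult_cobdry_def endo_restrict_restrict[OF Q] c_def \<gamma>_def endo_restrict_comp ..
      then show ?thesis using dif_restrict[OF y[of a b d] Q] by (simp only: endo_restrict_id[OF Q])
    qed
    have mem: "i \<in> I" "j \<in> I" "k \<in> I" "l \<in> I" by (simp_all add: I_def)
    have id2: "endo_id E Q \<bullet>\<bullet> endo_id E Q = endo_id E Q" by (rule endo_id_left[OF G_End[OF G_id]])
    \<comment> \<open>After cancelling inverse pairs both sides equal \<gamma>_ij \<gamma>_jk
      \<gamma>_kl \<gamma>_li.\<close>
    have eq: "c i j k \<bullet>\<bullet> c i k l = \<gamma> i j \<bullet>\<bullet> c j k l \<bullet>\<bullet> \<gamma> j i \<bullet>\<bullet> c i j l"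
      unfolding c_def endo_comp_assoc
      by (simp only: cancel mem G_comp \<gamma>G)
    have lhs: "dif Q q (c i j k \<bullet>\<bullet> c i k l) (endo_id E Q) (endo_restrict Q (y i j k) + endo_restrict Q (y i k l))"
      using dif_comp[OF c c q, of i j k i k l] mem by (simp only: id2)
    \<comment> \<open>Comparison with the same product in which the coboundaries are replaced by the
      identity: the conjugating factors have discrepancy 0, so conjugation does not affect the
      lowest component.\<close>
    have "dif Q q (\<gamma> i j \<bullet>\<bullet> c j k l \<bullet>\<bullet> \<gamma> j i \<bullet>\<bullet> c i j l) (\<gamma> i j \<bullet>\<bullet> endo_id E Q \<bullet>\<bullet> \<gamma> j i \<bullet>\<bullet> endo_id E Q)
        (0 + endo_restrict Q (y j k l) + 0 + endo_restrict Q (y i j l))"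
      by (intro dif_comp q dif_refl c \<gamma>G mem)
    then have rhs: "dif Q q (\<gamma> i j \<bullet>\<bullet> c j k l \<bullet>\<bullet> \<gamma> j i \<bullet>\<bullet> c i j l) (endo_id E Q)
        (endo_restrict Q (y j k l) + endo_restrict Q (y i j l))"
      by (simp only: endo_id_right[OF G_End[OF \<gamma>G]] inv mem id2 add_0_left add_0_right)
    have "endo_restrict Q (y i j k) + endo_restrict Q (y i k l) = endo_restrict Q (y j k l) + endo_restrict Q (y i j l)"
      by (rule dif_unique[OF lhs[unfolded eq] rhs])
    then have "endo_restrict Q (y j k l) - endo_restrict Q (y i k l) + endo_restrict Q (y i j l) - endo_restrict Q (y i j k) = 0"
      by (rule add_eq_add_imp_alternating_sum)
    then show ?thesis by (simp only: d2_def Q_def[symmetric] endo_restrict_add endo_restrict_diff)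
  qed
  then show ?thesis by - (rule ext, rule ext, rule ext, rule ext, simp only: zero_fun_apply)
qed

end

subsection \<open>Lifting cocycles\<close>

lemma (in low_rank_bundle) dif_idI:
  assumes "g \<in> G E V" "1 \<le> q" "\<And>p. 1 \<le> p \<Longrightarrow> p < q \<Longrightarrow> P p g = 0"
  shows "dif V q g (endo_id E V) (P q g)"
  unfolding dif_def using assms G_id pr_id[of _ V] by auto

context low_rank_cover
begin

lemma C1_uminus:
  assumes x: "x \<in> C1 U (D q)"
  shows "- x \<in> C1 U (D q)"
proof (rule C1I)
  fix i j
  have n: "(- x) i j = - x i j" for i j by (intro ext) simp
  show "(- x) i j \<in> D q (U2 i j)" unfolding n by (rule Der_deg_uminus[OF C1_mem[OF x]])
  show "(- x) j i = - (- x) i j" unfolding n C1_alt[OF x, of j i] ..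
qed

lemma H2_vanishes_D: "2 \<le> q \<Longrightarrow> q \<le> 3 \<Longrightarrow> H2_vanishes U (D q)"
proof -
  assume "2 \<le> q" "q \<le> 3"
  then have "q = 2 \<or> q = 3" by auto
  then show ?thesis using H2_4 H2_6 by auto
qed

text \<open>Since \<open>c\<^sub>i\<^sub>i\<^sub>k\<close> and \<open>c\<^sub>i\<^sub>j\<^sub>i\<close> are trivial, any 1-cochain bounding the obstruction is alternating.\<close>

lemma lift_step:
  assumes g: "g \<in> C1_G" and q: "2 \<le> q" "q \<le> 3"
    and triv: "\<And>i j k p. 1 \<le> p \<Longrightarrow> p < q \<Longrightarrow> P p (mult_cobdry U g i j k) = 0"
  obtains g' w where "g' \<in> C1_G" "cdif q g' g w"
    "\<And>i j k p. 1 \<le> p \<Longrightarrow> p \<le> q \<Longrightarrow> P p (mult_cobdry U g' i j k) = 0"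
proof -
  have q1: "1 \<le> q" using q by simp
  define y where "y = (\<lambda>i j k. P q (mult_cobdry U g i j k))"
  have y: "dif (U3 i j k) q (mult_cobdry U g i j k) (endo_id E (U3 i j k)) (y i j k)" for i j k
    unfolding y_def by (rule dif_idI[OF mult_cobdry_G[OF g] q1 triv])
  have "d2 U y = 0" by (rule mult_cobdry_cocycle[OF g q1 q(2) y])
  moreover have "y \<in> C2 U (D q)"
    unfolding C2_def using dif_Der_deg[OF y q1 q(2)] by blast
  ultimately have "y \<in> d1 U ` C1_all U (D q)"
    using H2_vanishes_D[OF q] unfolding H2_vanishes_def by blast
  then obtain w where w: "\<And>i j. w i j \<in> D q (U2 i j)" and dw: "y = d1 U w"
    unfolding C1_all_def by blast
  have self: "endo_restrict (U2 i j) (w i j) = w i j" for i j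
    by (rule endo_restrict_self[OF End_filt_subset[OF Der_deg_filt[OF w]]])
  have pr0: "P q (endo_id E V) = 0" for V using pr_id[of q V] q1 by simp
  have diag: "w i i = 0" for i
  proof -
    have "y i i i = 0"
      unfolding y_def mult_cobdry_def C1_G_diag[OF g] pr_restrict
        endo_id_left[OF End_filt_subset[OF End_filt_id]] pr0 by simp
    moreover have "y i i i = endo_restrict (U2 i i) (w i i)"
      unfolding dw d1_def by simp
    ultimately show ?thesis by (simp only: self)
  qed
  have alt: "w j i = - w i j" for i j
  proof -
    have gij: "g i j \<bullet>\<bullet> g j i \<bullet>\<bullet> g i i = g i j \<bullet>\<bullet> g j i \<bullet>\<bullet> endo_id E (U i)"
      by (simp only: C1_G_diag[OF g])
    have Q: "U3 i j i = U2 i j" by blast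
    have "mult_cobdry U g i j i = endo_restrict (U2 i j) (g i j \<bullet>\<bullet> g j i) \<bullet>\<bullet> endo_restrict (U2 i j) (endo_id E (U i))"
      unfolding mult_cobdry_def Q unfolding gij by (rule endo_restrict_comp)
    also have "\<dots> = endo_id E (U2 i j)"
      unfolding C1_G_inverse[OF g] endo_restrict_id[OF subset_refl] endo_restrict_id[OF Int_lower1]
      by (rule endo_id_left[OF End_filt_subset[OF End_filt_id]])
    finally have "y i j i = 0" unfolding y_def by (simp only: pr0)
    moreover have "y i j i = endo_restrict (U2 i j) (w j i + w i j)"
      unfolding dw d1_def Q diag by simp
    moreover have "endo_restrict (U2 i j) (w j i) = w j i"
      using self[of j i] by (simp only: Int_commute)
    ultimately have "w j i + w i j = 0" by (simp only: endo_restrict_add self)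
    then show ?thesis by (metis add_eq_0_iff2)
  qed
  have wC: "w \<in> C1 U (D q)" by (intro C1I w alt)
  obtain g' where g': "g' \<in> C1_G" "cdif q g' g (- w)"
    by (rule C1_G_modify[OF g C1_uminus[OF wC] q1 q(2)])
  have dif: "dif (U3 i j k) q (mult_cobdry U g' i j k) (endo_id E (U3 i j k)) 0" for i j k
  proof -
    have n: "(- w) i j = - w i j" for i j by (intro ext) simp
    have "endo_restrict (U3 i j k) ((- w) i j + (- w) j k + (- w) k i) = - y i j k"
      unfolding dw d1_C1[OF wC] n endo_restrict_uminus[symmetric]
      by (rule arg_cong[where f="endo_restrict _"]) simp
    then show ?thesis
      using dif_trans[OF mult_cobdry_dif[OF g'(2) q1 q(2), of i j k] y[of i j k]] by simp
  qed
  have "P p (mult_cobdry U g' i j k) = 0" if "1 \<le> p" "p \<le> q" for i j k p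
  proof (cases "p = q")
    case True
    then show ?thesis using dif_top[OF dif[of i j k]] by (simp add: pr0)
  next
    case False
    then show ?thesis using dif_lower[OF dif[of i j k], of p] that pr_id[of p "U3 i j k"] by simp
  qed
  then show thesis using that g' by blast
qed

lemma cdif_trans_less: "cdif q g h x \<Longrightarrow> cdif p k g y \<Longrightarrow> q < p \<Longrightarrow> cdif q k h x"
  using cdif_trans[OF cdif_less, of p k g y q h x] by simp

text \<open>In degree 2q the correction by \<open>z\<close> leaves the coboundary trivial because
  \<open>z\<close> is an additive cocycle. The obstructions left lie in degrees 2m with m > q \<ge>
  1, that is, in degrees 4 and 6, and removing them by \<open>lift_step\<close> does not disturb the
  difference already prescribed.\<close>

lemma lift:
  assumes b: "b \<in> Z1_G E U" and z: "z \<in> Z1 U (D q)" and q: "1 \<le> q" "q \<le> 3"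
  obtains n where "n \<in> Z1_G E U" "cdif q n b z"
proof -
  have zC: "z \<in> C1 U (D q)" and dz: "d1 U z = 0" using z by (simp_all add: Z1_def)
  \<comment> \<open>Here \<open>m\<close> is the first index at which the coboundary may still be
    nontrivial; at m = 4 no possible degree remains.\<close>
  have ex: "\<exists>g\<in>C1_G. cdif q g b z \<and> (\<forall>i j k p. 1 \<le> p \<and> p < m \<longrightarrow> P p (mult_cobdry U g i j k) = 0)"
    if "Suc q \<le> m" "m \<le> 4" for m
    using that
  proof (induction m rule: dec_induct)
    case base
    obtain g where g: "g \<in> C1_G" "cdif q g b z" by (rule C1_G_modify[OF Z1_G_C1_G[OF b] zC q])
    have d: "dif (U3 i j k) q (mult_cobdry U g i j k) (endo_id E (U3 i j k)) 0" for i j k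
    proof -
      have "endo_restrict (U3 i j k) (z i j + z j k + z k i) = 0"
        unfolding d1_C1[OF zC, symmetric] dz by simp
      then show ?thesis
        using mult_cobdry_dif[OF g(2) q, of i j k] b by (simp add: Z1_G_iff)
    qed
    have "P p (mult_cobdry U g i j k) = 0" if "1 \<le> p" "p < Suc q" for i j k p
    proof (cases "p = q")
      case True
      then show ?thesis using dif_top[OF d[of i j k]] pr_id[of q "U3 i j k"] q by simp
    next
      case False
      then show ?thesis using dif_lower[OF d[of i j k], of p] that pr_id[of p "U3 i j k"] by simp
    qed
    then show ?case using g by blast
  next
    case (step m)
    then obtain g where g: "g \<in> C1_G" "cdif q g b z"
      and t: "\<And>i j k p. 1 \<le> p \<Longrightarrow> p < m \<Longrightarrow> P p (mult_cobdry U g i j k) = 0" by auto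
    have m: "2 \<le> m" "m \<le> 3" using step q by auto
    obtain g' w where g': "g' \<in> C1_G" "cdif m g' g w"
      "\<And>i j k p. 1 \<le> p \<Longrightarrow> p \<le> m \<Longrightarrow> P p (mult_cobdry U g' i j k) = 0"
      by (rule lift_step[OF g(1) m t]) blast+
    have "cdif q g' b z" by (rule cdif_trans_less[OF g(2) g'(2)]) (use step in simp)
    then show ?case using g'(1,3) by (auto simp: less_Suc_eq_le)
  qed
  have "Suc q \<le> 4" using q by simp
  then obtain g where g: "g \<in> C1_G" "cdif q g b z"
    and t: "\<And>i j k p. 1 \<le> p \<Longrightarrow> p < 4 \<Longrightarrow> P p (mult_cobdry U g i j k) = 0"
    using ex[of 4] by auto
  have "mult_cobdry U g i j k = endo_id E (U3 i j k)" for i j k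
    using G_eq_id_iff[OF mult_cobdry_G[OF g(1)]] t by auto
  then have "g \<in> Z1_G E U" using g(1) by (simp add: Z1_G_iff)
  then show thesis using that g(2) by blast
qed

definition id_cochain :: "'i \<Rightarrow> 'i \<Rightarrow> ('a, 'e) endo" where
  "id_cochain = (\<lambda>i j. endo_id E (U2 i j))"

lemma id_cochain_Z1_G: "id_cochain \<in> Z1_G E U"
  unfolding Z1_G_iff
proof (intro conjI allI)
  show "id_cochain \<in> C1_G"
    unfolding C1_G_def id_cochain_def
  proof (intro CollectI allI conjI G_id)
    show "endo_id E (U2 i j) \<bullet>\<bullet> endo_id E (U2 j i) = endo_id E (U2 i j)" for i j
      unfolding Int_commute[of "U j"] by (rule endo_id_left[OF End_filt_subset[OF End_filt_id]])
  qed
  show "mult_cobdry U id_cochain i j k = endo_id E (U3 i j k)" for i j k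
  proof -
    have r: "endo_restrict (U3 i j k) (id_cochain a b) = endo_id E (U3 i j k)" if "a \<in> {i, j, k}" "b \<in> {i, j, k}" for a b
      unfolding id_cochain_def by (rule endo_restrict_id) (use that in auto)
    show ?thesis
      unfolding mult_cobdry_comp by (simp only: r insertI1 insertI2 endo_id_left[OF End_filt_subset[OF End_filt_id]])
  qed
qed

lemma pr_id_cochain: "1 \<le> q \<Longrightarrow> P q (id_cochain i j) = 0"
  unfolding id_cochain_def using pr_id[of q] by simp

subsection \<open>The maps \<open>R\<close>\<close>

lemma pr_upto_eq: "1 \<le> q \<Longrightarrow> pr_upto E (2 * q - 2) \<phi> = (\<Sum>k\<in>{1..<q}. P k \<phi>)"
  unfolding pr_upto_def by (rule sum.cong) auto

lemma pr_pr_upto: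
  assumes u: "u \<in> Der_pos E V" and q: "1 \<le> q"
  shows "P p (pr_upto E (2 * q - 2) u) = (if 1 \<le> p \<and> p < q then P p u else 0)"
proof -
  have "P p (pr_upto E (2 * q - 2) u) = (\<Sum>k\<in>{1..<q}. if k = p then P p u else 0)"
    unfolding pr_upto_eq[OF q] pr_sum pr_pr[OF Der_pos_filt[OF u]] by (rule sum.cong) auto
  then show ?thesis by (simp add: sum.delta)
qed

lemma pr_upto_Der_pos:
  assumes u: "u \<in> Der_pos E V" and q: "1 \<le> q"
  shows "pr_upto E (2 * q - 2) u \<in> Der_pos E V"
  unfolding Der_pos_iff
proof (intro conjI allI impI)
  show "pr_upto E (2 * q - 2) u \<in> F V"
    unfolding pr_upto_def by (intro End_filt_sum End_filt_pr Der_pos_filt[OF u])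
  show "P 0 (pr_upto E (2 * q - 2) u) = 0" unfolding pr_pr_upto[OF u q] by simp
  show "P p (pr_upto E (2 * q - 2) u) \<in> D p V" if "1 \<le> p" for p
    unfolding pr_pr_upto[OF u q] using pr_Der_pos[OF u that] Der_deg_zero by simp
qed

lemma pr_upto_uminus: "pr_upto E m (- \<phi>) = - pr_upto E m \<phi>"
  unfolding pr_upto_def pr_uminus by (rule sum_negf)

lemma pr_upto_cochain_C1:
  assumes u: "u \<in> C1 U (Der_pos E)" and q: "1 \<le> q"
  shows "pr_upto_cochain E (2 * q - 2) u \<in> C1 U (Der_pos E)"
  unfolding pr_upto_cochain_def
proof (rule C1I)
  show "pr_upto E (2 * q - 2) (u i j) \<in> Der_pos E (U2 i j)" for i j
    by (rule pr_upto_Der_pos[OF C1_mem[OF u] q])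
  show "pr_upto E (2 * q - 2) (u j i) = - pr_upto E (2 * q - 2) (u i j)" for i j
    unfolding C1_alt[OF u, of j i] by (rule pr_upto_uminus)
qed

lemma cdif_exp:
  assumes "u \<in> C1 U (Der_pos E)" "v \<in> C1 U (Der_pos E)" "1 \<le> q" "q \<le> 3"
    "\<And>i j p. 1 \<le> p \<Longrightarrow> p < q \<Longrightarrow> P p (u i j) = P p (v i j)"
  shows "cdif q (exp_cochain E U u) (exp_cochain E U v) (\<lambda>i j. P q (u i j) - P q (v i j))"
  unfolding cdif_def exp_cochain_def
  by (intro allI dif_exp[OF C1_mem[OF assms(1)] C1_mem[OF assms(2)] assms(3,4)] assms(5))

lemma pr_cochain_C1:
  assumes u: "u \<in> C1 U (Der_pos E)" and q: "1 \<le> q"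
  shows "pr_cochain E (2 * q) u \<in> C1 U (D q)"
  unfolding pr_cochain_def
proof (rule C1I)
  show "P q (u i j) \<in> D q (U2 i j)" for i j by (rule pr_Der_pos[OF C1_mem[OF u] q])
  show "P q (u j i) = - P q (u i j)" for i j unfolding C1_alt[OF u, of j i] by (rule pr_uminus)
qed

lemma C1_tildeD: "u \<in> C1_tilde E U \<Longrightarrow> u \<in> C1 U (Der_pos E)" "u \<in> C1_tilde E U \<Longrightarrow> exp_cochain E U u \<in> Z1_G E U"
  by (simp_all add: C1_tilde_def)

text \<open>The truncation of \<open>u\<close> below degree 2q has no component of degree 2q, so its
  exponential differs from exp(u) by -pr_2q(u) in that degree. The multiplicative coboundary of
  exp(u) is trivial, so that of the truncation shows minus the additive coboundary.\<close>

lemma R_eq: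
  assumes u: "u \<in> C1_tilde E U" and q: "1 \<le> q" "q \<le> 3"
  shows "R E U (2 * q) u i j k = - d1 U (pr_cochain E (2 * q) u) i j k"
proof -
  note uC = C1_tildeD(1)[OF u]
  define v where "v = pr_upto_cochain E (2 * q - 2) u"
  have vC: "v \<in> C1 U (Der_pos E)" unfolding v_def by (rule pr_upto_cochain_C1[OF uC q(1)])
  have Pv: "P p (v i j) = (if 1 \<le> p \<and> p < q then P p (u i j) else 0)" for p i j
    unfolding v_def pr_upto_cochain_def by (rule pr_pr_upto[OF C1_mem[OF uC] q(1)])
  have "cdif q (exp_cochain E U v) (exp_cochain E U u) (\<lambda>i j. P q (v i j) - P q (u i j))"
    by (rule cdif_exp[OF vC uC q]) (simp add: Pv)
  then have c: "cdif q (exp_cochain E U v) (exp_cochain E U u) (\<lambda>i j. - P q (u i j))"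
    by (simp add: Pv)
  have "mult_cobdry U (exp_cochain E U u) i j k = endo_id E (U3 i j k)"
    using C1_tildeD(2)[OF u] by (simp add: Z1_G_iff)
  then have "P q (mult_cobdry U (exp_cochain E U v) i j k) =
      endo_restrict (U3 i j k) (- P q (u i j) + - P q (u j k) + - P q (u k i))"
    using dif_top[OF mult_cobdry_dif[OF c q, of i j k]] pr_id[of q "U3 i j k"] q by simp
  also have "\<dots> = - d1 U (pr_cochain E (2 * q) u) i j k"
    unfolding d1_C1[OF pr_cochain_C1[OF uC q(1)]] unfolding endo_restrict_uminus[symmetric] pr_cochain_def
    by (rule arg_cong[where f="endo_restrict _"]) simp
  finally show ?thesis unfolding R_def v_def .
qed

text \<open>The coboundary c of exp(u) has degree-2 part d u = 0. The failure of the Leibniz rule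
  for the parts of c of degrees 4 and 6 is a sum of products of parts of degrees 2 and 2,
  respectively 2 and 4; each has a factor of degree 2 and vanishes.\<close>

lemma Z1_tilde_eq: "Z1_tilde E U = Z1 U (D 1)"
proof -
  have "R E U 4 u \<in> C2 U (Der_deg E 4) \<and> R E U 6 u \<in> C2 U (Der_deg E 6)" if u: "u \<in> Z1 U (D 1)" for u
  proof -
    have uC: "u \<in> C1 U (D 1)" and du: "d1 U u = 0" using u by (simp_all add: Z1_def)
    have up: "u \<in> C1 U (Der_pos E)"
    proof (rule C1I)
      show "u i j \<in> Der_pos E (U2 i j)" for i j by (rule Der_pos_Der_deg[OF C1_mem[OF uC]]) simp
      show "u j i = - u i j" for i j by (rule C1_alt[OF uC])
    qed
    have Pu: "P p (u i j) = (if p = 1 then u i j else 0)" for p i j by (rule pr_Der_deg[OF C1_mem[OF uC]])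
    \<comment> \<open>A cochain concentrated in degree 2 equals its truncations, so R_4 and R_6 are
      components of one and the same coboundary.\<close>
    have upto: "pr_upto_cochain E (2 * q - 2) u = u" if "2 \<le> q" for q
    proof (rule ext, rule ext)
      fix i j
      have "pr_upto E (2 * q - 2) (u i j) = (\<Sum>k\<in>{1..<q}. if k = 1 then u i j else 0)"
        using that by (subst pr_upto_eq) (simp_all add: Pu)
      then show "pr_upto_cochain E (2 * q - 2) u i j = u i j"
        using that by (simp add: pr_upto_cochain_def sum.delta)
    qed
    define c where "c = mult_cobdry U (exp_cochain E U u)"
    have G: "c i j k \<in> G E (U3 i j k)" for i j k
      unfolding c_def by (rule mult_cobdry_G[OF exp_cochain_C1_G[OF up]])
    have c1: "P 1 (c i j k) = 0" for i j k
    proof -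
      have zC: "0 \<in> C1 U (Der_pos E)" by (rule C1I) (simp_all add: Der_pos_zero)
      have e0: "exp_cochain E U 0 = id_cochain"
        unfolding exp_cochain_def id_cochain_def by (simp add: endo_exp_zero)
      have cd: "cdif 1 (exp_cochain E U u) id_cochain u"
        using cdif_exp[OF up zC, of 1] unfolding e0 by (simp add: Pu[of 1, simplified])
      have "endo_restrict (U3 i j k) (u i j + u j k + u k i) = 0"
        unfolding d1_C1[OF uC, symmetric] du by simp
      then show ?thesis
        using dif_top[OF mult_cobdry_dif[OF cd, of i j k]] id_cochain_Z1_G pr_id[of 1 "U3 i j k"]
        by (simp add: c_def Z1_G_iff)
    qed
    have id0: "P p (endo_id E V) = 0" if "1 \<le> p" for p V using pr_id[of p V] that by simp
    have d: "P q (c i j k) \<in> D q (U3 i j k)" if "q = 2 \<or> q = 3" for q i j k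
    proof -
      have "P q (c i j k) - P q (endo_id E (U3 i j k)) \<in> D q (U3 i j k)"
      \<comment> \<open>The comparison is with the identity. In degree 6 the parts of degree 4 may
        differ, so only equality of the cross terms is available, not of all lower
        components.\<close>
      proof (rule pr_diff_derivation[OF G G_id])
        fix p W s t assume "0 < p" "p < q"
        then have "p = 1 \<or> q - p = 1" using that by linarith
        then have "P p (c i j k) = 0 \<or> P (q - p) (c i j k) = 0" using c1 by metis
        moreover have "P p (endo_id E (U3 i j k)) = 0" using id0[of p] \<open>0 < p\<close> by simp
        ultimately show "sec_wedge (P p (c i j k) W s) (P (q - p) (c i j k) W t) =
            sec_wedge (P p (endo_id E (U3 i j k)) W s) (P (q - p) (endo_id E (U3 i j k)) W t)" by auto
      qed (use that in auto)
      then show ?thesis using id0[of q "U3 i j k"] that by auto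
    qed
    have "R E U 4 u = (\<lambda>i j k. P 2 (c i j k))" "R E U 6 u = (\<lambda>i j k. P 3 (c i j k))"
      using upto[of 2] upto[of 3] by (simp_all add: R_def c_def)
    then show ?thesis using d[of 2] d[of 3] by (simp add: C2_def)
  qed
  then show ?thesis by (auto simp: Z1_tilde_def)
qed

text \<open>The trivial cocycle serves as base point: lifting \<open>z\<close> over it gives a
  multiplicative cocycle whose lowest component is \<open>z\<close>, and its logarithm has the same
  one.\<close>

lemma exp_cochain_lift:
  assumes z: "z \<in> Z1 U (D 1)"
  obtains u where "u \<in> C1_tilde E U" "pr_cochain E 2 u = z"
proof -
  obtain n where n: "n \<in> Z1_G E U" "cdif 1 n id_cochain z"
    by (rule lift[OF id_cochain_Z1_G z]) auto
  obtain u where u: "u \<in> C1 U (Der_pos E)" and nu: "n = exp_cochain E U u" by (rule C1_G_exp[OF Z1_G_C1_G[OF n(1)]])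
  have "pr_cochain E 2 u i j = z i j" for i j
    using cdif_top[OF n(2), of i j] pr_id_cochain[of 1 i j] pr_exp(2)[OF C1_mem[OF u, of i j]]
    by (simp add: nu exp_cochain_def pr_cochain_def)
  then have "pr_cochain E 2 u = z" by (intro ext[of "pr_cochain E 2 u" z] ext[of "pr_cochain E 2 u _" "z _"])
  then show thesis using that[of u] u n(1) by (simp add: C1_tilde_def nu)
qed

lemma pr_cochain_Z1:
  assumes u: "u \<in> C1_tilde E U"
  shows "pr_cochain E 2 u \<in> Z1 U (D 1)"
proof -
  note uC = C1_tildeD(1)[OF u]
  have zC: "0 \<in> C1 U (Der_pos E)" by (rule C1I) (simp_all add: Der_pos_zero)
  have e0: "exp_cochain E U 0 = id_cochain"
    unfolding exp_cochain_def id_cochain_def by (simp add: endo_exp_zero)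
  have "cdif 1 (exp_cochain E U u) id_cochain (pr_cochain E 2 u)"
    using cdif_exp[OF uC zC, of 1] unfolding e0 pr_cochain_def by simp
  then show ?thesis by (rule cdif_Z1[OF C1_tildeD(2)[OF u] id_cochain_Z1_G]) auto
qed

lemma C1_tilde_pr_2_iff: "(\<exists>u\<in>C1_tilde E U. pr_cochain E 2 u = u2) \<longleftrightarrow> u2 \<in> Z1_tilde E U"
  unfolding Z1_tilde_eq using exp_cochain_lift pr_cochain_Z1 by blast

end

section \<open>The action of 0-cochains\<close>

lemma d0_add: "d0 U (v + w) = d0 U v + d0 U w" for v w :: "'i \<Rightarrow> ('a, 'e) endo"
  by (intro ext) (simp add: d0_def endo_restrict_def)

lemma d0_uminus: "d0 U (- v) = - d0 U v" for v :: "'i \<Rightarrow> ('a, 'e) endo"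
  by (intro ext) (simp add: d0_def endo_restrict_def)

lemma d0_zero: "d0 U 0 = (0 :: 'i \<Rightarrow> 'i \<Rightarrow> ('a, 'e) endo)"
  by (intro ext) (simp add: d0_def endo_restrict_def)

lemma H1_class_eq_iff:
  fixes A :: "'a set \<Rightarrow> ('a, 'e) endo set"
  assumes zero: "\<And>V. 0 \<in> A V" and add: "\<And>V x y. x \<in> A V \<Longrightarrow> y \<in> A V \<Longrightarrow> x + y \<in> A V"
    and uminus: "\<And>V x. x \<in> A V \<Longrightarrow> - x \<in> A V"
  shows "H1_class U A z = H1_class U A z' \<longleftrightarrow> (\<exists>w\<in>C0 U A. z' = z + d0 U w)"
proof
  assume "H1_class U A z = H1_class U A z'"
  moreover have "z' \<in> H1_class U A z'"
  proof -
    have "0 \<in> B1 U A"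
      unfolding B1_def C0_def by (rule image_eqI[of _ _ 0]) (simp_all add: d0_zero zero)
    then show ?thesis unfolding H1_class_def by force
  qed
  ultimately show "\<exists>w\<in>C0 U A. z' = z + d0 U w" unfolding H1_class_def B1_def by auto
next
  have sub: "H1_class U A z' \<subseteq> H1_class U A z" if "w \<in> C0 U A" "z' = z + d0 U w" for w z z'
  proof
    fix y assume "y \<in> H1_class U A z'"
    then obtain w' where w': "w' \<in> C0 U A" "y = z' + d0 U w'" unfolding H1_class_def B1_def by auto
    have "w + w' \<in> C0 U A" using that(1) w'(1) by (simp add: C0_def add)
    moreover have "y = z + d0 U (w + w')" by (simp only: w' that d0_add add.assoc)
    ultimately show "y \<in> H1_class U A z" unfolding H1_class_def B1_def by blast
  qed
  assume "\<exists>w\<in>C0 U A. z' = z + d0 U w"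
  then obtain w where w: "w \<in> C0 U A" "z' = z + d0 U w" by blast
  have "- w \<in> C0 U A" using w(1) by (simp add: C0_def uminus)
  moreover have "z = z' + d0 U (- w)" by (simp only: w d0_uminus add.assoc add.right_inverse add_0_right)
  ultimately show "H1_class U A z = H1_class U A z'" using sub[OF w] sub[of "- w" z z'] by blast
qed

lemma orbit_iff: "g' \<in> orbit E U g \<longleftrightarrow> (\<exists>v\<in>C0 U (Der_pos E). g' = act E U v g)"
  unfolding orbit_def by blast

context low_rank_cover
begin

lemma H1_class_D:
  "H1_class U (D q) z = H1_class U (D q) z' \<longleftrightarrow> (\<exists>w\<in>C0 U (D q). z' = z + d0 U w)"
  by (rule H1_class_eq_iff) (rule Der_deg_zero Der_deg_add Der_deg_uminus; assumption)+

lemma H1_class_Der_pos: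
  "H1_class U (Der_pos E) z = H1_class U (Der_pos E) z' \<longleftrightarrow> (\<exists>w\<in>C0 U (Der_pos E). z' = z + d0 U w)"
  by (rule H1_class_eq_iff) (rule Der_pos_zero Der_pos_add Der_pos_uminus; assumption)+

lemma C0_mem: "v \<in> C0 U A \<Longrightarrow> v i \<in> A (U i)"
  unfolding C0_def by blast

lemma C0I: "(\<And>i. v i \<in> A (U i)) \<Longrightarrow> v \<in> C0 U A"
  unfolding C0_def by blast

lemma C0_D_Der_pos: "v \<in> C0 U (D q) \<Longrightarrow> 1 \<le> q \<Longrightarrow> v \<in> C0 U (Der_pos E)"
  by (rule C0I) (rule Der_pos_Der_deg[OF C0_mem])

definition eps :: "'a set \<Rightarrow> 'i \<Rightarrow> ('a, 'e) endo \<Rightarrow> ('a, 'e) endo" where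
  "eps Q i x = endo_restrict Q (endo_exp E (U i) x)"

lemma eps_G: "x \<in> Der_pos E (U i) \<Longrightarrow> Q \<subseteq> U i \<Longrightarrow> eps Q i x \<in> G E Q"
  unfolding eps_def by (rule G_restrict[OF endo_exp_G])

lemma eps_inverse:
  assumes "x \<in> Der_pos E (U i)" "Q \<subseteq> U i"
  shows "eps Q i x \<bullet>\<bullet> eps Q i (- x) = endo_id E Q" "eps Q i (- x) \<bullet>\<bullet> eps Q i x = endo_id E Q"
  unfolding eps_def endo_restrict_comp[symmetric] endo_exp_inverse[OF assms(1)] endo_exp_inverse'[OF assms(1)]
  by (rule endo_restrict_id[OF assms(2)])+

lemma G_cancel: "a \<bullet>\<bullet> b = endo_id E Q \<Longrightarrow> c \<in> G E Q \<Longrightarrow> a \<bullet>\<bullet> (b \<bullet>\<bullet> c) = c"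
  unfolding endo_comp_assoc[symmetric] using endo_id_left[OF G_End] by simp

lemma act_eq:
  assumes "g \<in> C1_G"
  shows "act E U v g i j = eps (U2 i j) i (v i) \<bullet>\<bullet> g i j \<bullet>\<bullet> eps (U2 i j) j (- v j)"
  unfolding act_def endo_restrict_comp eps_def endo_restrict_self[OF G_End[OF C1_G_G[OF assms]]] ..

lemma restrict_act:
  assumes "Q \<subseteq> U2 i j"
  shows "endo_restrict Q (act E U v g i j) = eps Q i (v i) \<bullet>\<bullet> endo_restrict Q (g i j) \<bullet>\<bullet> eps Q j (- v j)"
  unfolding act_def endo_restrict_restrict[OF assms] endo_restrict_comp eps_def ..

lemma act_C1_G:
  assumes v: "v \<in> C0 U (Der_pos E)" and g: "g \<in> C1_G"
  shows "act E U v g \<in> C1_G"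
  unfolding C1_G_def
proof (intro CollectI allI conjI)
  fix i j
  define Q where "Q = U2 i j"
  have Q: "Q \<subseteq> U i" "Q \<subseteq> U j" "U2 j i = Q" by (auto simp: Q_def)
  note V = C0_mem[OF v]
  have eG: "eps Q i (v i) \<in> G E Q" "eps Q i (- v i) \<in> G E Q" "eps Q j (v j) \<in> G E Q" "eps Q j (- v j) \<in> G E Q"
    by (rule eps_G[OF _ Q(1)] eps_G[OF _ Q(2)]; rule V Der_pos_uminus[OF V])+
  have gG: "g i j \<in> G E Q" "g j i \<in> G E Q" and inv: "g i j \<bullet>\<bullet> g j i = endo_id E Q"
    using C1_G_G[OF g, of i j] C1_G_G[OF g, of j i] C1_G_inverse[OF g, of i j] by (simp_all only: Q(3) Q_def[symmetric])
  have a: "act E U v g i j = eps Q i (v i) \<bullet>\<bullet> g i j \<bullet>\<bullet> eps Q j (- v j)"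
    "act E U v g j i = eps Q j (v j) \<bullet>\<bullet> g j i \<bullet>\<bullet> eps Q i (- v i)"
    unfolding act_eq[OF g] Q(3) unfolding Q_def by (rule refl)+
  show "act E U v g i j \<in> G E (U2 i j)"
    unfolding a Q_def[symmetric] by (intro G_comp eG gG)
  show "act E U v g i j \<bullet>\<bullet> act E U v g j i = endo_id E (U2 i j)"
    unfolding a Q_def[symmetric] endo_comp_assoc
    by (simp only: G_cancel[OF eps_inverse(2)[OF V Q(2)]] G_cancel[OF inv] G_comp eG gG eps_inverse(1)[OF V Q(1)])
qed

text \<open>The exponentials of v_j and v_k cancel between neighbouring factors, and the coboundary
  is merely conjugated by exp(v_i).\<close>

lemma act_Z1_G:
  assumes v: "v \<in> C0 U (Der_pos E)" and g: "g \<in> Z1_G E U"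
  shows "act E U v g \<in> Z1_G E U"
  unfolding Z1_G_iff
proof (intro conjI allI)
  show "act E U v g \<in> C1_G" by (rule act_C1_G[OF v Z1_G_C1_G[OF g]])
  fix i j k
  define Q where "Q = U3 i j k"
  have Q: "Q \<subseteq> U i" "Q \<subseteq> U j" "Q \<subseteq> U k" "Q \<subseteq> U2 i j" "Q \<subseteq> U2 j k" "Q \<subseteq> U2 k i" by (auto simp: Q_def)
  note V = C0_mem[OF v]
  have eG: "eps Q a (v a) \<in> G E Q" "eps Q a (- v a) \<in> G E Q" if "a \<in> {i, j, k}" for a
    using that Q(1-3) by (auto intro!: eps_G V Der_pos_uminus)
  define \<gamma> where "\<gamma> = (\<lambda>a b. endo_restrict Q (g a b))"
  have \<gamma>G: "\<gamma> i j \<in> G E Q" "\<gamma> j k \<in> G E Q" "\<gamma> k i \<in> G E Q"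
    unfolding \<gamma>_def using Q(4-6) G_restrict[OF C1_G_G[OF Z1_G_C1_G[OF g]]] by auto
  have c: "\<gamma> i j \<bullet>\<bullet> (\<gamma> j k \<bullet>\<bullet> \<gamma> k i) = endo_id E Q"
    using g unfolding Z1_G_iff mult_cobdry_comp \<gamma>_def Q_def endo_comp_assoc by blast
  have c': "\<gamma> i j \<bullet>\<bullet> (\<gamma> j k \<bullet>\<bullet> (\<gamma> k i \<bullet>\<bullet> \<phi>)) = \<phi>" if "\<phi> \<in> G E Q" for \<phi>
    using G_cancel[OF c[unfolded endo_comp_assoc[symmetric]] that] endo_id_left[OF G_End[OF that]] c
    by (metis endo_comp_assoc)
  have "mult_cobdry U (act E U v g) i j k =
      (eps Q i (v i) \<bullet>\<bullet> \<gamma> i j \<bullet>\<bullet> eps Q j (- v j)) \<bullet>\<bullet> (eps Q j (v j) \<bullet>\<bullet> \<gamma> j k \<bullet>\<bullet> eps Q k (- v k)) \<bullet>\<bullet>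
      (eps Q k (v k) \<bullet>\<bullet> \<gamma> k i \<bullet>\<bullet> eps Q i (- v i))"
    unfolding mult_cobdry_comp Q_def[symmetric] restrict_act[OF Q(4)] restrict_act[OF Q(5)] restrict_act[OF Q(6)] \<gamma>_def ..
  also have "\<dots> = endo_id E Q"
    unfolding endo_comp_assoc
    by (simp only: G_cancel[OF eps_inverse(2)[OF V Q(2)]] G_cancel[OF eps_inverse(2)[OF V Q(3)]] c'
        G_comp eG \<gamma>G insertI1 insertI2 eps_inverse(1)[OF V Q(1)])
  finally show "mult_cobdry U (act E U v g) i j k = endo_id E (U3 i j k)" by (simp only: Q_def)
qed

lemma act_zero: "g \<in> C1_G \<Longrightarrow> act E U 0 g = g"
proof (rule ext, rule ext)
  fix i j assume g: "g \<in> C1_G"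
  have e: "eps (U2 i j) i 0 = endo_id E (U2 i j)" "eps (U2 i j) j (- 0) = endo_id E (U2 i j)"
    unfolding eps_def by (simp_all add: endo_exp_zero endo_restrict_id)
  have "(0 :: 'i \<Rightarrow> ('a, 'e) endo) k = 0" for k by (rule zero_fun_apply)
  then show "act E U 0 g i j = g i j"
    unfolding act_eq[OF g] using e endo_id_left[OF G_End[OF C1_G_G[OF g, of i j]]] endo_id_right[OF G_End[OF C1_G_G[OF g, of i j]]]
    by (simp only:)
qed

text \<open>The logarithm of exp(v_i) exp(w_i) exists because \<open>G\<close> is closed under
  composition and every element of \<open>G\<close> is an exponential; no explicit formula for it is
  required.\<close>

lemma act_comp:
  assumes v: "v \<in> C0 U (Der_pos E)" and w: "w \<in> C0 U (Der_pos E)"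
  obtains x where "x \<in> C0 U (Der_pos E)" "\<And>g. act E U v (act E U w g) = act E U x g"
proof -
  note V = C0_mem[OF v] and W = C0_mem[OF w]
  have "\<exists>x. x \<in> Der_pos E (U i) \<and> endo_exp E (U i) x = endo_exp E (U i) (v i) \<bullet>\<bullet> endo_exp E (U i) (w i)" for i
    by (rule G_obtain_exp[OF G_comp[OF endo_exp_G[OF V] endo_exp_G[OF W]]]) blast
  then obtain x where x: "\<And>i. x i \<in> Der_pos E (U i)"
    and e: "\<And>i. endo_exp E (U i) (x i) = endo_exp E (U i) (v i) \<bullet>\<bullet> endo_exp E (U i) (w i)" by metis
  \<comment> \<open>Inverses reverse the order of the factors, as the right-hand side of the action
    demands.\<close>
  have e': "endo_exp E (U i) (- x i) = endo_exp E (U i) (- w i) \<bullet>\<bullet> endo_exp E (U i) (- v i)" for i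
  proof -
    define k where "k = endo_exp E (U i) (- w i) \<bullet>\<bullet> endo_exp E (U i) (- v i)"
    have kG: "k \<in> G E (U i)" unfolding k_def by (intro G_comp endo_exp_G Der_pos_uminus V W)
    have "endo_exp E (U i) (x i) \<bullet>\<bullet> k = endo_id E (U i)"
      unfolding e k_def endo_comp_assoc
      by (simp only: G_cancel[OF endo_exp_inverse[OF W]] endo_exp_G[OF Der_pos_uminus[OF V]] endo_exp_inverse[OF V])
    then have "endo_exp E (U i) (- x i) = endo_exp E (U i) (- x i) \<bullet>\<bullet> (endo_exp E (U i) (x i) \<bullet>\<bullet> k)"
      using endo_id_right[OF G_End[OF endo_exp_G[OF Der_pos_uminus[OF x]]]] by simp
    also have "\<dots> = k" by (rule G_cancel[OF endo_exp_inverse'[OF x] kG])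
    finally show ?thesis unfolding k_def .
  qed
  have "act E U v (act E U w g) = act E U x g" for g
  proof (rule ext, rule ext)
    fix i j
    show "act E U v (act E U w g) i j = act E U x g i j"
      unfolding act_def e e' endo_restrict_comp endo_restrict_restrict[OF subset_refl] endo_comp_assoc ..
  qed
  moreover have "x \<in> C0 U (Der_pos E)" using x by (rule C0I)
  ultimately show thesis using that by blast
qed

lemma C0_uminus: "v \<in> C0 U (Der_pos E) \<Longrightarrow> - v \<in> C0 U (Der_pos E)"
  by (simp add: C0_def Der_pos_uminus)

lemma act_uminus:
  assumes v: "v \<in> C0 U (Der_pos E)" and g: "g \<in> C1_G"
  shows "act E U (- v) (act E U v g) = g"
proof (rule ext, rule ext)
  fix i j
  have Q: "U2 i j \<subseteq> U i" "U2 i j \<subseteq> U j" by auto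
  note V = C0_mem[OF v] and gG = C1_G_G[OF g, of i j]
  have n: "(- v) k = - v k" for k by (intro ext) simp
  note c1 = G_cancel[OF eps_inverse(2)[OF V Q(1)]]
  show "act E U (- v) (act E U v g) i j = g i j"
    unfolding act_eq[OF act_C1_G[OF v g]] act_eq[OF g] n minus_minus endo_comp_assoc
    by (simp only: c1 G_comp gG eps_G[OF V Q(2)] eps_G[OF Der_pos_uminus[OF V] Q(2)]
        eps_inverse(2)[OF V Q(2)] endo_id_right[OF G_End[OF gG]])
qed

lemma orbit_refl: "g \<in> C1_G \<Longrightarrow> g \<in> orbit E U g"
  unfolding orbit_iff using act_zero[of g] C0I[of 0 "Der_pos E"] Der_pos_zero by force

lemma orbit_trans: "g' \<in> orbit E U g \<Longrightarrow> g'' \<in> orbit E U g' \<Longrightarrow> g'' \<in> orbit E U g"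
  unfolding orbit_iff by (metis act_comp)

lemma orbit_sym: "g \<in> C1_G \<Longrightarrow> g' \<in> orbit E U g \<Longrightarrow> g \<in> orbit E U g'"
  unfolding orbit_iff by (metis act_uminus C0_uminus)

lemma orbit_eq_iff:
  assumes "g \<in> C1_G" "g' \<in> C1_G"
  shows "orbit E U g = orbit E U g' \<longleftrightarrow> g' \<in> orbit E U g"
  using orbit_refl assms orbit_trans orbit_sym by (metis subsetI subset_antisym)

text \<open>Multiplication by common factors on either side contributes discrepancy 0. So a common
  0-cochain moves two cochains without changing their difference.\<close>

lemma act_cdif:
  assumes v: "v \<in> C0 U (Der_pos E)" and g: "g \<in> C1_G" and h: "h \<in> C1_G" and x: "cdif q g h x" and q: "1 \<le> q" "q \<le> 3"
  shows "cdif q (act E U v g) (act E U v h) x"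
  unfolding cdif_def act_eq[OF g] act_eq[OF h]
proof (intro allI)
  fix i j
  have Q: "U2 i j \<subseteq> U i" "U2 i j \<subseteq> U j" by auto
  note V = C0_mem[OF v]
  show "dif (U2 i j) q (eps (U2 i j) i (v i) \<bullet>\<bullet> g i j \<bullet>\<bullet> eps (U2 i j) j (- v j))
      (eps (U2 i j) i (v i) \<bullet>\<bullet> h i j \<bullet>\<bullet> eps (U2 i j) j (- v j)) (x i j)"
    using dif_comp[OF dif_comp[OF dif_refl[OF eps_G[OF V Q(1)]] x[unfolded cdif_def, rule_format] q]
      dif_refl[OF eps_G[OF Der_pos_uminus[OF V] Q(2)]] q] by simp
qed

lemma eps_dif:
  assumes x: "x \<in> Der_pos E (U i)" and Q: "Q \<subseteq> U i" and q: "1 \<le> q" "q \<le> 3"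
    and low: "\<And>p. 1 \<le> p \<Longrightarrow> p < q \<Longrightarrow> P p x = 0"
  shows "dif Q q (eps Q i x) (endo_id E Q) (endo_restrict Q (P q x))"
proof -
  have "dif (U i) q (endo_exp E (U i) x) (endo_exp E (U i) 0) (P q x - P q 0)"
    by (rule dif_exp[OF x Der_pos_zero q]) (simp add: low)
  then have "dif (U i) q (endo_exp E (U i) x) (endo_id E (U i)) (P q x)" by (simp add: endo_exp_zero)
  from dif_restrict[OF this Q] show ?thesis unfolding eps_def endo_restrict_id[OF Q] .
qed

text \<open>The left factor contributes the lowest component of v_i and the right one that of -v_j,
  while \<open>d0\<close> is formed as v_j - v_i; hence the minus sign.\<close>

lemma act_cdif_self:
  assumes v: "v \<in> C0 U (Der_pos E)" and g: "g \<in> C1_G" and q: "1 \<le> q" "q \<le> 3"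
    and low: "\<And>i p. 1 \<le> p \<Longrightarrow> p < q \<Longrightarrow> P p (v i) = 0"
  shows "cdif q (act E U v g) g (- d0 U (\<lambda>i. P q (v i)))"
  unfolding cdif_def act_eq[OF g]
proof (intro allI)
  fix i j
  have Q: "U2 i j \<subseteq> U i" "U2 i j \<subseteq> U j" by auto
  note V = C0_mem[OF v] and gG = C1_G_G[OF g, of i j]
  have low': "P p (- v j) = 0" if "1 \<le> p" "p < q" for p
    unfolding pr_uminus low[OF that] by simp
  have "dif (U2 i j) q (eps (U2 i j) i (v i) \<bullet>\<bullet> g i j \<bullet>\<bullet> eps (U2 i j) j (- v j))
      (endo_id E (U2 i j) \<bullet>\<bullet> g i j \<bullet>\<bullet> endo_id E (U2 i j))
      (endo_restrict (U2 i j) (P q (v i)) + 0 + endo_restrict (U2 i j) (P q (- v j)))"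
    by (intro dif_comp q dif_refl gG eps_dif V Der_pos_uminus Q low low')
  moreover have "endo_restrict (U2 i j) (P q (v i)) + 0 + endo_restrict (U2 i j) (P q (- v j)) =
      (- d0 U (\<lambda>i. P q (v i))) i j"
  proof -
    have n: "(- y) i j = - y i j" for y :: "'i \<Rightarrow> 'i \<Rightarrow> ('a, 'e) endo" by (intro ext) simp
    show ?thesis
      unfolding n d0_def pr_uminus endo_restrict_uminus[symmetric] add_0_right endo_restrict_add[symmetric]
      by (rule arg_cong[where f="endo_restrict _"]) simp
  qed
  ultimately show "dif (U2 i j) q (eps (U2 i j) i (v i) \<bullet>\<bullet> g i j \<bullet>\<bullet> eps (U2 i j) j (- v j)) (g i j)
      ((- d0 U (\<lambda>i. P q (v i))) i j)"
    by (simp only: endo_id_left[OF G_End[OF gG]] endo_id_right[OF G_End[OF gG]])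
qed

lemma pr_C0: "v \<in> C0 U (Der_pos E) \<Longrightarrow> 1 \<le> q \<Longrightarrow> (\<lambda>i. P q (v i)) \<in> C0 U (D q)"
  by (rule C0I) (rule pr_Der_pos[OF C0_mem])

lemma B1_Z1:
  assumes w: "w \<in> C0 U (D q)"
  shows "d0 U w \<in> Z1 U (D q)"
proof -
  note W = C0_mem[OF w]
  have "d0 U w \<in> C1 U (D q)"
  proof (rule C1I)
    fix i j
    have "endo_restrict (U2 i j) (w j) \<in> D q (U2 i j)" "endo_restrict (U2 i j) (w i) \<in> D q (U2 i j)"
      by (rule Der_deg_restrict[OF W]; blast)+
    then show "d0 U w i j \<in> D q (U2 i j)"
      unfolding d0_def endo_restrict_diff by (rule Der_deg_diff)
    show "d0 U w j i = - d0 U w i j"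
      unfolding d0_def endo_restrict_uminus[symmetric] Int_commute[of "U j"]
      by (rule arg_cong[where f="endo_restrict _"]) simp
  qed
  moreover have "d1 U (d0 U w) i j k = 0" for i j k
  proof -
    have Q: "U3 i j k \<subseteq> U2 i j" "U3 i j k \<subseteq> U2 j k" "U3 i j k \<subseteq> U2 i k" by auto
    have "d1 U (d0 U w) i j k = endo_restrict (U3 i j k) ((w k - w j) - (w k - w i) + (w j - w i))"
      unfolding d1_def d0_def endo_restrict_add endo_restrict_diff endo_restrict_restrict[OF Q(1)]
        endo_restrict_restrict[OF Q(2)] endo_restrict_restrict[OF Q(3)] ..
    also have "(w k - w j) - (w k - w i) + (w j - w i) = 0" by simp
    finally show ?thesis by simp
  qed
  then have "d1 U (d0 U w) = 0" by - (rule ext, rule ext, rule ext, simp only: zero_fun_apply)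
  ultimately show ?thesis by (simp add: Z1_def)
qed

lemma Z1_add:
  assumes x: "x \<in> Z1 U (D q)" and y: "y \<in> Z1 U (D q)"
  shows "x + y \<in> Z1 U (D q)"
proof -
  have xC: "x \<in> C1 U (D q)" and yC: "y \<in> C1 U (D q)" and d: "d1 U x = 0" "d1 U y = 0"
    using x y by (simp_all add: Z1_def)
  note p = cochain_add_apply[of x y]
  have C: "x + y \<in> C1 U (D q)"
  proof (rule C1I)
    show "(x + y) i j \<in> D q (U2 i j)" for i j unfolding p by (rule Der_deg_add[OF C1_mem[OF xC] C1_mem[OF yC]])
    show "(x + y) j i = - (x + y) i j" for i j
      unfolding p C1_alt[OF xC, of j i] C1_alt[OF yC, of j i] by (rule minus_add_distrib[symmetric])
  qed
  have "d1 U (x + y) = d1 U x + d1 U y"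
    by (intro ext) (simp add: d1_def endo_restrict_def)
  then show ?thesis using C d by (simp add: Z1_def)
qed

end

section \<open>The classification\<close>

lemma diff_diff_eq_if_eq_add_diff:
  fixes a b x y :: "'g::ab_group_add"
  assumes "a = a' + (x - y)"
  shows "a - b - x = a' - b - y"
  unfolding assms by (simp add: algebra_simps)

lemma eq_add_if_diff_eq_uminus:
  fixes a b c :: "'g::ab_group_add"
  assumes "a + - b = - c"
  shows "b = a + c"
proof -
  have "b = a - (a + - b)" by simp
  also have "\<dots> = a - (- c)" by (simp only: assms)
  finally show ?thesis by simp
qed

context low_rank_cover
begin

text \<open>The choice is made from the coset and not from \<open>z\<close>, so cohomologous
  cocycles get the same representative.\<close>

definition rep :: "nat \<Rightarrow> ('i \<Rightarrow> 'i \<Rightarrow> ('a, 'e) endo) \<Rightarrow> 'i \<Rightarrow> 'i \<Rightarrow> ('a, 'e) endo" where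
  "rep q z = (SOME y. y \<in> H1_class U (D q) z)"

text \<open>The sign fits the action: by \<open>act_cdif_self\<close>, acting with this 0-cochain
  subtracts \<open>z - rep q z\<close> and so turns a difference \<open>z\<close> into its
  representative.\<close>

definition bounding :: "nat \<Rightarrow> ('i \<Rightarrow> 'i \<Rightarrow> ('a, 'e) endo) \<Rightarrow> 'i \<Rightarrow> ('a, 'e) endo" where
  "bounding q z = (SOME v. v \<in> C0 U (D q) \<and> d0 U v = z - rep q z)"

text \<open>A choice of the cocycle provided by \<open>lift\<close>. Being a function of
  \<open>b\<close> and \<open>z\<close> alone, it gives equal results for equal bases and equal
  representatives.\<close>

definition translate ::
    "nat \<Rightarrow> ('i \<Rightarrow> 'i \<Rightarrow> ('a, 'e) endo) \<Rightarrow> ('i \<Rightarrow> 'i \<Rightarrow> ('a, 'e) endo) \<Rightarrow> 'i \<Rightarrow> 'i \<Rightarrow> ('a, 'e) endo" where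
  "translate q b z = (SOME n. n \<in> Z1_G E U \<and> cdif q n b z)"

text \<open>Step \<open>n\<close> of the normalisation of a cocycle \<open>g\<close>: the first component is equivalent to \<open>g\<close> and
  agrees up to degree \<open>2n\<close> with the second, which depends only on the classes met so far.\<close>

primrec normalise ::
    "nat \<Rightarrow> ('i \<Rightarrow> 'i \<Rightarrow> ('a, 'e) endo) \<Rightarrow> ('i \<Rightarrow> 'i \<Rightarrow> ('a, 'e) endo) \<times> ('i \<Rightarrow> 'i \<Rightarrow> ('a, 'e) endo)" where
  "normalise 0 g = (g, id_cochain)"
| "normalise (Suc n) g =
     (let h = fst (normalise n g); b = snd (normalise n g);
          z = (\<lambda>i j. P (Suc n) (h i j) - P (Suc n) (b i j))
      in (act E U (bounding (Suc n) z) h, translate (Suc n) b (rep (Suc n) z)))"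

abbreviation "H n g \<equiv> fst (normalise n g)"
abbreviation "B n g \<equiv> snd (normalise n g)"

text \<open>The index is shifted: \<open>zeta n\<close> has degree 2(n + 1) and is the difference
  treated in passing from step \<open>n\<close> to step \<open>Suc n\<close>.\<close>

definition zeta :: "nat \<Rightarrow> ('i \<Rightarrow> 'i \<Rightarrow> ('a, 'e) endo) \<Rightarrow> 'i \<Rightarrow> 'i \<Rightarrow> ('a, 'e) endo" where
  "zeta n g = (\<lambda>i j. P (Suc n) (H n g i j) - P (Suc n) (B n g i j))"

lemma H_Suc: "H (Suc n) g = act E U (bounding (Suc n) (zeta n g)) (H n g)"
  by (simp add: zeta_def Let_def)

lemma B_Suc: "B (Suc n) g = translate (Suc n) (B n g) (rep (Suc n) (zeta n g))"
  by (simp add: zeta_def Let_def)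

declare normalise.simps(2) [simp del]

lemma rep_in_class: "\<exists>w\<in>C0 U (D q). rep q z = z + d0 U w"
proof -
  have "H1_class U (D q) z = H1_class U (D q) z" ..
  then have "z + d0 U 0 \<in> H1_class U (D q) z"
    unfolding H1_class_def B1_def using C0I[of 0 "D q"] Der_deg_zero by force
  then have "rep q z \<in> H1_class U (D q) z"
    unfolding rep_def by (rule someI[of "\<lambda>y. y \<in> H1_class U (D q) z"])
  then show ?thesis unfolding H1_class_def B1_def by auto
qed

lemma rep_class: "H1_class U (D q) (rep q z) = H1_class U (D q) z"
proof -
  have "H1_class U (D q) z = H1_class U (D q) (rep q z)"
    unfolding H1_class_D by (rule rep_in_class)
  then show ?thesis ..
qed

lemma rep_cong: "H1_class U (D q) z = H1_class U (D q) z' \<Longrightarrow> rep q z = rep q z'"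
  by (simp add: rep_def)

lemma rep_Z1: "z \<in> Z1 U (D q) \<Longrightarrow> rep q z \<in> Z1 U (D q)"
  using rep_in_class[of q z] Z1_add B1_Z1 by metis

lemma bounding: "bounding q z \<in> C0 U (D q)" "d0 U (bounding q z) = z - rep q z"
proof -
  obtain w where w: "w \<in> C0 U (D q)" "rep q z = z + d0 U w" using rep_in_class by blast
  have "- w \<in> C0 U (D q)" using w(1) by (simp add: C0_def Der_deg_uminus)
  moreover have "d0 U (- w) = z - rep q z"
    unfolding w(2) d0_uminus minus_diff_eq[of "z + d0 U w" z, symmetric] add_diff_cancel_left' ..
  ultimately have "\<exists>v. v \<in> C0 U (D q) \<and> d0 U v = z - rep q z" by blast
  from someI_ex[OF this] show "bounding q z \<in> C0 U (D q)" "d0 U (bounding q z) = z - rep q z"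
    unfolding bounding_def by blast+
qed

lemma translate:
  assumes "b \<in> Z1_G E U" "z \<in> Z1 U (D q)" "1 \<le> q" "q \<le> 3"
  shows "translate q b z \<in> Z1_G E U" "cdif q (translate q b z) b z"
proof -
  obtain n where "n \<in> Z1_G E U" "cdif q n b z" by (rule lift[OF assms])
  then have "\<exists>n. n \<in> Z1_G E U \<and> cdif q n b z" by blast
  from someI_ex[OF this] show "translate q b z \<in> Z1_G E U" "cdif q (translate q b z) b z"
    unfolding translate_def by blast+
qed

lemma cdif_0: "g \<in> C1_G \<Longrightarrow> h \<in> C1_G \<Longrightarrow> cdif 0 g h 0"
  by (simp add: cdif_def dif_def C1_G_G) (metis C1_G_G mult_0_right pr_0_G)

lemma cdif_zeta:
  assumes "cdif n (H n g) (B n g) 0"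
  shows "cdif (Suc n) (H n g) (B n g) (zeta n g)"
  unfolding zeta_def by (rule cdif_Suc[OF assms])

text \<open>In each step the acting 0-cochain reduces the difference to the representative of its
  class, and the base is translated by that same representative. Agreement thus extends by one
  degree.\<close>

lemma normalise_Z1:
  assumes g: "g \<in> Z1_G E U" and n: "n \<le> 3"
  shows "H n g \<in> Z1_G E U \<and> B n g \<in> Z1_G E U \<and> H n g \<in> orbit E U g \<and> cdif n (H n g) (B n g) 0"
  using n
proof (induction n)
  case 0
  show ?case
    using g id_cochain_Z1_G orbit_refl[OF Z1_G_C1_G[OF g]] cdif_0[OF Z1_G_C1_G Z1_G_C1_G] by simp
next
  case (Suc n)
  then have IH: "H n g \<in> Z1_G E U" "B n g \<in> Z1_G E U" "H n g \<in> orbit E U g" "cdif n (H n g) (B n g) 0" by auto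
  have q: "1 \<le> Suc n" "Suc n \<le> 3" using Suc.prems by auto
  define v where "v = bounding (Suc n) (zeta n g)"
  have vD: "v \<in> C0 U (D (Suc n))" and dv: "d0 U v = zeta n g - rep (Suc n) (zeta n g)"
    unfolding v_def by (rule bounding)+
  have v: "v \<in> C0 U (Der_pos E)" by (rule C0_D_Der_pos[OF vD q(1)])
  have z: "zeta n g \<in> Z1 U (D (Suc n))" by (rule cdif_Z1[OF IH(1,2) cdif_zeta[OF IH(4)] q])
  note t = translate[OF IH(2) rep_Z1[OF z] q]
  have Pv: "P p (v i) = (if p = Suc n then v i else 0)" for p i by (rule pr_Der_deg[OF C0_mem[OF vD]])
  have "cdif (Suc n) (act E U v (H n g)) (H n g) (- d0 U (\<lambda>i. P (Suc n) (v i)))"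
    by (rule act_cdif_self[OF v Z1_G_C1_G[OF IH(1)] q]) (simp add: Pv)
  then have "cdif (Suc n) (act E U v (H n g)) (H n g) (- (zeta n g - rep (Suc n) (zeta n g)))"
    by (simp only: Pv simp_thms if_True dv)
  \<comment> \<open>The three differences add up to -(\<zeta> - rep) + \<zeta> - rep = 0.\<close>
  from cdif_trans[OF cdif_trans[OF this cdif_zeta[OF IH(4)]] cdif_sym[OF t(2)]]
  have "cdif (Suc n) (H (Suc n) g) (B (Suc n) g) 0"
    unfolding H_Suc B_Suc v_def[symmetric] by simp
  moreover have "act E U v (H n g) \<in> orbit E U g"
    using orbit_trans[OF IH(3)] v unfolding orbit_iff by blast
  ultimately show ?case
    using act_Z1_G[OF v IH(1)] t(1) by (simp add: H_Suc B_Suc v_def)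
qed

lemma zeta_Z1:
  assumes "g \<in> Z1_G E U" "n \<le> 2"
  shows "zeta n g \<in> Z1 U (D (Suc n))" "cdif (Suc n) (H n g) (B n g) (zeta n g)"
  using normalise_Z1[OF assms(1), of n] cdif_zeta[of n g] cdif_Z1[of "H n g" "B n g" "Suc n" "zeta n g"] assms(2) by auto

text \<open>Two cocycles that agree below degree 2p produce the same \<zeta> in every earlier step,
  so they are moved by the same 0-cochains and compared with the same bases; their difference in
  degree 2p survives unchanged. This is why \<open>D'\<close> depends on lower components
  only.\<close>

lemma normalise_cdif:
  assumes g: "g \<in> Z1_G E U" and g': "g' \<in> Z1_G E U" and x: "cdif p g g' x" and p: "p \<le> 3"
  shows "n < p \<Longrightarrow> B n g = B n g' \<and> cdif p (H n g) (H n g') x"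
proof (induction n)
  case 0
  then show ?case using x by simp
next
  case (Suc n)
  then have B: "B n g = B n g'" and c: "cdif p (H n g) (H n g') x" by auto
  have "P (Suc n) (H n g i j) = P (Suc n) (H n g' i j)" for i j
    using c Suc.prems unfolding cdif_def using dif_lower by blast
  then have z: "zeta n g = zeta n g'" unfolding zeta_def B by simp
  have n: "n \<le> 3" "1 \<le> p" using Suc.prems p by auto
  have v: "bounding (Suc n) (zeta n g) \<in> C0 U (Der_pos E)" by (rule C0_D_Der_pos[OF bounding(1)]) simp
  have "cdif p (act E U (bounding (Suc n) (zeta n g)) (H n g)) (act E U (bounding (Suc n) (zeta n g)) (H n g')) x"
    by (rule act_cdif[OF v _ _ c n(2) p]) (use normalise_Z1[OF g n(1)] normalise_Z1[OF g' n(1)] Z1_G_C1_G in auto)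
  then show ?case unfolding H_Suc B_Suc B z by simp
qed

lemma cdif_3_eq:
  assumes "cdif 3 g h 0"
  shows "g = h"
proof (rule ext, rule ext)
  fix i j
  have d: "dif (U2 i j) 3 (g i j) (h i j) 0" using assms unfolding cdif_def zero_fun_apply by blast
  show "g i j = h i j"
  proof (rule G_eqI[OF dif_G[OF d]])
    fix q :: nat assume "1 \<le> q" "q \<le> 3"
    then show "P q (g i j) = P q (h i j)"
      using dif_lower[OF d, of q] dif_top[OF d] by (cases "q = 3") auto
  qed
qed

text \<open>Equal classes yield equal representatives and so the same final base. Both cocycles are
  equivalent to cocycles that agree with it in degrees 2, 4 and 6, hence equal it.\<close>

lemma zeta_classes_determine_orbit:
  assumes g: "g \<in> Z1_G E U" and g': "g' \<in> Z1_G E U"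
    and eq: "\<And>n. n \<le> 2 \<Longrightarrow> H1_class U (D (Suc n)) (zeta n g) = H1_class U (D (Suc n)) (zeta n g')"
  shows "g' \<in> orbit E U g"
proof -
  have "B n g = B n g'" if "n \<le> 3" for n
    using that
  proof (induction n)
    case (Suc n)
    then show ?case unfolding B_Suc using rep_cong[OF eq[of n]] by simp
  qed simp
  then have B: "B 3 g = B 3 g'" by simp
  note a = normalise_Z1[OF g, of 3] normalise_Z1[OF g', of 3]
  have "cdif 3 (H 3 g) (H 3 g') 0"
    using cdif_trans[of 3 "H 3 g" "B 3 g" 0 "H 3 g'" 0] cdif_sym[of 3 "H 3 g'" "B 3 g'" 0] a by (simp add: B)
  then have "H 3 g = H 3 g'" by (rule cdif_3_eq)
  then show ?thesis
    using a orbit_sym[OF Z1_G_C1_G[OF g']] orbit_trans by (metis order_refl)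
qed

section \<open>Cohomology classes of sums, separated by degree\<close>

lemma pr_d0: "P q (d0 U v i j) = d0 U (\<lambda>i. P q (v i)) i j"
  by (simp only: d0_def pr_restrict pr_diff)

lemma Z1_C1: "z \<in> Z1 U A \<Longrightarrow> z \<in> C1 U A"
  by (simp add: Z1_def)

lemma pr_Z1: "z \<in> Z1 U (D q) \<Longrightarrow> P p (z i j) = (if p = q then z i j else 0)"
  by (rule pr_Der_deg[OF C1_mem[OF Z1_C1]])

lemma Der_pos_class_imp:
  assumes z: "z1 \<in> Z1 U (D 1)" "z2 \<in> Z1 U (D 2)" "z3 \<in> Z1 U (D 3)"
    and z': "z1' \<in> Z1 U (D 1)" "z2' \<in> Z1 U (D 2)" "z3' \<in> Z1 U (D 3)"
    and eq: "H1_class U (Der_pos E) (z1 + z2 + z3) = H1_class U (Der_pos E) (z1' + z2' + z3')"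
  shows "H1_class U (D 1) z1 = H1_class U (D 1) z1'" "H1_class U (D 2) z2 = H1_class U (D 2) z2'"
    "H1_class U (D 3) z3 = H1_class U (D 3) z3'"
proof -
  obtain v where v: "v \<in> C0 U (Der_pos E)" and e: "z1' + z2' + z3' = z1 + z2 + z3 + d0 U v"
    using eq H1_class_Der_pos by blast
  have e': "z1' i j + z2' i j + z3' i j = z1 i j + z2 i j + z3 i j + d0 U v i j" for i j
    using fun_cong[OF fun_cong[OF e, of i], of j] by (simp only: cochain_add_apply)
  have P: "P q (z1' i j) + P q (z2' i j) + P q (z3' i j) =
      P q (z1 i j) + P q (z2 i j) + P q (z3 i j) + d0 U (\<lambda>i. P q (v i)) i j" for q i j
    using arg_cong[OF e', of "P q" i j] by (simp only: pr_add pr_d0)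
  note p = pr_Z1[OF z(1)] pr_Z1[OF z(2)] pr_Z1[OF z(3)] pr_Z1[OF z'(1)] pr_Z1[OF z'(2)] pr_Z1[OF z'(3)]
  have ne: "(1::nat) \<noteq> 2" "(1::nat) \<noteq> 3" "(2::nat) \<noteq> 3" "(2::nat) \<noteq> 1" "(3::nat) \<noteq> 1" "(3::nat) \<noteq> 2"
    by simp_all
  have "z1' = z1 + d0 U (\<lambda>i. P 1 (v i))"
  proof (rule ext, rule ext)
    fix i j
    show "z1' i j = (z1 + d0 U (\<lambda>i. P 1 (v i))) i j"
      using P[of 1 i j] unfolding cochain_add_apply
      by (simp only: p ne if_True if_False add_0_left add_0_right simp_thms)
  qed
  moreover have "z2' = z2 + d0 U (\<lambda>i. P 2 (v i))"
  proof (rule ext, rule ext)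
    fix i j
    show "z2' i j = (z2 + d0 U (\<lambda>i. P 2 (v i))) i j"
      using P[of 2 i j] unfolding cochain_add_apply
      by (simp only: p ne if_True if_False add_0_left add_0_right simp_thms)
  qed
  moreover have "z3' = z3 + d0 U (\<lambda>i. P 3 (v i))"
  proof (rule ext, rule ext)
    fix i j
    show "z3' i j = (z3 + d0 U (\<lambda>i. P 3 (v i))) i j"
      using P[of 3 i j] unfolding cochain_add_apply
      by (simp only: p ne if_True if_False add_0_left add_0_right simp_thms)
  qed
  ultimately show "H1_class U (D 1) z1 = H1_class U (D 1) z1'" "H1_class U (D 2) z2 = H1_class U (D 2) z2'"
    "H1_class U (D 3) z3 = H1_class U (D 3) z3'"
    using pr_C0[OF v, of 1] pr_C0[OF v, of 2] pr_C0[OF v, of 3] unfolding H1_class_D by auto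
qed

lemma C0_add_apply: "(v + w) i = v i + w i" for v w :: "'i \<Rightarrow> ('a, 'e) endo"
  by (intro ext) simp

text \<open>The coboundary is linear and a 0-cochain of \<open>Der_pos\<close> splits into its three
  components. The right side is the elementwise form of the direct sum used in
  \<open>sigma_target\<close>.\<close>

lemma H1_class_Der_pos_sum:
  "H1_class U (Der_pos E) (z1 + z2 + z3) =
     {a + b + c | a b c. a \<in> H1_class U (D 1) z1 \<and> b \<in> H1_class U (D 2) z2 \<and> c \<in> H1_class U (D 3) z3}"
  (is "?L = ?R")
proof
  show "?L \<subseteq> ?R"
  proof
    fix y assume "y \<in> ?L"
    then obtain v where v: "v \<in> C0 U (Der_pos E)" and y: "y = z1 + z2 + z3 + d0 U v"
      unfolding H1_class_def B1_def by auto
    define w where "w = (\<lambda>q i. P q (v i))"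
    have w: "w q \<in> C0 U (D q)" if "1 \<le> q" for q unfolding w_def by (rule pr_C0[OF v that])
    have "v i = (w 1 + w 2 + w 3) i" for i
    proof -
      have "v i = (\<Sum>q=1..3. P q (v i))" by (rule Der_pos_sum[OF C0_mem[OF v]])
      also have "{1..3::nat} = {1, 2, 3}" by auto
      also have "(\<Sum>q\<in>{1, 2, 3}. P q (v i)) = P 1 (v i) + P 2 (v i) + P 3 (v i)" by (simp add: add.assoc)
      finally show ?thesis unfolding w_def C0_add_apply .
    qed
    then have "v = w 1 + w 2 + w 3" by (rule ext)
    then have "y = (z1 + d0 U (w 1)) + (z2 + d0 U (w 2)) + (z3 + d0 U (w 3))"
      by (simp only: y d0_add ac_simps)
    moreover have m: "z + d0 U (w q) \<in> H1_class U (D q) z" if "1 \<le> q" for q z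
      unfolding H1_class_def B1_def using w[OF that] by blast
    ultimately show "y \<in> ?R"
      unfolding mem_Collect_eq
      by (intro exI[of _ "z1 + d0 U (w 1)"] exI[of _ "z2 + d0 U (w 2)"] exI[of _ "z3 + d0 U (w 3)"] conjI m) simp_all
  qed
  show "?R \<subseteq> ?L"
  proof
    fix y assume "y \<in> ?R"
    then obtain w1 w2 w3 where w: "w1 \<in> C0 U (D 1)" "w2 \<in> C0 U (D 2)" "w3 \<in> C0 U (D 3)"
      and y: "y = (z1 + d0 U w1) + (z2 + d0 U w2) + (z3 + d0 U w3)"
      unfolding H1_class_def B1_def by auto
    have "w1 + w2 + w3 \<in> C0 U (Der_pos E)"
    proof (rule C0I)
      fix i
      have "w1 i \<in> Der_pos E (U i)" "w2 i \<in> Der_pos E (U i)" "w3 i \<in> Der_pos E (U i)"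
        using C0_mem[OF C0_D_Der_pos[OF w(1)]] C0_mem[OF C0_D_Der_pos[OF w(2)]] C0_mem[OF C0_D_Der_pos[OF w(3)]] by simp_all
      then show "(w1 + w2 + w3) i \<in> Der_pos E (U i)" unfolding C0_add_apply by (intro Der_pos_add)
    qed
    moreover have "y = z1 + z2 + z3 + d0 U (w1 + w2 + w3)" by (simp only: y d0_add ac_simps)
    ultimately show "y \<in> ?L" unfolding H1_class_def B1_def by blast
  qed
qed

text \<open>The value of \<sigma> on the orbit of \<open>g\<close>, written in terms of the
  multiplicative cocycle; \<open>sum_D'\<close> matches it with the formula in
  \<open>D'\<close>.\<close>

definition tau :: "('i \<Rightarrow> 'i \<Rightarrow> ('a, 'e) endo) \<Rightarrow> ('i \<Rightarrow> 'i \<Rightarrow> ('a, 'e) endo) set" where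
  "tau g = H1_class U (Der_pos E) (zeta 0 g + zeta 1 g + zeta 2 g)"

text \<open>\<open>zeta (q - 1)\<close> is the difference of degree 2q. Beyond degree 6 the value 0
  fits the vanishing of \<open>R\<close> there.\<close>

definition D' :: "nat \<Rightarrow> ('i \<Rightarrow> 'i \<Rightarrow> ('a, 'e) endo) \<Rightarrow> 'i \<Rightarrow> 'i \<Rightarrow> ('a, 'e) endo" where
  "D' q u = (if 2 \<le> q \<and> q \<le> 3 then (\<lambda>i j. zeta (q - 1) (exp_cochain E U u) i j - P q (u i j)) else 0)"

text \<open>As \<zeta> is an additive cocycle, the coboundary of \<zeta> - pr_2q(u) is -d pr_2q(u),
  which is R_2q(u) by \<open>R_eq\<close>. Dependence on lower components comes from
  \<open>normalise_cdif\<close>.\<close>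

lemma admissible_D': "admissible E U D'"
  unfolding admissible_def
proof (intro allI impI conjI ballI)
  fix q :: nat and u assume q2: "2 \<le> q" and u: "u \<in> C1_tilde E U"
  note uC = C1_tildeD(1)[OF u] and g = C1_tildeD(2)[OF u]
  show "D' q u \<in> C1 U (D q)" and "d1 U (D' q u) = R E U (2 * q) u"
  proof -
    have "D' q u \<in> C1 U (D q) \<and> d1 U (D' q u) = R E U (2 * q) u"
    proof (cases "q \<le> 3")
      case True
      define z where "z = zeta (q - 1) (exp_cochain E U u)"
      have "Suc (q - 1) = q" "q - 1 \<le> 2" using q2 True by auto
      then have z: "z \<in> Z1 U (D q)" using zeta_Z1(1)[OF g, of "q - 1"] by (simp only: z_def)
      have zC: "z \<in> C1 U (D q)" and dz: "d1 U z = 0" using z by (simp_all add: Z1_def)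
      have q1: "1 \<le> q" using q2 by simp
      note pC = pr_cochain_C1[OF uC q1]
      have e: "D' q u i j = z i j - pr_cochain E (2 * q) u i j" for i j
        using q2 True by (simp add: D'_def z_def pr_cochain_def)
      have "D' q u \<in> C1 U (D q)"
      proof (rule C1I)
        show "D' q u i j \<in> D q (U2 i j)" for i j unfolding e by (rule Der_deg_diff[OF C1_mem[OF zC] C1_mem[OF pC]])
        show "D' q u j i = - D' q u i j" for i j
          unfolding e C1_alt[OF zC, of j i] C1_alt[OF pC, of j i] by simp
      qed
      moreover have "d1 U (D' q u) i j k = R E U (2 * q) u i j k" for i j k
      proof -
        have "d1 U (D' q u) i j k = d1 U z i j k - d1 U (pr_cochain E (2 * q) u) i j k"
          unfolding d1_def endo_restrict_diff[symmetric] e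
          by (rule arg_cong[where f="endo_restrict _"]) (simp only: diff_conv_add_uminus minus_add_distrib minus_minus ac_simps)
        then show ?thesis unfolding R_eq[OF u q1 True] dz by simp
      qed
      ultimately show ?thesis by (simp add: fun_eq_iff)
    next
      case False
      then have z: "D' q u = 0" by (simp add: D'_def)
      have "R E U (2 * q) u i j k = 0" for i j k
        unfolding R_def
        by (rule pr_large[OF G_filt[OF mult_cobdry_G[OF exp_cochain_C1_G[OF pr_upto_cochain_C1[OF uC]]]]])
          (use False q2 in auto)
      moreover have "d1 U (0 :: 'i \<Rightarrow> 'i \<Rightarrow> ('a, 'e) endo) i j k = 0" for i j k
        by (intro ext) (simp add: d1_def endo_restrict_def)
      moreover have "0 \<in> C1 U (D q)" by (rule C1I) (simp_all add: Der_deg_zero)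
      ultimately show ?thesis unfolding z by (simp add: fun_eq_iff)
    qed
    then show "D' q u \<in> C1 U (D q)" "d1 U (D' q u) = R E U (2 * q) u" by auto
  qed
next
  fix q :: nat and u u' assume q2: "2 \<le> q" and u: "u \<in> C1_tilde E U" and u': "u' \<in> C1_tilde E U"
    and eq: "pr_upto_cochain E (2 * q - 2) u = pr_upto_cochain E (2 * q - 2) u'"
  show "D' q u = D' q u'"
  proof (cases "q \<le> 3")
    case True
    have q1: "1 \<le> q" using q2 by simp
    have low: "P p (u i j) = P p (u' i j)" if "1 \<le> p" "p < q" for p i j
    proof -
      have "pr_upto E (2 * q - 2) (u i j) = pr_upto E (2 * q - 2) (u' i j)"
        using fun_cong[OF fun_cong[OF eq, of i], of j] by (simp add: pr_upto_cochain_def)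
      then show ?thesis
        using pr_pr_upto[OF C1_mem[OF C1_tildeD(1)[OF u]] q1, of p i j] pr_pr_upto[OF C1_mem[OF C1_tildeD(1)[OF u']] q1, of p i j] that
        by simp
    qed
    define n where "n = q - 1"
    have n: "n < q" "Suc n = q" using q2 by (auto simp: n_def)
    have c: "cdif q (exp_cochain E U u) (exp_cochain E U u') (\<lambda>i j. P q (u i j) - P q (u' i j))"
      by (rule cdif_exp[OF C1_tildeD(1)[OF u] C1_tildeD(1)[OF u'] q1 True low])
    note N = normalise_cdif[OF C1_tildeD(2)[OF u] C1_tildeD(2)[OF u'] c True n(1)]
    show ?thesis
    proof (rule ext, rule ext)
      fix i j
      have "P q (H n (exp_cochain E U u) i j) = P q (H n (exp_cochain E U u') i j) + (P q (u i j) - P q (u' i j))"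
        using cdif_top N by blast
      \<comment> \<open>The bases coincide, so \<zeta> and pr_2q(u) change by the same amount and
        their difference does not change.\<close>
      then have "zeta n (exp_cochain E U u) i j - P q (u i j) = zeta n (exp_cochain E U u') i j - P q (u' i j)"
        unfolding zeta_def n(2) N[THEN conjunct1] by (rule diff_diff_eq_if_eq_add_diff)
      then show "D' q u i j = D' q u' i j" using q2 True by (simp add: D'_def n_def)
    qed
  qed (simp add: D'_def)
qed

text \<open>The summands -pr_4(u) and -pr_6(u) in \<open>D'\<close> cancel the upper components of
  \<open>u\<close>. In degree 2 the base is the trivial cocycle, so \<open>zeta 0\<close> is the
  component of \<open>u\<close> itself.\<close>

lemma sum_D':
  assumes u: "u \<in> C1_tilde E U" and r: "3 \<le> rk E"
  shows "u + (\<Sum>q=2..rk E. D' q u) =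
    zeta 0 (exp_cochain E U u) + zeta 1 (exp_cochain E U u) + zeta 2 (exp_cochain E U u)"
proof -
  have "(\<Sum>q=2..rk E. D' q u) = (\<Sum>q\<in>{2, 3}. D' q u)"
    by (rule sum.mono_neutral_right) (use r in \<open>auto simp: D'_def\<close>)
  also have "\<dots> = D' 2 u + D' 3 u" by simp
  finally have s: "(\<Sum>q=2..rk E. D' q u) = D' 2 u + D' 3 u" .
  show ?thesis
    unfolding s
  proof (rule ext, rule ext)
    fix i j
    let ?g = "exp_cochain E U u"
    note V = C1_mem[OF C1_tildeD(1)[OF u], of i j]
    have z0: "zeta 0 ?g i j = P 1 (u i j)"
      using pr_exp(2)[OF V] pr_id_cochain[of 1 i j] by (simp add: zeta_def exp_cochain_def)
    have "u i j = (\<Sum>q=1..3. P q (u i j))" by (rule Der_pos_sum[OF V])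
    also have "{1..3::nat} = {1, 2, 3}" by auto
    also have "(\<Sum>q\<in>{1, 2, 3}. P q (u i j)) = P 1 (u i j) + (P 2 (u i j) + P 3 (u i j))" by simp
    finally have uij: "u i j = P 1 (u i j) + (P 2 (u i j) + P 3 (u i j))" .
    have "D' 2 u i j = zeta 1 ?g i j - P 2 (u i j)" "D' 3 u i j = zeta 2 ?g i j - P 3 (u i j)"
      by (simp_all add: D'_def)
    then have "(u + (D' 2 u + D' 3 u)) i j =
        (P 1 (u i j) + (P 2 (u i j) + P 3 (u i j))) + ((zeta 1 ?g i j - P 2 (u i j)) + (zeta 2 ?g i j - P 3 (u i j)))"
      using uij by (simp only: cochain_add_apply)
    also have "\<dots> = P 1 (u i j) + zeta 1 ?g i j + zeta 2 ?g i j" by (simp add: algebra_simps)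
    finally show "(u + (D' 2 u + D' 3 u)) i j = (zeta 0 ?g + zeta 1 ?g + zeta 2 ?g) i j"
      by (simp only: cochain_add_apply z0)
  qed
qed

end

section \<open>Consequences of the vanishing of H^0\<close>

locale rigid_low_rank_cover = low_rank_cover +
  assumes H0: "H0_vanishes U (Der_pos E)"
begin

lemma d0_eq_0: "v \<in> C0 U (D q) \<Longrightarrow> 1 \<le> q \<Longrightarrow> d0 U v = 0 \<Longrightarrow> v = 0"
  using H0 C0_D_Der_pos unfolding H0_vanishes_def by blast

text \<open>If the action changes nothing below degree 2q, the components of \<open>v\<close> there
  have coboundary 0 one after the other, and vanish as H^0 does. So \<open>v\<close> starts in
  degree 2q, where \<open>act_cdif_self\<close> computes its effect.\<close>

lemma act_cdif_rigid:
  assumes v: "v \<in> C0 U (Der_pos E)" and g: "g \<in> C1_G" and x: "cdif q (act E U v g) g x" and q: "1 \<le> q" "q \<le> 3"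
  shows "x = - d0 U (\<lambda>i. P q (v i))"
proof -
  have "\<forall>i. P p (v i) = 0" if "1 \<le> p" "p < q" for p
    using that
  proof (induction p rule: less_induct)
    case (less p)
    have "cdif p (act E U v g) g (- d0 U (\<lambda>i. P p (v i)))"
      by (rule act_cdif_self[OF v g]) (use less q in auto)
    moreover have "cdif p (act E U v g) g 0" by (rule cdif_less[OF x less.prems(2)])
    ultimately have "- d0 U (\<lambda>i. P p (v i)) = 0" by (rule cdif_unique)
    then have "d0 U (\<lambda>i. P p (v i)) = 0" by (metis minus_minus minus_zero)
    then have "(\<lambda>i. P p (v i)) = 0" by (rule d0_eq_0[OF pr_C0[OF v less.prems(1)] less.prems(1)])
    then show ?case by (metis zero_fun_apply)
  qed
  then have "cdif q (act E U v g) g (- d0 U (\<lambda>i. P q (v i)))"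
    by (intro act_cdif_self[OF v g q]) blast
  then show ?thesis by (rule cdif_unique[OF x])
qed

text \<open>With a common base, the two partly normalised cocycles lie in one orbit and agree below
  the current degree. By rigidity their \<zeta> differ by a coboundary, so the next representative
  and the next base are common as well.\<close>

lemma zeta_class_orbit:
  assumes g: "g \<in> Z1_G E U" and g': "g' \<in> Z1_G E U" and o: "g' \<in> orbit E U g" and n: "n \<le> 3"
  shows "B n g = B n g' \<and> (n \<le> 2 \<longrightarrow> H1_class U (D (Suc n)) (zeta n g) = H1_class U (D (Suc n)) (zeta n g'))"
proof -
  have cls: "H1_class U (D (Suc n)) (zeta n g) = H1_class U (D (Suc n)) (zeta n g')"
    if n: "n \<le> 2" and B: "B n g = B n g'" for n
  proof -
    have n3: "n \<le> 3" and q: "1 \<le> Suc n" "Suc n \<le> 3" using n by auto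
    note a = normalise_Z1[OF g n3] and a' = normalise_Z1[OF g' n3]
    have "H n g' \<in> orbit E U (H n g)"
      using orbit_trans[OF orbit_sym[OF Z1_G_C1_G[OF g]] orbit_trans[OF o]] a a' by blast
    then obtain v where v: "v \<in> C0 U (Der_pos E)" "H n g' = act E U v (H n g)" unfolding orbit_iff by blast
    have "cdif (Suc n) (H n g') (H n g) (zeta n g' + - zeta n g)"
      using cdif_trans[OF zeta_Z1(2)[OF g' n] cdif_sym[OF zeta_Z1(2)[OF g n, unfolded B]]] .
    then have "zeta n g' + - zeta n g = - d0 U (\<lambda>i. P (Suc n) (v i))"
      unfolding v(2) using act_cdif_rigid[OF v(1) Z1_G_C1_G _ q] a by blast
    then have "zeta n g = zeta n g' + d0 U (\<lambda>i. P (Suc n) (v i))"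
      by (rule eq_add_if_diff_eq_uminus)
    then have "H1_class U (D (Suc n)) (zeta n g') = H1_class U (D (Suc n)) (zeta n g)"
      unfolding H1_class_D using pr_C0[OF v(1) q(1)] by blast
    then show ?thesis ..
  qed
  show ?thesis
    using n
  proof (induction n)
    case 0
    show ?case using cls[of 0] by simp
  next
    case (Suc n)
    then have IH: "B n g = B n g'" "H1_class U (D (Suc n)) (zeta n g) = H1_class U (D (Suc n)) (zeta n g')" by auto
    have "B (Suc n) g = B (Suc n) g'" unfolding B_Suc IH(1) rep_cong[OF IH(2)] ..
    then show ?case using cls[of "Suc n"] by blast
  qed
qed

lemma tau_eq_iff:
  assumes g: "g \<in> Z1_G E U" and g': "g' \<in> Z1_G E U"
  shows "tau g = tau g' \<longleftrightarrow> g' \<in> orbit E U g"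
proof
  have s: "Suc 0 = 1" "Suc 1 = 2" "Suc 2 = 3" by simp_all
  note z = zeta_Z1(1)[OF g, of 0, unfolded s] zeta_Z1(1)[OF g, of 1, unfolded s] zeta_Z1(1)[OF g, of 2, unfolded s]
  note z' = zeta_Z1(1)[OF g', of 0, unfolded s] zeta_Z1(1)[OF g', of 1, unfolded s] zeta_Z1(1)[OF g', of 2, unfolded s]
  {
    assume "tau g = tau g'"
    note c = Der_pos_class_imp[OF z z' this[unfolded tau_def]]
    show "g' \<in> orbit E U g"
    proof (rule zeta_classes_determine_orbit[OF g g'])
      fix n :: nat assume "n \<le> 2"
      then have "n = 0 \<or> n = 1 \<or> n = 2" by auto
      then show "H1_class U (D (Suc n)) (zeta n g) = H1_class U (D (Suc n)) (zeta n g')"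
        using c by (auto simp only: s)
    qed
  }
  assume o: "g' \<in> orbit E U g"
  show "tau g = tau g'"
    unfolding tau_def H1_class_Der_pos_sum
    using zeta_class_orbit[OF g g' o, of 0] zeta_class_orbit[OF g g' o, of 1] zeta_class_orbit[OF g g' o, of 2]
    by (simp only: s)
qed

text \<open>A cocycle assembled from the chosen representatives of the given classes is a fixed
  point of the normalisation: each \<zeta> is already the chosen representative, and the 0-cochain
  that acts has coboundary 0.\<close>

lemma tau_surj:
  assumes z: "\<And>n. n \<le> 2 \<Longrightarrow> z n \<in> Z1 U (D (Suc n))"
  obtains g where "g \<in> Z1_G E U" "\<And>n. n \<le> 2 \<Longrightarrow> H1_class U (D (Suc n)) (zeta n g) = H1_class U (D (Suc n)) (z n)"
proof -
  have s: "Suc 1 = 2" "Suc 2 = 3" by simp_all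
  \<comment> \<open>The recursion of the base cocycles in \<open>normalise\<close>, driven by the
    prescribed cocycles instead of those measured on \<open>g\<close>.\<close>
  define b where "b = rec_nat id_cochain (\<lambda>n b. translate (Suc n) b (rep (Suc n) (z n)))"
  have b0: "b 0 = id_cochain" and bS: "b (Suc n) = translate (Suc n) (b n) (rep (Suc n) (z n))" for n
    by (simp_all add: b_def)
  have bZ: "b n \<in> Z1_G E U" if "n \<le> 3" for n
    using that
  proof (induction n)
    case 0
    show ?case unfolding b0 by (rule id_cochain_Z1_G)
  next
    case (Suc n)
    then show ?case unfolding bS by (intro translate(1) rep_Z1 z) auto
  qed
  have bd: "cdif (Suc n) (b (Suc n)) (b n) (rep (Suc n) (z n))" if "n \<le> 2" for n
    unfolding bS by (intro translate(2) rep_Z1 z bZ) (use that in auto)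
  define g where "g = b 3"
  have gZ: "g \<in> Z1_G E U" unfolding g_def by (rule bZ) simp
  have gb: "cdif n g (b n) 0" if "n \<le> 3" for n
  proof -
    have "cdif 3 g (b 3) 0" unfolding g_def by (rule cdif_refl[OF Z1_G_C1_G[OF bZ]]) simp
    moreover have g2: "cdif 2 g (b 2) 0"
    proof -
      have "cdif 3 g (b 2) (rep 3 (z 2))" unfolding g_def using bd[of 2, unfolded s] by simp
      then show ?thesis by (rule cdif_less) simp
    qed
    moreover have "cdif 1 g (b 1) 0"
    proof -
      have "cdif 2 (b 2) (b 1) (rep 2 (z 1))" using bd[of 1, unfolded s] by simp
      then have "cdif 2 g (b 1) (0 + rep 2 (z 1))" by (rule cdif_trans[OF g2])
      then show ?thesis by (rule cdif_less) simp
    qed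
    moreover have "cdif 0 g (b 0) 0" by (rule cdif_0[OF Z1_G_C1_G[OF gZ] Z1_G_C1_G[OF bZ]]) simp
    moreover have "n = 0 \<or> n = 1 \<or> n = 2 \<or> n = 3" using that by auto
    ultimately show ?thesis by blast
  qed
  have gd: "cdif (Suc n) g (b n) (rep (Suc n) (z n))" if "n \<le> 2" for n
  proof -
    have "Suc n \<le> 3" using that by simp
    from cdif_trans[OF gb[OF this] bd[OF that]] show ?thesis by simp
  qed
  have N: "H n g = g \<and> B n g = b n \<and> (n \<le> 2 \<longrightarrow> zeta n g = rep (Suc n) (z n))" if "n \<le> 3" for n
  proof -
    have zt: "zeta n g = rep (Suc n) (z n)" if "n \<le> 2" "H n g = g" "B n g = b n" for n
      by (rule cdif_unique[OF zeta_Z1(2)[OF gZ that(1)]]) (simp only: that(2,3) gd[OF that(1)])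
    show ?thesis
      using that
    proof (induction n)
      case 0
      show ?case using zt[of 0] b0 by simp
    next
      case (Suc n)
      then have IH: "H n g = g" "B n g = b n" "zeta n g = rep (Suc n) (z n)" by auto
      have rr: "rep (Suc n) (zeta n g) = rep (Suc n) (z n)" unfolding IH(3) by (rule rep_cong[OF rep_class])
      \<comment> \<open>Vanishing of H^0 makes this arbitrarily chosen 0-cochain zero, so the step
        leaves \<open>g\<close> itself unchanged and not just its orbit.\<close>
      have "d0 U (bounding (Suc n) (zeta n g)) = 0"
        unfolding bounding(2) rr unfolding IH(3) by simp
      then have "bounding (Suc n) (zeta n g) = 0" by (rule d0_eq_0[OF bounding(1), rotated]) simp
      then have "H (Suc n) g = g" unfolding H_Suc IH(1) by (simp only: act_zero[OF Z1_G_C1_G[OF gZ]])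
      moreover have "B (Suc n) g = b (Suc n)" unfolding B_Suc rr IH(2) bS ..
      ultimately show ?case using zt[of "Suc n"] by blast
    qed
  qed
  show thesis
  proof (rule that[OF gZ])
    show "H1_class U (D (Suc n)) (zeta n g) = H1_class U (D (Suc n)) (z n)" if "n \<le> 2" for n
    proof -
      have "zeta n g = rep (Suc n) (z n)" using N[of n] that by simp
      then show ?thesis by (simp only: rep_class)
    qed
  qed
qed

lemma tau_image: "tau ` Z1_G E U = sigma_target E U"
proof
  have s: "Suc 0 = 1" "Suc 1 = 2" "Suc 2 = 3" by simp_all
  have d: "Der_deg E 2 = D 1" "Der_deg E 4 = D 2" "Der_deg E 6 = D 3" by simp_all
  show "tau ` Z1_G E U \<subseteq> sigma_target E U"
  proof
    fix X assume "X \<in> tau ` Z1_G E U"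
    then obtain g where g: "g \<in> Z1_G E U" and X: "X = tau g" by blast
    note z = zeta_Z1(1)[OF g, of 0, unfolded s] zeta_Z1(1)[OF g, of 1, unfolded s] zeta_Z1(1)[OF g, of 2, unfolded s]
    have "H1_class U (D 1) (zeta 0 g) \<in> H1_class U (D 1) ` Z1 U (D 1)" "H1_class U (D 2) (zeta 1 g) \<in> H1 U (D 2)"
      "H1_class U (D 3) (zeta 2 g) \<in> H1 U (D 3)"
      unfolding H1_def using z by (auto simp only: zero_le order_refl one_le_numeral intro!: imageI)
    then show "X \<in> sigma_target E U"
      unfolding sigma_target_def X tau_def H1_class_Der_pos_sum d Z1_tilde_eq by blast
  qed
  show "sigma_target E U \<subseteq> tau ` Z1_G E U"
  proof
    fix X assume "X \<in> sigma_target E U"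
    then obtain z1 z2 z3 where z: "z1 \<in> Z1 U (D 1)" "z2 \<in> Z1 U (D 2)" "z3 \<in> Z1 U (D 3)"
      and X: "X = {a + b + c | a b c. a \<in> H1_class U (D 1) z1 \<and> b \<in> H1_class U (D 2) z2 \<and> c \<in> H1_class U (D 3) z3}"
      unfolding sigma_target_def d Z1_tilde_eq H1_def by blast
    define z where "z = (\<lambda>n::nat. if n = 0 then z1 else if n = 1 then z2 else z3)"
    have zv: "z 0 = z1" "z 1 = z2" "z 2 = z3" by (simp_all add: z_def)
    have "z n \<in> Z1 U (D (Suc n))" if "n \<le> 2" for n
    proof -
      have "n = 0 \<or> n = 1 \<or> n = 2" using that by auto
      then show ?thesis using z by (auto simp only: s zv)
    qed
    then obtain g where g: "g \<in> Z1_G E U"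
      and c: "\<And>n. n \<le> 2 \<Longrightarrow> H1_class U (D (Suc n)) (zeta n g) = H1_class U (D (Suc n)) (z n)"
      using tau_surj by blast
    have "tau g = X"
      unfolding tau_def H1_class_Der_pos_sum X using c[of 0] c[of 1] c[of 2] by (simp only: s zv zero_le order_refl one_le_numeral simp_thms)
    then show "X \<in> tau ` Z1_G E U" using g by blast
  qed
qed

text \<open>The value is read off from a chosen cocycle in the orbit. The two directions of
  \<open>tau_eq_iff\<close> give independence of this choice and injectivity;
  \<open>tau_image\<close> gives the range.\<close>

lemma sigma_bij:
  obtains \<sigma> where "bij_betw \<sigma> (H1_G E U) (sigma_target E U)" "\<And>g. g \<in> Z1_G E U \<Longrightarrow> \<sigma> (orbit E U g) = tau g"
proof -
  define \<sigma> where "\<sigma> = (\<lambda>X. tau (SOME g. g \<in> Z1_G E U \<and> orbit E U g = X))"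
  have \<sigma>: "\<sigma> (orbit E U g) = tau g" if g: "g \<in> Z1_G E U" for g
  proof -
    define h where "h = (SOME h. h \<in> Z1_G E U \<and> orbit E U h = orbit E U g)"
    have h: "h \<in> Z1_G E U" "orbit E U h = orbit E U g"
      unfolding h_def using someI[of "\<lambda>h. h \<in> Z1_G E U \<and> orbit E U h = orbit E U g" g] g by auto
    then have "tau h = tau g"
      using tau_eq_iff[OF h(1) g] orbit_eq_iff[OF Z1_G_C1_G[OF h(1)] Z1_G_C1_G[OF g]] by blast
    then show ?thesis by (simp add: \<sigma>_def h_def)
  qed
  have "inj_on \<sigma> (H1_G E U)"
    unfolding H1_G_def
  proof (rule inj_onI, elim imageE)
    fix X Y g h assume g: "g \<in> Z1_G E U" "X = orbit E U g" and h: "h \<in> Z1_G E U" "Y = orbit E U h" and eq: "\<sigma> X = \<sigma> Y"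
    then show "X = Y"
      using tau_eq_iff[OF g(1) h(1)] orbit_eq_iff[OF Z1_G_C1_G[OF g(1)] Z1_G_C1_G[OF h(1)]] \<sigma> by simp
  qed
  moreover have "\<sigma> ` H1_G E U = sigma_target E U"
    unfolding H1_G_def tau_image[symmetric] using \<sigma> by (force simp: image_iff)
  ultimately show thesis using that \<sigma> by (auto simp: bij_betw_def)
qed

end

theorem corollary2p2:
  fixes E :: "('a::{t2_space,second_countable_topology}, 'e) vbundle"
    and U :: "'i \<Rightarrow> 'a set"
  assumes "holomorphic_vector_bundle E"
    and "rk E = 6 \<or> rk E = 7"
    and "leray_cover E U"
    and "H2_vanishes U (Der_deg E 4)"
    and "H2_vanishes U (Der_deg E 6)"
  shows "(\<forall>u2\<in>C1 U (Der_deg E 2).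
            (\<exists>u\<in>C1_tilde E U. pr_cochain E 2 u = u2) \<longleftrightarrow> u2 \<in> Z1_tilde E U) \<and>
         (H0_vanishes U (Der_pos E) \<longrightarrow>
            (\<exists>D'. admissible E U D' \<and>
               (\<exists>\<sigma>. bij_betw \<sigma> (H1_G E U) (sigma_target E U) \<and>
                    (\<forall>u\<in>C1_tilde E U.
                       \<sigma> (orbit E U (exp_cochain E U u)) =
                         H1_class U (Der_pos E) (u + (\<Sum>q=2..rk E. D' q u))))))"
proof -
  interpret low_rank_cover E U
    by unfold_locales (use assms in auto)
  have r: "3 \<le> rk E" using assms(2) by auto
  have "\<exists>D'. admissible E U D' \<and>
      (\<exists>\<sigma>. bij_betw \<sigma> (H1_G E U) (sigma_target E U) \<and>
        (\<forall>u\<in>C1_tilde E U. \<sigma> (orbit E U (exp_cochain E U u)) =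
           H1_class U (Der_pos E) (u + (\<Sum>q=2..rk E. D' q u))))"
    if H0: "H0_vanishes U (Der_pos E)"
  proof -
    interpret rigid_low_rank_cover E U by unfold_locales (rule H0)
    obtain \<sigma> where \<sigma>: "bij_betw \<sigma> (H1_G E U) (sigma_target E U)"
      "\<And>g. g \<in> Z1_G E U \<Longrightarrow> \<sigma> (orbit E U g) = tau g"
      by (rule sigma_bij) blast
    have "\<sigma> (orbit E U (exp_cochain E U u)) = H1_class U (Der_pos E) (u + (\<Sum>q=2..rk E. D' q u))"
      if u: "u \<in> C1_tilde E U" for u
      unfolding \<sigma>(2)[OF C1_tildeD(2)[OF u]] tau_def sum_D'[OF u r] ..
    with admissible_D' \<sigma>(1) show ?thesis by blast
  qed
  then show ?thesis using C1_tilde_pr_2_iff by blast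
qed

end
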